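(* Let $Q$ be $\mathbb R^n$ or $\mathbb Z^n$, let $Z\in\mathcal Z(Q)$ be a stability condition over $Q$ and let $V,W\in\mathrm{Pers}_{\mathrm{fp}}(Q)$. Then for each $\theta\in\mathbb R$, the HN filtered rank invariants $s^\theta_{Z,V}$ and $s^\theta_{Z,W}$ are functors $Q^{\mathrm{opp}}\times Q\to(\mathbb Z_+\cup\{+\infty\})^{\mathrm{opp}}$. Moreover, \[\sup_{\theta\in\mathbb R}d_E(s^\theta_{Z,V},s^\theta_{Z,W})\leqslant d_I(V,W).\]
   Context: Persistence modules. Fix a field $\mathbb{F}$. $Q=\mathbb R^n$ or $\mathbb Z^n$ with product order. $\mathrm{Pers}(Q)$ is the category of functors $V\colon Q\to\mathrm{Vect}_{\mathbb F}$ with all $V_q$ finite-dimensional; $\underline{\dim}_V\colon q\mapsto\dim V_q$. $\mathrm{Pers}_{\mathrm{fp}}(Q)$ is the (abelian) full subcategory of discretisable (equivalently finitely presentable) modules, i.e. those isomorphic to a left Kan extension $f_*U$ of some $U\in\mathrm{Pers}(P)$ along an order-preserving map $f\colon P\to Q$ with $P$ finite. Stability. For an abelian category $\mathcal A$, a stability condition is a group homomorphism $Z\colon K(\mathcal A)\to\mathbb C$ sending nonzero objects to $\{\operatorname{Re} z>0\}$. The slope of $V\ne0$ is $\mu_Z(V)=\operatorname{Im}Z([V])/\operatorname{Re}Z([V])$; $V\neq0$ is $Z$-semistable if $\mu_Z(W)\leqslant\mu_Z(V)$ for all nonzero subobjects $W$. An HN filtration of $V\neq0$ is a finite filtration $0=V^0\subsetneq\dots\subsetneq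 V^\ell=V$ with $Z$-semistable quotients $V^j/V^{j-1}$ of strictly decreasing slopes (unique when it exists). Write $\langle V,Z\rangle^\theta:=V^i$ where $\mu_Z(V^i/V^{i-1})\geqslant\theta>\mu_Z(V^{i+1}/V^i)$ (conventions $\mu_Z(V^0/V^{-1})=+\infty$, $\mu_Z(V^{\ell+1}/V^\ell)=-\infty$), and $\langle0,Z\rangle^\theta=0$. A stability condition over $Q$ is one on $\mathrm{Pers}_{\mathrm{fp}}(Q)$. Grid functions. A cube is a product of intervals (order-convex subsets). A grid function is a product $G=G_1\times\dots\times G_n\colon P=P_1\times\dots\times P_n\hookrightarrow Q$ where $P$ is a cube of $\mathbb Z^n$, each $G_i$ is strictly increasing, and $G_i(t)\to\pm\infty$ as $t\to\pm\infty$ if $P_i$ is unbounded in that direction. It is finite if $P$ is. $\lfloor q\rfloor_G=\max\{p: G(p)\leqslant q\}\in P\cup\{-\infty\}$ ($-\infty$ if the set is empty), $\mathrm{cub}_G(p)=\{q:\lfloor q\rfloor_G=p\}$; for $p\in P$ it is a product $\prod_i[a_i,b_i)$, $b_i\leqslant\infty$. A function $a\colon Q\to\mathbb R$ is $G$-discretisable if $a(q)=a'(\lfloor q\rfloor_G)$ for some $a'\colon P\to\mathbb R$ (with $a'(-\infty)=0$). A refinement of $G$ is a grid function $G'$ with $G=G'\circ g$ for some order-preserving $g$; it is an extension if $\operatorname{Im}G=\operatorname{Im}G'\cap c$ for some cube $c$ of $Q$. Integrals are for Lebesgue measure (counting measure for $\mathbb Z^n$). For a nonempty bounded cube $c$,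 $\delta_c(h)=\int_ch/\int_c1$, the integral being $\dim c$-dimensional, where $\dim c$ is the number of coordinates in which the projection of $c$ has nonempty interior ($\delta_{\{x\}}$ is evaluation at $x$). The faces of a bounded $\prod_i[a_i,b_i)$ are the products $\prod J_i$ with $J_i\in\{[a_i,b_i),\{a_i\},\{b_i\}\}$. $\mathcal Z(Q)$. For $G$ a finite grid function, $\mathcal Z^{\mathrm{step}}(G)$ is the set of stability conditions of the form $Z([V])=\int_Q(b+\sqrt{-1}a)\,\underline{\dim}_V$ with $a,b\colon Q\to\mathbb R$ discretisable by an extension of $G$, $a$ null on all unbounded $\mathrm{cub}_G(x)$, $x\in P\cup\{-\infty\}$, and $b$ strictly positive and integrable. $\mathcal Z(G)$ is the set of stability conditions of the form $[V]\mapsto Z([V])+\sqrt{-1}\sum_c\lambda_c\delta_c(\underline{\dim}_V)$ with $Z\in\mathcal Z^{\mathrm{step}}(G)$, the sum over faces $c$ of the bounded cubes $\mathrm{cub}_G(x)$, $x\in P$, and $\lambda_c\geqslant0$. $\mathcal Z(Q)=\bigcup_{G\text{ finite}}\mathcal Z(G)$. For $Z\in\mathcal Z(Q)$, HN filtrations along $Z$ of nonzero modules in $\mathrm{Pers}_{\mathrm{fp}}(Q)$ exist. HN filtered rank invariant. For $x\in Q$, $(T_x^*V)_y=V_{x+y}$. For $V\in\mathrm{Pers}_{\mathrm{fp}}(Q)$ and $\theta\in\mathbb R$, $s_{Z,V}^\theta\colon Q\times Q\to\mathbb Z_+\cup\{+\infty\}$ is $s_{Z,V}^\theta(x,y)=\operatorname{rank}\big((\langle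 T_x^*V,Z\rangle^\theta)_{0}\to(\langle T_x^*V,Z\rangle^\theta)_{y-x}\big)$ if $x\leqslant y$, and $+\infty$ otherwise. Posets are viewed as categories; so a functor $s\colon Q^{\mathrm{opp}}\times Q\to(\mathbb Z_+\cup\{+\infty\})^{\mathrm{opp}}$ is a function with $s(x,y)\leqslant s(x',y')$ whenever $x\leqslant x'$ and $y'\leqslant y$. Distances. $\vec\varepsilon=(\varepsilon,\dots,\varepsilon)\in Q$ (so $\varepsilon$ is an integer if $Q=\mathbb Z^n$). An $\varepsilon$-interleaving between $V,W$ is a pair of maps $f\colon V\to T^*_{\vec\varepsilon}W$, $g\colon W\to T^*_{\vec\varepsilon}V$ with $T^*_{\vec\varepsilon}g\circ f$ and $T^*_{\vec\varepsilon}f\circ g$ equal to the maps $V\to T^*_{2\vec\varepsilon}V$, $W\to T^*_{2\vec\varepsilon}W$ given by the internal maps. $d_I(V,W)$ is the infimum of $\varepsilon\geqslant0$ for which an $\varepsilon$-interleaving exists. For functors $r,s\colon Q^{\mathrm{opp}}\times Q\to(\mathbb Z_+\cup\{+\infty\})^{\mathrm{opp}}$, $d_E(r,s)$ is the infimum of $\varepsilon\geqslant0$ such that $r(a-\vec\varepsilon,b+\vec\varepsilon)\leqslant s(a,b)$ and $s(a-\vec\varepsilon,b+\vec\varepsilon)\leqslant r(a,b)$ for all $a,b\in Q$. *)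

theory Defs
  imports
    "HOL-Analysis.Analysis"
    "HOL-Algebra.Free_Abelian_Groups"
    "HOL-Computational_Algebra.Polynomial"
begin

section \<open>The posets $\mathbb R^n$ and $\mathbb Z^n$\<close>

text \<open>
  The poset \<open>Q\<close> is the type \<open>real ^ 'n\<close> or \<open>int ^ 'n\<close> with the product order. The class below
  exists only to write each definition once for both; its only instances are \<^typ>\<open>real\<close> and
  \<^typ>\<open>int\<close>.
\<close>

class grid_coord = linordered_idom + linorder_topology +
  fixes coord_measure :: "'a measure"
    and real_of_coord :: "'a \<Rightarrow> real"

instantiation real :: grid_coord
begin
definition coord_measure_real :: "real measure" where "coord_measure_real = lborel"
definition real_of_coord_real :: "real \<Rightarrow> real" where "real_of_coord_real x = x"
instance ..
end

instantiation int :: grid_coord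
begin
definition coord_measure_int :: "int measure" where "coord_measure_int = count_space UNIV"
definition real_of_coord_int :: "int \<Rightarrow> real" where "real_of_coord_int x = real_of_int x"
instance ..
end


section \<open>Pointwise finite-dimensional persistence modules\<close>

text \<open>
  The category of finite-dimensional vector spaces over the field \<open>'k\<close> is modelled by the
  finite-dimensional subspaces of one fixed vector space of infinite dimension, namely \<open>'k poly\<close>
  with its scalar multiplication (the ring structure of polynomials is never used), with the
  linear maps between them. Every finite-dimensional vector space is isomorphic to such a subspace.
\<close>

global_interpretation amb: vector_space "smult :: 'k::field \<Rightarrow> 'k poly \<Rightarrow> 'k poly"
  by unfold_locales (simp_all add: smult_add_right smult_add_left)

definition fin_dim_subspace :: "'k::field poly set \<Rightarrow> bool" where
  "fin_dim_subspace A \<longleftrightarrow> amb.subspace A \<and> (\<exists>B. finite B \<and> A = amb.span B)"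

definition linear_between :: "'k::field poly set \<Rightarrow> 'k poly set \<Rightarrow> ('k poly \<Rightarrow> 'k poly) \<Rightarrow> bool" where
  "linear_between A B f \<longleftrightarrow>
     f ` A \<subseteq> B \<and>
     (\<forall>u\<in>A. \<forall>v\<in>A. f (u + v) = f u + f v) \<and>
     (\<forall>c. \<forall>u\<in>A. f (smult c u) = smult c (f u))"

text \<open>
  A functor \<open>V\<close> from a poset to vector spaces: \<open>fib V q\<close> is the space \<open>V\<^sub>q\<close>, and \<open>tmap V q r\<close>
  is the internal map \<open>V\<^sub>q \<rightarrow> V\<^sub>r\<close>, relevant only if \<open>q \<le> r\<close> and only on elements of \<open>V\<^sub>q\<close>.
\<close>

record (overloaded) ('q, 'k) pmod =
  fib :: "'q \<Rightarrow> 'k poly set"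
  tmap :: "'q \<Rightarrow> 'q \<Rightarrow> 'k poly \<Rightarrow> 'k poly"

definition Pers_on :: "'q set \<Rightarrow> ('q \<Rightarrow> 'q \<Rightarrow> bool) \<Rightarrow> ('q, 'k::field) pmod set" where
  "Pers_on S rel = {V.
     (\<forall>q\<in>S. fin_dim_subspace (fib V q)) \<and>
     (\<forall>q\<in>S. \<forall>r\<in>S. rel q r \<longrightarrow> linear_between (fib V q) (fib V r) (tmap V q r)) \<and>
     (\<forall>q\<in>S. \<forall>v\<in>fib V q. tmap V q q v = v) \<and>
     (\<forall>p\<in>S. \<forall>q\<in>S. \<forall>r\<in>S. rel p q \<longrightarrow> rel q r \<longrightarrow>
        (\<forall>v\<in>fib V p. tmap V q r (tmap V p q v) = tmap V p r v))}"

definition pers_hom_on ::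
    "'q set \<Rightarrow> ('q \<Rightarrow> 'q \<Rightarrow> bool) \<Rightarrow> ('q, 'k::field) pmod \<Rightarrow> ('q, 'k) pmod
      \<Rightarrow> ('q \<Rightarrow> 'k poly \<Rightarrow> 'k poly) \<Rightarrow> bool" where
  "pers_hom_on S rel V W f \<longleftrightarrow>
     (\<forall>q\<in>S. linear_between (fib V q) (fib W q) (f q)) \<and>
     (\<forall>q\<in>S. \<forall>r\<in>S. rel q r \<longrightarrow> (\<forall>v\<in>fib V q. f r (tmap V q r v) = tmap W q r (f q v)))"

abbreviation Pers :: "('q::order, 'k::field) pmod set" where
  "Pers \<equiv> Pers_on UNIV (\<le>)"

abbreviation pers_hom ::
    "('q::order, 'k::field) pmod \<Rightarrow> ('q, 'k) pmod \<Rightarrow> ('q \<Rightarrow> 'k poly \<Rightarrow> 'k poly) \<Rightarrow> bool" where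
  "pers_hom \<equiv> pers_hom_on UNIV (\<le>)"

definition dim_fun :: "('q, 'k::field) pmod \<Rightarrow> 'q \<Rightarrow> nat" where
  "dim_fun V q = amb.dim (fib V q)"

definition nonzero_pmod :: "('q, 'k::field) pmod \<Rightarrow> bool" where
  "nonzero_pmod V \<longleftrightarrow> (\<exists>q. fib V q \<noteq> {0})"


subsection \<open>Discretisable modules\<close>

definition pullback :: "('p \<Rightarrow> 'q) \<Rightarrow> ('q, 'k::field) pmod \<Rightarrow> ('p, 'k) pmod" where
  "pullback f V = \<lparr>fib = (\<lambda>p. fib V (f p)), tmap = (\<lambda>p p'. tmap V (f p) (f p'))\<rparr>"

text \<open>
  \<open>V\<close> is a left Kan extension of \<open>U\<close> along \<open>f\<close>: there is a universal natural transformation from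
  \<open>U\<close> to a restriction along \<open>f\<close>. Morphisms are compared only on the spaces themselves.
\<close>

definition is_left_Kan_extension ::
    "'p set \<Rightarrow> ('p \<Rightarrow> 'p \<Rightarrow> bool) \<Rightarrow> ('p \<Rightarrow> 'q::order)
      \<Rightarrow> ('p, 'k::field) pmod \<Rightarrow> ('q, 'k) pmod \<Rightarrow> bool" where
  "is_left_Kan_extension P rel f U V \<longleftrightarrow>
     (\<exists>\<eta>. pers_hom_on P rel U (pullback f V) \<eta> \<and>
        (\<forall>W\<in>Pers. \<forall>\<alpha>. pers_hom_on P rel U (pullback f W) \<alpha> \<longrightarrow>
           (\<exists>\<beta>. pers_hom V W \<beta> \<and>
              (\<forall>p\<in>P. \<forall>u\<in>fib U p. \<beta> (f p) (\<eta> p u) = \<alpha> p u) \<and>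
              (\<forall>\<beta>'. pers_hom V W \<beta>' \<and>
                     (\<forall>p\<in>P. \<forall>u\<in>fib U p. \<beta>' (f p) (\<eta> p u) = \<alpha> p u) \<longrightarrow>
                     (\<forall>q. \<forall>v\<in>fib V q. \<beta>' q v = \<beta> q v)))))"

text \<open>
  Every finite poset is isomorphic to one carried by a set of natural numbers. No closure under
  isomorphism is needed, since Kan extensions are characterised by their universal property.
\<close>

definition Pers_fp :: "('q::order, 'k::field) pmod set" where
  "Pers_fp = {V \<in> Pers. \<exists>(P :: nat set) rel f U.
     finite P \<and> reflp_on P rel \<and> transp_on P rel \<and> antisymp_on P rel \<and>
     monotone_on P rel (\<le>) f \<and> U \<in> Pers_on P rel \<and> is_left_Kan_extension P rel f U V}"


section \<open>Stability conditions\<close>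

definition short_exact ::
    "('q::order, 'k::field) pmod \<Rightarrow> ('q \<Rightarrow> 'k poly \<Rightarrow> 'k poly) \<Rightarrow> ('q, 'k) pmod
      \<Rightarrow> ('q \<Rightarrow> 'k poly \<Rightarrow> 'k poly) \<Rightarrow> ('q, 'k) pmod \<Rightarrow> bool" where
  "short_exact U f V g W \<longleftrightarrow>
     pers_hom U V f \<and> pers_hom V W g \<and>
     (\<forall>q. inj_on (f q) (fib U q) \<and>
          f q ` fib U q = {v \<in> fib V q. g q v = 0} \<and>
          g q ` fib V q = fib W q)"

text \<open>
  The Grothendieck group: the free abelian group on the objects of \<^const>\<open>Pers_fp\<close> modulo
  \<open>[V] = [U] + [W]\<close> for all short exact sequences \<open>0 \<rightarrow> U \<rightarrow> V \<rightarrow> W \<rightarrow> 0\<close>.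
\<close>

definition K_relations :: "(('q::order, 'k::field) pmod \<Rightarrow>\<^sub>0 int) set" where
  "K_relations = generate (free_Abelian_group Pers_fp)
     {frag_of V - frag_of U - frag_of W | U V W.
        U \<in> Pers_fp \<and> V \<in> Pers_fp \<and> W \<in> Pers_fp \<and> (\<exists>f g. short_exact U f V g W)}"

definition K_group :: "(('q::order, 'k::field) pmod \<Rightarrow>\<^sub>0 int) set monoid" where
  "K_group = free_Abelian_group Pers_fp Mod K_relations"

definition K_class :: "('q::order, 'k::field) pmod \<Rightarrow> (('q, 'k) pmod \<Rightarrow>\<^sub>0 int) set" where
  "K_class V = K_relations #>\<^bsub>free_Abelian_group Pers_fp\<^esub> frag_of V"

definition complex_add_group :: "complex monoid" where
  "complex_add_group = \<lparr>carrier = UNIV, monoid.mult = (+), one = 0\<rparr>"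

type_synonym ('q, 'k) stab = "(('q, 'k) pmod \<Rightarrow>\<^sub>0 int) set \<Rightarrow> complex"

definition stability_condition :: "('q::order, 'k::field) stab \<Rightarrow> bool" where
  "stability_condition Z \<longleftrightarrow>
     Z \<in> hom K_group complex_add_group \<and>
     (\<forall>V\<in>Pers_fp. nonzero_pmod V \<longrightarrow> Re (Z (K_class V)) > 0)"

definition slope :: "('q::order, 'k::field) stab \<Rightarrow> ('q, 'k) pmod \<Rightarrow> real" where
  "slope Z V = Im (Z (K_class V)) / Re (Z (K_class V))"

text \<open>
  A subobject of \<open>V\<close> is given by a family \<open>S\<close> of subspaces \<open>S q \<subseteq> V\<^sub>q\<close> stable under the internal
  maps; the corresponding module is \<open>submod V S\<close>.
\<close>

definition submod :: "('q, 'k::field) pmod \<Rightarrow> ('q \<Rightarrow> 'k poly set) \<Rightarrow> ('q, 'k) pmod" where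
  "submod V S = V\<lparr>fib := S\<rparr>"

definition semistable :: "('q::order, 'k::field) stab \<Rightarrow> ('q, 'k) pmod \<Rightarrow> bool" where
  "semistable Z V \<longleftrightarrow> V \<in> Pers_fp \<and> nonzero_pmod V \<and>
     (\<forall>S. S \<le> fib V \<longrightarrow> submod V S \<in> Pers_fp \<longrightarrow> nonzero_pmod (submod V S) \<longrightarrow>
        slope Z (submod V S) \<le> slope Z V)"

text \<open>
  \<open>F\<close> is a Harder-Narasimhan filtration \<open>0 = F 0 \<subset> \<dots> \<subset> F l = V\<close>, where \<open>C (Suc j)\<close> is the quotient
  of \<open>F (Suc j)\<close> by \<open>F j\<close>.
\<close>

definition HN_filtration ::
    "('q::order, 'k::field) stab \<Rightarrow> ('q, 'k) pmod \<Rightarrow> nat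
      \<Rightarrow> (nat \<Rightarrow> 'q \<Rightarrow> 'k poly set) \<Rightarrow> (nat \<Rightarrow> ('q, 'k) pmod) \<Rightarrow> bool" where
  "HN_filtration Z V l F C \<longleftrightarrow>
     F 0 = (\<lambda>_. {0}) \<and> F l = fib V \<and>
     (\<forall>j\<le>l. submod V (F j) \<in> Pers_fp) \<and>
     (\<forall>j<l. F j < F (Suc j) \<and>
        (\<exists>g. short_exact (submod V (F j)) (\<lambda>_ v. v) (submod V (F (Suc j))) g (C (Suc j))) \<and>
        semistable Z (C (Suc j))) \<and>
     (\<forall>j. 0 < j \<and> j < l \<longrightarrow> slope Z (C (Suc j)) < slope Z (C j))"

text \<open>The family of subspaces underlying \<open>\<langle>V, Z\<rangle>\<^sup>\<theta>\<close>, as a subobject of \<open>V\<close>.\<close>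

definition HN_sub ::
    "('q::order, 'k::field) stab \<Rightarrow> ('q, 'k) pmod \<Rightarrow> real \<Rightarrow> 'q \<Rightarrow> 'k poly set" where
  "HN_sub Z V \<theta> =
     (if nonzero_pmod V
      then (THE S. \<exists>l F C i. HN_filtration Z V l F C \<and> i \<le> l \<and> S = F i \<and>
              (i = 0 \<or> slope Z (C i) \<ge> \<theta>) \<and> (i = l \<or> \<theta> > slope Z (C (Suc i))))
      else (\<lambda>_. {0}))"


section \<open>Grid functions\<close>

definition order_convex :: "'a::linorder set \<Rightarrow> bool" where
  "order_convex I \<longleftrightarrow> (\<forall>x\<in>I. \<forall>y\<in>I. {x..y} \<subseteq> I)"

definition box_of :: "('n::finite \<Rightarrow> 'a set) \<Rightarrow> ('a ^ 'n) set" where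
  "box_of J = {q. \<forall>i. q $ i \<in> J i}"

definition is_cube :: "('a::linorder ^ 'n::finite) set \<Rightarrow> bool" where
  "is_cube c \<longleftrightarrow> (\<exists>J. (\<forall>i. order_convex (J i)) \<and> c = box_of J)"

record ('a, 'n) grid =
  gdom :: "'n \<Rightarrow> int set"
  gmap :: "'n \<Rightarrow> int \<Rightarrow> 'a"

definition grid_dom :: "('a, 'n::finite) grid \<Rightarrow> (int ^ 'n) set" where
  "grid_dom G = box_of (gdom G)"

definition grid_fun :: "('a, 'n::finite) grid \<Rightarrow> int ^ 'n \<Rightarrow> 'a ^ 'n" where
  "grid_fun G p = (\<chi> i. gmap G i (p $ i))"

definition grid_function :: "('a::linorder, 'n::finite) grid \<Rightarrow> bool" where
  "grid_function G \<longleftrightarrow> (\<forall>i.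
     order_convex (gdom G i) \<and>
     strict_mono_on (gdom G i) (gmap G i) \<and>
     (\<not> bdd_above (gdom G i) \<longrightarrow> filterlim (gmap G i) at_top at_top) \<and>
     (\<not> bdd_below (gdom G i) \<longrightarrow> filterlim (gmap G i) at_bot at_bot))"

definition finite_grid_function :: "('a::linorder, 'n::finite) grid \<Rightarrow> bool" where
  "finite_grid_function G \<longleftrightarrow> grid_function G \<and> finite (grid_dom G)"

text \<open>The value \<^const>\<open>None\<close> stands for \<open>-\<infinity>\<close>.\<close>

definition grid_floor :: "('a::linorder, 'n::finite) grid \<Rightarrow> 'a ^ 'n \<Rightarrow> (int ^ 'n) option" where
  "grid_floor G q =
     (if \<exists>p\<in>grid_dom G. grid_fun G p \<le> q
      then Some (GREATEST p. p \<in> grid_dom G \<and> grid_fun G p \<le> q)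
      else None)"

definition cub :: "('a::linorder, 'n::finite) grid \<Rightarrow> (int ^ 'n) option \<Rightarrow> ('a ^ 'n) set" where
  "cub G x = {q. grid_floor G q = x}"

definition discretisable_fun :: "('a::linorder, 'n::finite) grid \<Rightarrow> ('a ^ 'n \<Rightarrow> real) \<Rightarrow> bool" where
  "discretisable_fun G a \<longleftrightarrow>
     (\<exists>a'. \<forall>q. a q = (case grid_floor G q of None \<Rightarrow> 0 | Some p \<Rightarrow> a' p))"

definition grid_refinement :: "('a::linorder, 'n::finite) grid \<Rightarrow> ('a, 'n) grid \<Rightarrow> bool" where
  "grid_refinement G G' \<longleftrightarrow> grid_function G' \<and>
     (\<exists>g. mono_on (grid_dom G) g \<and>
        (\<forall>p\<in>grid_dom G. g p \<in> grid_dom G' \<and> grid_fun G p = grid_fun G' (g p)))"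

definition grid_extension :: "('a::linorder, 'n::finite) grid \<Rightarrow> ('a, 'n) grid \<Rightarrow> bool" where
  "grid_extension G G' \<longleftrightarrow> grid_refinement G G' \<and>
     (\<exists>c. is_cube c \<and> grid_fun G ` grid_dom G = grid_fun G' ` grid_dom G' \<inter> c)"

definition bounded_set :: "('a::linorder ^ 'n::finite) set \<Rightarrow> bool" where
  "bounded_set c \<longleftrightarrow> bdd_above c \<and> bdd_below c"

definition faces :: "('a::linorder ^ 'n::finite) set \<Rightarrow> ('a ^ 'n) set set" where
  "faces c = {box_of J | J a b.
     c = box_of (\<lambda>i. {a i..<b i}) \<and> (\<forall>i. J i \<in> {{a i..<b i}, {a i}, {b i}})}"

definition grid_faces :: "('a::linorder, 'n::finite) grid \<Rightarrow> ('a ^ 'n) set set" where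
  "grid_faces G = (\<Union>x\<in>{x \<in> grid_dom G. bounded_set (cub G (Some x))}. faces (cub G (Some x)))"


section \<open>Integrals over cubes\<close>

text \<open>
  For a nonempty cube \<open>c\<close>, \<open>cube_measure c\<close> is the product measure in the directions \<open>cube_dirs c\<close>
  in which \<open>c\<close> has nonempty interior (all directions if \<open>'a\<close> is \<^typ>\<open>int\<close>), carried by the
  coordinate plane through \<open>c\<close>: in every other direction the projection of \<open>c\<close> is a singleton.
  In particular \<open>cube_measure UNIV\<close> is Lebesgue measure, respectively counting measure, on \<open>Q\<close>
  (\<open>cube_measure_real\<close> and \<open>cube_measure_int\<close>).
\<close>

definition cube_dirs :: "('a::topological_space ^ 'n::finite) set \<Rightarrow> 'n set" where
  "cube_dirs c = {i. interior ((\<lambda>q. q $ i) ` c) \<noteq> {}}"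

definition cube_measure :: "('a::grid_coord ^ 'n::finite) set \<Rightarrow> ('a ^ 'n) measure" where
  "cube_measure c =
     distr (Pi\<^sub>M (cube_dirs c) (\<lambda>_. coord_measure)) borel
       (\<lambda>y. \<chi> i. if i \<in> cube_dirs c then y i else the_elem ((\<lambda>q. q $ i) ` c))"

lemma cube_dirs_UNIV: "cube_dirs (UNIV :: ('a::grid_coord ^ 'n::finite) set) = UNIV"
proof -
  have "(\<lambda>q :: 'a ^ 'n. q $ i) ` UNIV = UNIV" for i
    by (rule surjI[of _ "\<lambda>a. vec a"]) simp
  then show ?thesis by (simp add: cube_dirs_def)
qed

lemma measurable_vec_lambda_lborel: "(\<lambda>y. \<chi> i. y i) \<in> Pi\<^sub>M (UNIV::'n::finite set) (\<lambda>_. lborel::real measure) \<rightarrow>\<^sub>M (borel :: (real^'n) measure)"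
  by (subst borel_measurable_euclidean_space) (auto simp: Basis_vec_def inner_axis)

lemma cube_measure_real: "cube_measure (UNIV :: (real ^ 'n::finite) set) = lborel"
proof (rule sym, rule lborel_eqI)
  interpret product_sigma_finite "\<lambda>_::'n. lborel::real measure" by standard
  fix l u :: "real ^ 'n"
  assume le: "\<And>b. b \<in> Basis \<Longrightarrow> l \<bullet> b \<le> u \<bullet> b"
  have le': "l $ i \<le> u $ i" for i
    using le[of "axis i 1"] by (simp add: inner_axis axis_in_Basis_iff)
  have "emeasure (cube_measure UNIV) (box l u) =
    emeasure (Pi\<^sub>M UNIV (\<lambda>_::'n. lborel)) ((\<lambda>y. \<chi> i. y i) -` box l u \<inter> space (Pi\<^sub>M UNIV (\<lambda>_::'n. lborel::real measure)))"
    unfolding cube_measure_def cube_dirs_UNIV coord_measure_real_def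
    using measurable_vec_lambda_lborel by (subst emeasure_distr) auto
  also have "(\<lambda>y. \<chi> i. y i) -` box l u \<inter> space (Pi\<^sub>M UNIV (\<lambda>_::'n. lborel::real measure)) = Pi\<^sub>E UNIV (\<lambda>i. {l$i<..<u$i})"
    by (auto simp: mem_box_cart space_PiM PiE_def Pi_def)
  also have "emeasure (Pi\<^sub>M UNIV (\<lambda>_::'n. lborel)) \<dots> = (\<Prod>i\<in>UNIV. emeasure lborel {l$i<..<u$i})"
    by (subst emeasure_PiM) auto
  also have "\<dots> = (\<Prod>i\<in>UNIV. ennreal (u $ i - l $ i))"
    by (simp add: le')
  also have "\<dots> = ennreal (\<Prod>i\<in>UNIV. (u $ i - l $ i))"
    by (rule prod_ennreal) (simp add: le')
  also have "(\<Prod>i\<in>UNIV. (u $ i - l $ i)) = (\<Prod>b\<in>Basis. (u - l) \<bullet> b)"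
  proof -
    have B: "(Basis :: (real^'n) set) = (\<lambda>i. axis i 1) ` UNIV"
      by (auto simp: Basis_vec_def)
    show ?thesis unfolding B
      by (subst prod.reindex) (auto simp: inj_on_def axis_eq_axis inner_axis)
  qed
  finally show "emeasure (cube_measure UNIV) (box l u) = (\<Prod>b\<in>Basis. (u - l) \<bullet> b)" .
next
  show "sets (cube_measure (UNIV :: (real ^ 'n) set)) = sets borel"
    by (simp add: cube_measure_def)
qed

lemma cube_measure_int: "cube_measure (UNIV :: (int ^ 'n::finite) set) = count_space UNIV"
proof (rule measure_eqI)
  have op: "open (A :: (int^'n) set)" for A
    unfolding open_vec_def
  proof (intro ballI)
    fix x assume "x \<in> A"
    then show "\<exists>S. (\<forall>i. open (S i) \<and> x $ i \<in> S i) \<and> (\<forall>y. (\<forall>i. y $ i \<in> S i) \<longrightarrow> y \<in> A)"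
      by (intro exI[of _ "\<lambda>i. {x $ i}"]) (auto simp: open_discrete simp flip: vec_eq_iff)
  qed
  have sb: "sets (borel :: (int^'n) measure) = UNIV"
    using op by auto
  have P: "Pi\<^sub>M UNIV (\<lambda>_::'n. count_space (UNIV::int set)) = count_space (Pi\<^sub>E UNIV (\<lambda>_. UNIV))" 
    by (rule count_space_PiM_finite) auto
  show "sets (cube_measure (UNIV :: (int ^ 'n) set)) = sets (count_space UNIV)"
    using sb by (simp add: cube_measure_def)
  fix A :: "(int^'n) set"
  have "bij_betw (\<lambda>y. \<chi> i. y i) ((\<lambda>y. \<chi> i. y i) -` A) A"
    by (rule bij_betwI[where g = "\<lambda>q i. q $ i"]) auto
  then have "emeasure (count_space UNIV) ((\<lambda>y. \<chi> i. y i) -` A) = emeasure (count_space UNIV) A"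
    by (auto simp: emeasure_count_space bij_betw_finite bij_betw_same_card)
  then show "emeasure (cube_measure UNIV) A = emeasure (count_space UNIV) A"
    unfolding cube_measure_def cube_dirs_UNIV coord_measure_int_def P
    by (subst emeasure_distr) (auto simp: sb)
qed

definition cube_average :: "('a::grid_coord ^ 'n::finite) set \<Rightarrow> ('a ^ 'n \<Rightarrow> real) \<Rightarrow> real" where
  "cube_average c h = (LINT q:c|cube_measure c. h q) / (LINT q:c|cube_measure c. 1)"


section \<open>The stability conditions in \<open>\<Z>(Q)\<close>\<close>

definition Z_step ::
    "('a::grid_coord, 'n::finite) grid \<Rightarrow> ('a ^ 'n, 'k::field) stab set" where
  "Z_step G = {Z. stability_condition Z \<and>
     (\<exists>a b G'. grid_extension G G' \<and> discretisable_fun G' a \<and> discretisable_fun G' b \<and>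
        (\<forall>x \<in> insert None (Some ` grid_dom G).
           \<not> bounded_set (cub G x) \<longrightarrow> (\<forall>q\<in>cub G x. a q = 0)) \<and>
        (\<forall>q. b q > 0) \<and> integrable (cube_measure UNIV) b \<and>
        (\<forall>V\<in>Pers_fp. Z (K_class V) =
           (LINT q|cube_measure UNIV. Complex (b q) (a q) * of_nat (dim_fun V q))))}"

definition Z_grid ::
    "('a::grid_coord, 'n::finite) grid \<Rightarrow> ('a ^ 'n, 'k::field) stab set" where
  "Z_grid G = {Z. stability_condition Z \<and>
     (\<exists>Z0\<in>Z_step G. \<exists>lam. (\<forall>c\<in>grid_faces G. lam c \<ge> 0) \<and>
        (\<forall>V\<in>Pers_fp. Z (K_class V) = Z0 (K_class V) +
           \<i> * of_real (\<Sum>c\<in>grid_faces G. lam c * cube_average c (\<lambda>q. real (dim_fun V q)))))}"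

definition Z_all :: "('a::grid_coord ^ 'n::finite, 'k::field) stab set" where
  "Z_all = (\<Union>G\<in>{G. finite_grid_function G}. Z_grid G)"


section \<open>The HN filtered rank invariant\<close>

definition translate :: "'q::plus \<Rightarrow> ('q, 'k::field) pmod \<Rightarrow> ('q, 'k) pmod" where
  "translate x V = pullback (\<lambda>y. x + y) V"

definition HN_rank ::
    "('a::grid_coord ^ 'n::finite, 'k::field) stab \<Rightarrow> ('a ^ 'n, 'k) pmod \<Rightarrow> real
      \<Rightarrow> 'a ^ 'n \<Rightarrow> 'a ^ 'n \<Rightarrow> enat" where
  "HN_rank Z V \<theta> x y =
     (if x \<le> y
      then enat (amb.dim (tmap (translate x V) 0 (y - x) ` HN_sub Z (translate x V) \<theta> 0))
      else \<infinity>)"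

text \<open>Functors from \<open>Q\<^sup>o\<^sup>p \<times> Q\<close> to the opposite of \<^typ>\<open>enat\<close>.\<close>

definition rank_functor :: "('q::order \<Rightarrow> 'q \<Rightarrow> enat) \<Rightarrow> bool" where
  "rank_functor s \<longleftrightarrow> (\<forall>x x' y y'. x \<le> x' \<longrightarrow> y' \<le> y \<longrightarrow> s x y \<le> s x' y')"


section \<open>Distances\<close>

definition interleaving ::
    "'a::grid_coord \<Rightarrow> ('a ^ 'n::finite, 'k::field) pmod \<Rightarrow> ('a ^ 'n, 'k) pmod
      \<Rightarrow> ('a ^ 'n \<Rightarrow> 'k poly \<Rightarrow> 'k poly) \<Rightarrow> ('a ^ 'n \<Rightarrow> 'k poly \<Rightarrow> 'k poly) \<Rightarrow> bool" where
  "interleaving \<epsilon> V W f g \<longleftrightarrow>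
     pers_hom V (translate (vec \<epsilon>) W) f \<and> pers_hom W (translate (vec \<epsilon>) V) g \<and>
     (\<forall>q. \<forall>v\<in>fib V q. g (vec \<epsilon> + q) (f q v) = tmap V q (vec (2 * \<epsilon>) + q) v) \<and>
     (\<forall>q. \<forall>w\<in>fib W q. f (vec \<epsilon> + q) (g q w) = tmap W q (vec (2 * \<epsilon>) + q) w)"

text \<open>Both distances are \<open>\<infinity>\<close>, the infimum of the empty set, if no \<open>\<epsilon>\<close> is admissible.\<close>

definition d_I :: "('a::grid_coord ^ 'n::finite, 'k::field) pmod \<Rightarrow> ('a ^ 'n, 'k) pmod \<Rightarrow> ereal" where
  "d_I V W = Inf {ereal (real_of_coord \<epsilon>) | \<epsilon>. 0 \<le> \<epsilon> \<and> (\<exists>f g. interleaving \<epsilon> V W f g)}"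

definition d_E ::
    "('a::grid_coord ^ 'n::finite \<Rightarrow> 'a ^ 'n \<Rightarrow> enat) \<Rightarrow> ('a ^ 'n \<Rightarrow> 'a ^ 'n \<Rightarrow> enat) \<Rightarrow> ereal" where
  "d_E r s = Inf {ereal (real_of_coord \<epsilon>) | \<epsilon>. 0 \<le> \<epsilon> \<and>
     (\<forall>a b. r (a - vec \<epsilon>) (b + vec \<epsilon>) \<le> s a b \<and> s (a - vec \<epsilon>) (b + vec \<epsilon>) \<le> r a b)}"

end

theory Submission
  imports Defs
begin

text \<open>
  The ranks in the invariant are ranks of maps restricted to the subobjects \<open>\<langle>T\<^sub>xV, Z\<rangle>\<^sup>\<theta>\<close>. If
  these subobjects are functorial in the module, both claims follow by factoring maps: the internal
  maps of \<open>V\<close> give morphisms between its translates, so enlarging the interval from \<open>x\<close> to \<open>y\<close> can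
  only lower the rank; and in an \<open>\<epsilon>\<close>-interleaving the map of \<open>V\<close> from \<open>a - \<epsilon>\<close> to \<open>b + \<epsilon>\<close> factors
  through the map of \<open>W\<close> from \<open>a\<close> to \<open>b\<close> (\<open>HN_rank_le\<close>, \<open>HN_rank_interleaving\<close>).

  Functoriality comes from a description of \<open>\<langle>V, Z\<rangle>\<^sup>\<theta>\<close> without filtrations. Call
  \<open>Im Z - \<theta> Re Z\<close> the energy of a subobject. It is additive on short exact sequences, hence modular,
  and \<open>\<langle>V, Z\<rangle>\<^sup>\<theta>\<close> is the largest subobject of maximal energy (\<open>HN_cut_largest_max\<close>). For a morphism, the image of the
  largest maximiser of the source can be added to that of the target without loss of energy, so it is
  contained in it (\<open>largest_max_hom\<close>).

  It remains to see that filtrations exist. A module is finitely presented if and only if it is tame: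
  constant on the cells of some finite grid (\<open>Pers_fp_iff_tame\<close>). Subobjects of a tame module may need arbitrarily
  large grids, so there is no chain condition to appeal to. However, for \<open>Z\<close> in \<open>\<Z>(Q)\<close> one fixed
  grid suffices: refine the grids of \<open>V\<close> and of \<open>Z\<close> to a common grid \<open>T\<close>; then each subobject is dominated in
  energy, for every \<open>\<theta>\<close>, by one that is tame for \<open>T\<close>
  (\<open>tame_domination\<close>). To see this, remove the superfluous thresholds of a subobject \<open>S\<close> one by one
  (\<open>remove_threshold\<close>). Around such a threshold of a coordinate, \<open>S\<close> takes two
  values along that coordinate. Spread one or the other value over the whole slab. Within the grid of \<open>Z\<close>
  the energy of \<open>S\<close> is at most a convex combination of the two new energies, where the nonnegative weights
  of the face terms make this an inequality in the right direction; outside it the density of the energy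
  has constant sign, which decides for one of the two choices.

  Subobjects that are tame for \<open>T\<close> have only finitely many dimension functions, hence
  finitely many charges. Therefore maximisers exist, the largest one stays constant in \<open>\<theta>\<close> except for
  finitely many jumps, and the jumps as \<open>\<theta>\<close> decreases form the Harder-Narasimhan filtration.
\<close>

section \<open>Finite-dimensional subspaces and linear maps between them\<close>

lemma fin_dim_subspace_subset:
  assumes "fin_dim_subspace B" "amb.subspace A" "A \<subseteq> B"
  shows "fin_dim_subspace A"
proof -
  obtain Bs where Bs: "finite Bs" "B = amb.span Bs" using assms(1) by (auto simp: fin_dim_subspace_def)
  obtain As where As: "As \<subseteq> A" "amb.independent As" "A \<subseteq> amb.span As"
    by (rule amb.maximal_independent_subset)
  have "finite As" using amb.independent_span_bound[of Bs As] Bs As assms(3) by auto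
  moreover have "A = amb.span As"
    using As(3) amb.span_minimal[OF As(1) assms(2)] by blast
  ultimately show ?thesis using assms(2) by (auto simp: fin_dim_subspace_def)
qed

lemma fin_dim_subspace_basis:
  assumes "fin_dim_subspace A"
  obtains Bs where "finite Bs" "amb.independent Bs" "A = amb.span Bs" "card Bs = amb.dim A"
proof -
  obtain T where T: "finite T" "A = amb.span T" "amb.subspace A" using assms by (auto simp: fin_dim_subspace_def)
  obtain As where As: "As \<subseteq> A" "amb.independent As" "A \<subseteq> amb.span As" "card As = amb.dim A"
    by (rule amb.basis_exists)
  have "finite As" using amb.independent_span_bound[of T As] T As by auto
  moreover have "A = amb.span As"
    using As(3) amb.span_minimal[OF As(1) T(3)] by blast
  ultimately show ?thesis using that As by blast
qed

lemma dim_mono_fin_dim: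
  assumes "fin_dim_subspace B" "A \<subseteq> B"
  shows "amb.dim A \<le> amb.dim B"
  using fin_dim_subspace_basis[OF assms(1)] amb.dim_le_card assms(2) by metis

lemma zero_in_fin_dim_subspace: "fin_dim_subspace A \<Longrightarrow> 0 \<in> A"
  by (simp add: fin_dim_subspace_def amb.subspace_0)

lemma fin_dim_subspace_zero: "fin_dim_subspace {0}"
  by (auto simp: fin_dim_subspace_def amb.subspace_single_0 intro!: exI[of _ "{}"])

lemma linear_between_image:
  "linear_between A B f \<Longrightarrow> f ` A \<subseteq> B"
  "linear_between A B f \<Longrightarrow> v \<in> A \<Longrightarrow> f v \<in> B"
  by (auto simp: linear_between_def)

lemma linear_between_add:
  "linear_between A B f \<Longrightarrow> u \<in> A \<Longrightarrow> v \<in> A \<Longrightarrow> f (u + v) = f u + f v"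
  by (auto simp: linear_between_def)

lemma linear_between_scale:
  "linear_between A B f \<Longrightarrow> u \<in> A \<Longrightarrow> f (smult c u) = smult c (f u)"
  by (auto simp: linear_between_def)

lemma linear_between_zero:
  "linear_between A B f \<Longrightarrow> amb.subspace A \<Longrightarrow> f 0 = 0"
  using linear_between_scale[of A B f 0 0] amb.subspace_0 by fastforce

lemma linear_between_diff:
  assumes "linear_between A B f" "amb.subspace A" "u \<in> A" "v \<in> A"
  shows "f (u - v) = f u - f v"
proof -
  have "f (u - v + v) = f (u - v) + f v"
    using assms by (intro linear_between_add[OF assms(1)] amb.subspace_diff)
  then show ?thesis by simp
qed

lemma linear_between_subset:
  "linear_between A B f \<Longrightarrow> A' \<subseteq> A \<Longrightarrow> f ` A' \<subseteq> B' \<Longrightarrow> linear_between A' B' f"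
  unfolding linear_between_def by blast

lemma linear_between_comp:
  assumes "linear_between A B f" "linear_between B C g"
  shows "linear_between A C (\<lambda>v. g (f v))"
  using assms unfolding linear_between_def by (auto simp: image_subset_iff)

lemma linear_between_const_zero: "0 \<in> B \<Longrightarrow> linear_between A B (\<lambda>_. 0)"
  by (auto simp: linear_between_def)

lemma subspace_linear_image:
  assumes "linear_between A B f" "amb.subspace A"
  shows "amb.subspace (f ` A)"
proof (rule amb.subspaceI)
  show "0 \<in> f ` A" using linear_between_zero[OF assms] amb.subspace_0[OF assms(2)] by force
  show "x + y \<in> f ` A" if "x \<in> f ` A" "y \<in> f ` A" for x y
    using that linear_between_add[OF assms(1)] amb.subspace_add[OF assms(2)] by (metis (no_types, lifting) image_iff)
  show "smult c x \<in> f ` A" if "x \<in> f ` A" for x c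
    using that linear_between_scale[OF assms(1)] amb.subspace_scale[OF assms(2)] by (metis (no_types, lifting) image_iff)
qed

lemma subspace_linear_preimage:
  assumes "linear_between A B f" "amb.subspace A" "amb.subspace D"
  shows "amb.subspace {v \<in> A. f v \<in> D}"
  using assms linear_between_zero[OF assms(1,2)] unfolding amb.subspace_def
  by (auto simp: linear_between_add[OF assms(1)] linear_between_scale[OF assms(1)])

lemma
  assumes "linear_between A B f" "fin_dim_subspace A"
  shows fin_dim_linear_image: "fin_dim_subspace (f ` A)"
    and dim_linear_image_le: "amb.dim (f ` A) \<le> amb.dim A"
proof -
  obtain Bs where Bs: "finite Bs" "amb.independent Bs" "A = amb.span Bs" "card Bs = amb.dim A"
    by (rule fin_dim_subspace_basis[OF assms(2)])
  have sub: "amb.subspace A" using assms(2) by (simp add: fin_dim_subspace_def)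
  have "v \<in> A \<and> f v \<in> amb.span (f ` Bs)" if "v \<in> A" for v
    using that unfolding Bs(3)
  proof (induction rule: amb.span_induct_alt)
    case base
    then show ?case using linear_between_zero[OF assms(1) sub] amb.span_zero by (metis)
  next
    case (step c x y)
    have xA: "x \<in> A" using step Bs(3) amb.span_base by blast
    have yA: "y \<in> A" using step Bs(3) by blast
    have "f (smult c x + y) = smult c (f x) + f y"
      using linear_between_add[OF assms(1) amb.subspace_scale[OF sub xA] yA] linear_between_scale[OF assms(1) xA]
      by simp
    moreover have "smult c x + y \<in> A" using xA yA sub by (intro amb.subspace_add amb.subspace_scale)
    ultimately show ?case using step Bs(3) 
      by (auto intro!: amb.span_add amb.span_scale intro: amb.span_base)
  qed
  then have 1: "f ` A \<subseteq> amb.span (f ` Bs)" by blast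
  have "f ` Bs \<subseteq> f ` A" using Bs(3) amb.span_superset by blast
  then have "f ` A = amb.span (f ` Bs)"
    using 1 amb.span_minimal[OF _ subspace_linear_image[OF assms(1) sub]] by blast
  then show "fin_dim_subspace (f ` A)"
    using subspace_linear_image[OF assms(1) sub] Bs(1) unfolding fin_dim_subspace_def by blast
  have "amb.dim (f ` A) \<le> card (f ` Bs)" using 1 Bs(1) by (intro amb.dim_le_card) auto
  also have "\<dots> \<le> amb.dim A" using Bs(1,4) card_image_le by metis
  finally show "amb.dim (f ` A) \<le> amb.dim A" .
qed

lemma linear_between_inv_into:
  assumes "linear_between A B f" "amb.subspace A" "inj_on f A"
  shows "linear_between (f ` A) A (inv_into A f)"
  unfolding linear_between_def
proof (intro conjI ballI allI)
  show "inv_into A f ` f ` A \<subseteq> A" using assms(3) by (auto simp: inv_into_f_f)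
  show "inv_into A f (u + v) = inv_into A f u + inv_into A f v" if "u \<in> f ` A" "v \<in> f ` A" for u v
  proof -
    obtain x y where xy: "x \<in> A" "y \<in> A" "u = f x" "v = f y" using \<open>u \<in> f ` A\<close> \<open>v \<in> f ` A\<close> by auto
    have "u + v = f (x + y)" using xy linear_between_add[OF assms(1)] by simp
    moreover have "x + y \<in> A" using xy assms(2) by (intro amb.subspace_add)
    ultimately show ?thesis using xy assms(3) by (simp add: inv_into_f_f)
  qed
  show "inv_into A f (smult c u) = smult c (inv_into A f u)" if "u \<in> f ` A" for c u
  proof -
    obtain x where xy: "x \<in> A" "u = f x" using \<open>u \<in> f ` A\<close> by auto
    have "smult c u = f (smult c x)" using xy linear_between_scale[OF assms(1)] by simp
    moreover have "smult c x \<in> A" using xy assms(2) by (intro amb.subspace_scale)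
    ultimately show ?thesis using xy assms(3) by (simp add: inv_into_f_f)
  qed
qed

lemma dim_linear_image_inj:
  assumes "linear_between A B f" "fin_dim_subspace A" "inj_on f A"
  shows "amb.dim (f ` A) = amb.dim A"
proof (rule antisym[OF dim_linear_image_le[OF assms(1,2)]])
  have sub: "amb.subspace A" using assms(2) by (simp add: fin_dim_subspace_def)
  have "inv_into A f ` f ` A = A" using assms(3) by (auto simp: inv_into_f_f image_comp)
  then show "amb.dim A \<le> amb.dim (f ` A)"
    using dim_linear_image_le[OF linear_between_inv_into[OF assms(1) sub assms(3)] fin_dim_linear_image[OF assms(1,2)]]
    by simp
qed

text \<open>
  A linear projection along \<open>A\<close>, used to realise the quotient \<open>B / A\<close> inside the ambient space: since
  \<open>v - g v\<close> lies in \<open>A\<close>, the image of \<open>g\<close> is a complement of \<open>A\<close> in \<open>B\<close>.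
\<close>

lemma projection_exists:
  assumes "amb.subspace A" "amb.subspace B" "A \<subseteq> B"
  obtains g where "linear_between B B g" "\<And>v. v \<in> A \<Longrightarrow> g v = 0" "\<And>v. v \<in> B \<Longrightarrow> v - g v \<in> A"
proof -
  interpret vp: vector_space_pair "smult :: 'a \<Rightarrow> 'a poly \<Rightarrow> 'a poly" "smult :: 'a \<Rightarrow> 'a poly \<Rightarrow> 'a poly"
    by unfold_locales
  obtain As where As: "As \<subseteq> A" "amb.independent As" "A \<subseteq> amb.span As"
    by (rule amb.maximal_independent_subset)
  obtain Bs where Bs: "As \<subseteq> Bs" "Bs \<subseteq> B" "amb.independent Bs" "B \<subseteq> amb.span Bs"
    using amb.maximal_independent_subset_extend[of As B] As assms(3) by blast
  obtain g where g: "Vector_Spaces.linear smult smult g" "\<forall>x\<in>Bs. g x = (if x \<in> As then 0 else x)"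
    using vp.linear_independent_extend[OF Bs(3), of "\<lambda>x. if x \<in> As then 0 else x"] by blast
  have gadd: "g (x + y) = g x + g y" and gsc: "g (smult c x) = smult c (g x)" for x y c
    using g(1) unfolding Vector_Spaces.linear_iff by auto
  have g0: "g 0 = 0" using gsc[of 0 0] by simp
  have onA: "g v = 0" if "v \<in> A" for v
  proof -
    have "v \<in> amb.span As" using that As by blast
    then show ?thesis
      by (induction rule: amb.span_induct_alt) (use g As Bs in \<open>auto simp: gadd gsc g0\<close>)
  qed
  have diff: "v - g v \<in> A" if "v \<in> B" for v
  proof -
    have "v \<in> amb.span Bs" using that Bs by blast
    then show ?thesis
    proof (induction rule: amb.span_induct_alt)
      case base
      then show ?case using amb.subspace_0[OF assms(1)] by (simp add: g0)
    next
      case (step c x y)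
      have "x - g x \<in> A" using step g As amb.subspace_0[OF assms(1)] by auto
      then have "smult c (x - g x) + (y - g y) \<in> A"
        using step assms(1) by (intro amb.subspace_add amb.subspace_scale)
      then show ?case by (simp add: gadd gsc smult_diff_right algebra_simps)
    qed
  qed
  have "g v \<in> B" if "v \<in> B" for v
    using amb.subspace_diff[OF assms(2) that, of "v - g v"] diff[OF that] assms(3) by auto
  then have "linear_between B B g" by (auto simp: linear_between_def gadd gsc)
  then show ?thesis using that onA diff by blast
qed

section \<open>Modules that are constant on the cells of a finite grid\<close>

lemma PersD:
  assumes "V \<in> Pers"
  shows "fin_dim_subspace (fib V q)" "amb.subspace (fib V q)" "0 \<in> fib V q"
    and "q \<le> r \<Longrightarrow> linear_between (fib V q) (fib V r) (tmap V q r)"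
    and "v \<in> fib V q \<Longrightarrow> tmap V q q v = v"
    and "q \<le> r \<Longrightarrow> r \<le> s \<Longrightarrow> v \<in> fib V q \<Longrightarrow> tmap V r s (tmap V q r v) = tmap V q s v"
    and "q \<le> r \<Longrightarrow> v \<in> fib V q \<Longrightarrow> tmap V q r v \<in> fib V r"
    and "q \<le> r \<Longrightarrow> tmap V q r 0 = 0"
proof -
  show 1: "fin_dim_subspace (fib V q)" for q using assms by (auto simp: Pers_on_def)
  then show "amb.subspace (fib V q)" by (simp add: fin_dim_subspace_def)
  show "0 \<in> fib V q" using 1 zero_in_fin_dim_subspace by blast
  show 2: "q \<le> r \<Longrightarrow> linear_between (fib V q) (fib V r) (tmap V q r)"
    using assms by (auto simp: Pers_on_def)
  then show "q \<le> r \<Longrightarrow> v \<in> fib V q \<Longrightarrow> tmap V q r v \<in> fib V r"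
    by (auto simp: linear_between_def)
  show "v \<in> fib V q \<Longrightarrow> tmap V q q v = v"
    using assms by (auto simp: Pers_on_def)
  show "q \<le> r \<Longrightarrow> r \<le> s \<Longrightarrow> v \<in> fib V q \<Longrightarrow> tmap V r s (tmap V q r v) = tmap V q s v"
    using assms by (auto simp: Pers_on_def)
  show "q \<le> r \<Longrightarrow> tmap V q r 0 = 0"
    using linear_between_zero[OF 2] 1 by (auto simp: fin_dim_subspace_def)
qed

lemma PersI:
  assumes "\<And>q. fin_dim_subspace (fib V q)"
    and "\<And>q r. q \<le> r \<Longrightarrow> linear_between (fib V q) (fib V r) (tmap V q r)"
    and "\<And>q v. v \<in> fib V q \<Longrightarrow> tmap V q q v = v"
    and "\<And>q r s v. q \<le> r \<Longrightarrow> r \<le> s \<Longrightarrow> v \<in> fib V q \<Longrightarrow> tmap V r s (tmap V q r v) = tmap V q s v"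
  shows "V \<in> Pers"
  using assms by (auto simp: Pers_on_def)

lemma pers_homD:
  assumes "pers_hom V W f"
  shows "linear_between (fib V q) (fib W q) (f q)"
    and "q \<le> r \<Longrightarrow> v \<in> fib V q \<Longrightarrow> f r (tmap V q r v) = tmap W q r (f q v)"
    and "v \<in> fib V q \<Longrightarrow> f q v \<in> fib W q"
  using assms unfolding pers_hom_on_def linear_between_def by blast+

lemma pers_homI:
  assumes "\<And>q. linear_between (fib V q) (fib W q) (f q)"
    and "\<And>q r v. q \<le> r \<Longrightarrow> v \<in> fib V q \<Longrightarrow> f r (tmap V q r v) = tmap W q r (f q v)"
  shows "pers_hom V W f"
  using assms by (auto simp: pers_hom_on_def)

text \<open>
  A family \<open>T\<close> of sets of thresholds cuts the space into half-open cells, on which the same thresholds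
  have been passed. Phrasing everything by the set of passed thresholds makes refinement of \<open>T\<close>
  immediate.
\<close>

definition same_cell :: "('n \<Rightarrow> 'a::linorder set) \<Rightarrow> 'a ^ 'n::finite \<Rightarrow> 'a ^ 'n \<Rightarrow> bool" where
  "same_cell T q r \<longleftrightarrow> (\<forall>i. \<forall>t\<in>T i. t \<le> q $ i \<longleftrightarrow> t \<le> r $ i)"

definition above_grid :: "('n \<Rightarrow> 'a::linorder set) \<Rightarrow> 'a ^ 'n::finite \<Rightarrow> bool" where
  "above_grid T q \<longleftrightarrow> (\<forall>i. \<exists>t\<in>T i. t \<le> q $ i)"

definition cell_floor :: "('n \<Rightarrow> 'a::linorder set) \<Rightarrow> 'a ^ 'n::finite \<Rightarrow> 'a ^ 'n" where
  "cell_floor T q = (\<chi> i. Max {t \<in> T i. t \<le> q $ i})"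

definition tame :: "('n \<Rightarrow> 'a::linorder set) \<Rightarrow> ('a ^ 'n::finite, 'k::field) pmod \<Rightarrow> bool" where
  "tame T V \<longleftrightarrow>
     (\<forall>q r. q \<le> r \<longrightarrow> same_cell T q r \<longrightarrow> bij_betw (tmap V q r) (fib V q) (fib V r)) \<and>
     (\<forall>q. \<not> above_grid T q \<longrightarrow> fib V q = {0})"

definition finite_grid :: "('n \<Rightarrow> 'a set) \<Rightarrow> bool" where
  "finite_grid T \<longleftrightarrow> (\<forall>i. finite (T i))"

lemma tame_bij: "tame T V \<Longrightarrow> q \<le> r \<Longrightarrow> same_cell T q r \<Longrightarrow> bij_betw (tmap V q r) (fib V q) (fib V r)"
  and tame_zero: "tame T V \<Longrightarrow> \<not> above_grid T q \<Longrightarrow> fib V q = {0}"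
  by (auto simp: tame_def)

lemma same_cell_mono: "(\<And>i. T i \<subseteq> T' i) \<Longrightarrow> same_cell T' q r \<Longrightarrow> same_cell T q r"
  by (auto simp: same_cell_def)

lemma same_cell_refl: "same_cell T q q"
  by (simp add: same_cell_def)

lemma tame_mono:
  assumes "tame T V" "\<And>i. T i \<subseteq> T' i"
  shows "tame T' V"
proof -
  have "above_grid T' q" if "above_grid T q" for q
    unfolding above_grid_def
  proof
    fix i
    obtain t where "t \<in> T i" "t \<le> q $ i" using \<open>above_grid T q\<close> unfolding above_grid_def by metis
    then show "\<exists>t\<in>T' i. t \<le> q $ i" using assms(2)[of i] by blast
  qed
  moreover have "same_cell T q r" if "same_cell T' q r" for q r
    using same_cell_mono[OF assms(2) that] .
  ultimately show ?thesis using assms(1) unfolding tame_def by metis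
qed

lemma tame_Un:
  "tame T V \<Longrightarrow> tame (\<lambda>i. T i \<union> T' i) V" "tame T' V \<Longrightarrow> tame (\<lambda>i. T i \<union> T' i) V"
  by (auto intro: tame_mono)

lemma finite_grid_Un: "finite_grid T \<Longrightarrow> finite_grid T' \<Longrightarrow> finite_grid (\<lambda>i. T i \<union> T' i)"
  by (auto simp: finite_grid_def)

lemma
  assumes "finite_grid T" "above_grid T q"
  shows cell_floor_in: "cell_floor T q $ i \<in> T i"
    and cell_floor_le_nth: "cell_floor T q $ i \<le> q $ i"
    and cell_floor_ge: "t \<in> T i \<Longrightarrow> t \<le> q $ i \<Longrightarrow> t \<le> cell_floor T q $ i"
    and cell_floor_le: "cell_floor T q \<le> q"
    and same_cell_floor: "same_cell T (cell_floor T q) q"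
proof -
  have fin: "finite {t \<in> T i. t \<le> q $ i}" for i using assms(1) by (auto simp: finite_grid_def)
  have ne: "{t \<in> T i. t \<le> q $ i} \<noteq> {}" for i using assms(2) by (auto simp: above_grid_def)
  have "cell_floor T q $ i \<in> {t \<in> T i. t \<le> q $ i}" for i
    unfolding cell_floor_def using Max_in[OF fin ne] by simp
  then show a: "cell_floor T q $ i \<in> T i" "cell_floor T q $ i \<le> q $ i" for i by auto
  show b: "t \<le> cell_floor T q $ i" if "t \<in> T i" "t \<le> q $ i" for i t
    unfolding cell_floor_def using Max_ge[OF fin] that by simp
  show "cell_floor T q \<le> q" using a(2) by (auto simp: less_eq_vec_def)
  show "same_cell T (cell_floor T q) q" using a b by (auto simp: same_cell_def intro: order_trans)
qed

lemma above_grid_mono: "above_grid T q \<Longrightarrow> q \<le> r \<Longrightarrow> above_grid T r"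
  unfolding above_grid_def less_eq_vec_def by (meson order_trans)

lemma cell_floor_mono:
  assumes "finite_grid T" "above_grid T q" "q \<le> r"
  shows "cell_floor T q \<le> cell_floor T r"
  using cell_floor_ge[OF assms(1) above_grid_mono[OF assms(2,3)]] cell_floor_in[OF assms(1,2)]
    cell_floor_le_nth[OF assms(1,2)] assms(3)
  unfolding less_eq_vec_def by (meson order_trans)

lemma cell_floor_cong: "same_cell T q r \<Longrightarrow> cell_floor T q = cell_floor T r"
proof -
  assume "same_cell T q r"
  then have "{t \<in> T i. t \<le> q $ i} = {t \<in> T i. t \<le> r $ i}" for i by (auto simp: same_cell_def)
  then show ?thesis by (simp add: cell_floor_def)
qed

lemma above_grid_cong: "same_cell T q r \<Longrightarrow> above_grid T q \<longleftrightarrow> above_grid T r"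
  unfolding above_grid_def same_cell_def by blast

lemma
  assumes "finite_grid T" "\<And>i. p $ i \<in> T i"
  shows above_grid_point: "above_grid T p" and cell_floor_point: "cell_floor T p = p"
proof -
  show a: "above_grid T p" using assms(2) by (auto simp: above_grid_def)
  show "cell_floor T p = p"
    using cell_floor_le_nth[OF assms(1) a] cell_floor_ge[OF assms(1) a assms(2)]
    by (auto simp: vec_eq_iff intro!: antisym)
qed

text \<open>
  The universal property of the Kan extension is tested on the module \<open>V \<circ> floor\<close>. It yields a
  section of the canonical map \<open>V \<circ> floor \<rightarrow> V\<close>, and \<open>V \<circ> floor\<close> is constant on cells.
\<close>

lemma left_Kan_extension_tame:
  fixes f :: "'p \<Rightarrow> 'a::linorder ^ 'n::finite"
  assumes V: "V \<in> Pers" and fin: "finite P" and K: "is_left_Kan_extension P rel f U V"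
    and mono: "monotone_on P rel (\<le>) f"
  shows "\<exists>T. finite_grid T \<and> tame T V"
proof -
  define T where "T i = (\<lambda>p. f p $ i) ` P" for i
  have T: "finite_grid T" using fin by (simp add: finite_grid_def T_def)
  obtain \<eta> where \<eta>: "pers_hom_on P rel U (pullback f V) \<eta>"
    and "\<forall>W\<in>Pers. \<forall>\<alpha>. pers_hom_on P rel U (pullback f W) \<alpha> \<longrightarrow>
        (\<exists>\<beta>. pers_hom V W \<beta> \<and>
              (\<forall>p\<in>P. \<forall>u\<in>fib U p. \<beta> (f p) (\<eta> p u) = \<alpha> p u) \<and>
              (\<forall>\<beta>'. pers_hom V W \<beta>' \<and>
                     (\<forall>p\<in>P. \<forall>u\<in>fib U p. \<beta>' (f p) (\<eta> p u) = \<alpha> p u) \<longrightarrow>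
                     (\<forall>q. \<forall>v\<in>fib V q. \<beta>' q v = \<beta> q v)))"
    using K unfolding is_left_Kan_extension_def by (elim exE conjE) (rule that)
  note univ = this(2)[rule_format]
  \<comment> \<open>\<open>W\<close> is \<open>V \<circ> floor\<close> and \<open>c : W \<rightarrow> V\<close> the canonical map. They agree at the points \<open>f p\<close>, so \<open>\<eta>\<close> also maps into \<open>W\<close>.\<close>
  define W where "W = \<lparr>fib = (\<lambda>q. if above_grid T q then fib V (cell_floor T q) else {0}),
     tmap = (\<lambda>q r. if above_grid T q then tmap V (cell_floor T q) (cell_floor T r) else (\<lambda>_. 0))\<rparr>"
  define c where "c q = (if above_grid T q then tmap V (cell_floor T q) q else (\<lambda>_. 0))" for q
  have fl: "above_grid T (f p)" "cell_floor T (f p) = f p" if "p \<in> P" for p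
  proof -
    have "f p $ i \<in> T i" for i using that by (auto simp: T_def)
    then show "above_grid T (f p)" "cell_floor T (f p) = f p"
      using above_grid_point[OF T] cell_floor_point[OF T] by blast+
  qed
  have WP: "W \<in> Pers"
  proof (rule PersI)
    show "fin_dim_subspace (fib W q)" for q
      using PersD(1)[OF V] by (simp add: W_def fin_dim_subspace_zero)
    show "linear_between (fib W q) (fib W r) (tmap W q r)" if "q \<le> r" for q r
      using above_grid_mono[OF _ that] cell_floor_mono[OF T _ that] PersD[OF V] fin_dim_subspace_zero
      by (auto simp: W_def intro!: linear_between_const_zero)
    show "tmap W q q v = v" if "v \<in> fib W q" for q v
      using that PersD[OF V] by (auto simp: W_def split: if_splits)
    show "tmap W r s (tmap W q r v) = tmap W q s v"
      if "q \<le> r" "r \<le> s" "v \<in> fib W q" for q r s v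
      using that above_grid_mono[OF _ that(1)] above_grid_mono[OF _ that(2)]
        cell_floor_mono[OF T _ that(1)] cell_floor_mono[OF T _ that(2)] PersD[OF V]
      by (auto simp: W_def)
  qed
  have cW: "pers_hom W V c"
  proof (rule pers_homI)
    show "linear_between (fib W q) (fib V q) (c q)" for q
      using PersD[OF V] cell_floor_le[OF T] by (auto simp: W_def c_def intro!: linear_between_const_zero)
    show "c r (tmap W q r v) = tmap V q r (c q v)" if "q \<le> r" "v \<in> fib W q" for q r v
      using that above_grid_mono[OF _ that(1)] PersD[OF V] cell_floor_le[OF T]
        cell_floor_mono[OF T _ that(1)]
      by (auto simp: W_def c_def)
  qed
  have "pers_hom_on P rel U (pullback f W) \<eta>"
    using \<eta> fl unfolding pers_hom_on_def by (simp add: W_def pullback_def)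
  then obtain \<beta> where \<beta>: "pers_hom V W \<beta>" "\<forall>p\<in>P. \<forall>u\<in>fib U p. \<beta> (f p) (\<eta> p u) = \<eta> p u"
    using univ[OF WP] by blast
  have c\<beta>hom: "pers_hom V V (\<lambda>q v. c q (\<beta> q v))"
    by (rule pers_homI, rule linear_between_comp[OF pers_homD(1)[OF \<beta>(1)] pers_homD(1)[OF cW]])
      (simp add: pers_homD[OF \<beta>(1)] pers_homD[OF cW])
  have idhom: "pers_hom V V (\<lambda>q v. v)"
    by (auto simp: pers_hom_on_def linear_between_def)
  have \<eta>V: "\<eta> p u \<in> fib V (f p)" if "p \<in> P" "u \<in> fib U p" for p u
  proof -
    have "linear_between (fib U p) (fib V (f p)) (\<eta> p)"
      using \<eta> that by (simp add: pers_hom_on_def pullback_def)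
    then show ?thesis using that linear_between_image by blast
  qed
  have c\<beta>\<eta>: "c (f p) (\<beta> (f p) (\<eta> p u)) = \<eta> p u" if "p \<in> P" "u \<in> fib U p" for p u
    using that \<beta>(2) fl[OF that(1)] PersD(5)[OF V \<eta>V[OF that]] by (simp add: c_def)
  \<comment> \<open>Uniqueness: \<open>c \<circ> \<beta>\<close> and the identity of \<open>V\<close> both extend \<open>\<eta>\<close>.\<close>
  obtain \<gamma> where \<gamma>: "\<forall>\<beta>'. pers_hom V V \<beta>' \<and> (\<forall>p\<in>P. \<forall>u\<in>fib U p. \<beta>' (f p) (\<eta> p u) = \<eta> p u) \<longrightarrow>
      (\<forall>q. \<forall>v\<in>fib V q. \<beta>' q v = \<gamma> q v)"
    using univ[OF V \<eta>] by (elim exE conjE) (rule that)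
  have c\<beta>: "c q (\<beta> q v) = v" if "v \<in> fib V q" for q v
    using \<gamma>[rule_format, of "\<lambda>q v. c q (\<beta> q v)" v q, OF conjI[OF c\<beta>hom] that]
      \<gamma>[rule_format, of "\<lambda>q v. v" v q, OF conjI[OF idhom] that] c\<beta>\<eta> by simp
  have "tame T V"
    unfolding tame_def
  proof (intro conjI allI impI)
    fix q r assume qr: "q \<le> r" "same_cell T q r"
    show "bij_betw (tmap V q r) (fib V q) (fib V r)"
    proof (cases "above_grid T q")
      case True
      have r: "above_grid T r" and fr: "cell_floor T r = cell_floor T q"
        using True above_grid_cong[OF qr(2)] cell_floor_cong[OF qr(2)] by auto
      have "\<beta> r (tmap V q r v) = \<beta> q v" if "v \<in> fib V q" for v
        using pers_homD(2)[OF \<beta>(1) qr(1) that] pers_homD(3)[OF \<beta>(1) that] True PersD(5)[OF V] fr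
        by (simp add: W_def)
      then have "c q (\<beta> r (tmap V q r v)) = v" if "v \<in> fib V q" for v
        using that c\<beta> by simp
      moreover have "tmap V q r (c q (\<beta> r w)) = w \<and> c q (\<beta> r w) \<in> fib V q" if "w \<in> fib V r" for w
      proof -
        have "\<beta> r w \<in> fib V (cell_floor T q)"
          using pers_homD(3)[OF \<beta>(1) that] r fr by (simp add: W_def)
        then have "tmap V q r (c q (\<beta> r w)) = c r (\<beta> r w)" "c q (\<beta> r w) \<in> fib V q"
          using True r fr qr PersD[OF V] cell_floor_le[OF T] by (simp_all add: c_def)
        then show ?thesis using c\<beta>[OF that] by simp
      qed
      ultimately show ?thesis
        using PersD(7)[OF V qr(1)]
        by (intro bij_betw_byWitness[where f' = "\<lambda>w. c q (\<beta> r w)"]) auto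
    next
      case False
      have r: "\<not> above_grid T r" using False above_grid_cong[OF qr(2)] by auto
      have "fib V x = {0}" if "\<not> above_grid T x" for x
        using c\<beta>[of _ x] that PersD(3)[OF V] by (auto simp: c_def)
      then show ?thesis using False r PersD(8)[OF V qr(1)] by (simp add: bij_betw_def)
    qed
  next
    fix q assume "\<not> above_grid T q"
    then show "fib V q = {0}"
      using c\<beta>[of _ q] PersD(3)[OF V] by (auto simp: c_def)
  qed
  then show ?thesis using T by blast
qed

text \<open>
  Conversely a tame module is the Kan extension of its restriction to the grid points; the grid is
  enumerated because the finite posets of \<^const>\<open>Pers_fp\<close> are carried by sets of numbers.
\<close>

lemma tame_left_Kan_extension:
  fixes V :: "('a::linorder ^ 'n::finite, 'k::field) pmod"
  assumes V: "V \<in> Pers" and T: "finite_grid T" and tm: "tame T V"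
  shows "V \<in> Pers_fp"
proof -
  define G where "G = {p. \<forall>i. p $ i \<in> T i}"
  have "G \<subseteq> vec_lambda ` (PiE UNIV T)"
  proof
    fix p assume "p \<in> G"
    then have "vec_nth p \<in> PiE UNIV T" by (auto simp: G_def)
    then show "p \<in> vec_lambda ` (PiE UNIV T)" by (metis image_eqI vec_nth_inverse)
  qed
  moreover have "finite (PiE UNIV T)" using T by (intro finite_PiE) (auto simp: finite_grid_def)
  ultimately have finG: "finite G" using finite_subset by blast
  obtain e where e: "bij_betw e G {0..<card G}" using ex_bij_betw_finite_nat[OF finG] by blast
  define P where "P = {0..<card G}"
  define f where "f = inv_into G e"
  have f: "bij_betw f P G" unfolding f_def P_def using e by (rule bij_betw_inv_into)
  have fe: "f (e p) = p" "e p \<in> P" if "p \<in> G" for p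
    using that e unfolding f_def P_def by (simp_all only: bij_betw_inv_into_left bij_betw_apply)
  have fP: "f m \<in> G" if "m \<in> P" for m using f that bij_betw_apply by metis
  have finj: "m = n" if "m \<in> P" "n \<in> P" "f m = f n" for m n
    using f that by (auto simp: bij_betw_def inj_on_def)
  have ef: "e (f m) = m" if "m \<in> P" for m using that fP fe finj by blast
  define rel where "rel m n \<longleftrightarrow> f m \<le> f n" for m n
  have flG: "cell_floor T q \<in> G" if "above_grid T q" for q
    using cell_floor_in[OF T that] by (auto simp: G_def)
  have Gfl: "above_grid T p" "cell_floor T p = p" if "p \<in> G" for p
    using that T by (auto intro!: above_grid_point cell_floor_point simp: G_def)
  have bij: "bij_betw (tmap V (cell_floor T q) q) (fib V (cell_floor T q)) (fib V q)"
    if "above_grid T q" for q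
    using tame_bij[OF tm] cell_floor_le[OF T that] same_cell_floor[OF T that] by blast
  have K: "is_left_Kan_extension P rel f (pullback f V) V"
    unfolding is_left_Kan_extension_def
  proof (rule exI[of _ "\<lambda>_ v. v"], intro conjI ballI allI impI)
    show "pers_hom_on P rel (pullback f V) (pullback f V) (\<lambda>_ v. v)"
      by (auto simp: pers_hom_on_def linear_between_def)
    fix W :: "('a ^ 'n, 'k) pmod" and \<alpha>
    assume W: "W \<in> Pers" and \<alpha>: "pers_hom_on P rel (pullback f V) (pullback f W) \<alpha>"
    \<comment> \<open>\<open>\<alpha>\<close> indexed by grid points instead of numbers; a morphism out of \<open>V\<close> is forced to be \<open>\<alpha>'\<close> transported from the floor.\<close>
    define \<alpha>' where "\<alpha>' p = \<alpha> (e p)" for p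
    have \<alpha>'lin: "linear_between (fib V p) (fib W p) (\<alpha>' p)" if "p \<in> G" for p
      using \<alpha> fe[OF that] by (auto simp: pers_hom_on_def pullback_def \<alpha>'_def)
    have \<alpha>'nat: "\<alpha>' p' (tmap V p p' v) = tmap W p p' (\<alpha>' p v)"
      if "p \<in> G" "p' \<in> G" "p \<le> p'" "v \<in> fib V p" for p p' v
    proof -
      have nat: "\<alpha> n (tmap V (f m) (f n) v) = tmap W (f m) (f n) (\<alpha> m v)"
        if "m \<in> P" "n \<in> P" "f m \<le> f n" "v \<in> fib V (f m)" for m n v
        using \<alpha> that by (simp add: pers_hom_on_def pullback_def rel_def)
      show ?thesis using nat[of "e p" "e p'" v] fe that by (simp add: \<alpha>'_def)
    qed
    define \<beta> where "\<beta> q = (if above_grid T q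
      then (\<lambda>v. tmap W (cell_floor T q) q (\<alpha>' (cell_floor T q)
             (inv_into (fib V (cell_floor T q)) (tmap V (cell_floor T q) q) v)))
      else (\<lambda>_. 0))" for q
    have \<beta>: "\<beta> q (tmap V (cell_floor T q) q u) = tmap W (cell_floor T q) q (\<alpha>' (cell_floor T q) u)"
      if "above_grid T q" "u \<in> fib V (cell_floor T q)" for q u
      using bij[OF that(1)] that by (simp add: \<beta>_def bij_betw_def inv_into_f_f)
    have ex: "\<exists>u\<in>fib V (cell_floor T q). v = tmap V (cell_floor T q) q u"
      if "above_grid T q" "v \<in> fib V q" for q v
      using bij[OF that(1)] that by (auto simp: bij_betw_def)
    have \<beta>hom: "pers_hom V W \<beta>"
    proof (rule pers_homI)
      show "linear_between (fib V q) (fib W q) (\<beta> q)" for q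
      proof (cases "above_grid T q")
        case True
        have "linear_between (fib V q) (fib V (cell_floor T q))
           (inv_into (fib V (cell_floor T q)) (tmap V (cell_floor T q) q))"
          using linear_between_inv_into[OF PersD(4)[OF V cell_floor_le[OF T True]] PersD(2)[OF V]]
            bij[OF True] by (auto simp: bij_betw_def)
        then show ?thesis
          unfolding \<beta>_def using True
          by (simp add: linear_between_comp[OF _ linear_between_comp[OF \<alpha>'lin[OF flG[OF True]]
               PersD(4)[OF W cell_floor_le[OF T True]]]])
      next
        case False
        then show ?thesis using PersD(3)[OF W] by (simp add: \<beta>_def linear_between_const_zero)
      qed
      show "\<beta> r (tmap V q r v) = tmap W q r (\<beta> q v)" if qr: "q \<le> r" "v \<in> fib V q" for q r v
      proof (cases "above_grid T q")
        case True
        let ?q = "cell_floor T q" and ?r = "cell_floor T r"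
        have r: "above_grid T r" using above_grid_mono[OF True qr(1)] .
        note le = cell_floor_le[OF T True] cell_floor_le[OF T r] cell_floor_mono[OF T True qr(1)]
        obtain u where u: "u \<in> fib V ?q" "v = tmap V ?q q u" using ex[OF True qr(2)] by blast
        have "\<alpha>' ?q u \<in> fib W ?q"
          using \<alpha>'lin[OF flG[OF True]] u linear_between_image by blast
        then show ?thesis
          using u qr le PersD[OF V] PersD[OF W] \<beta>[OF True u(1)] \<beta>[OF r, of "tmap V ?q ?r u"]
            \<alpha>'nat[OF flG[OF True] flG[OF r] le(3) u(1)] by simp
      next
        case False
        then have "v = 0" using tame_zero[OF tm] qr by auto
        moreover have "\<beta> r 0 = 0"
        proof (cases "above_grid T r")
          case r: True
          have "\<alpha>' (cell_floor T r) 0 = 0"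
            using linear_between_zero[OF \<alpha>'lin[OF flG[OF r]] PersD(2)[OF V]] .
          then show ?thesis using \<beta>[OF r, of 0] PersD[OF V] PersD[OF W] cell_floor_le[OF T r] by simp
        qed (simp add: \<beta>_def)
        ultimately show ?thesis using False PersD(8)[OF V qr(1)] PersD(8)[OF W qr(1)] by (simp add: \<beta>_def)
      qed
    qed
    have \<beta>G: "\<beta> p v = \<alpha>' p v" if "p \<in> G" "v \<in> fib V p" for p v
      using \<beta>[of p v] that Gfl PersD[OF V] PersD[OF W] linear_between_image(2)[OF \<alpha>'lin] by simp
    show "\<exists>\<beta>. pers_hom V W \<beta> \<and>
              (\<forall>p\<in>P. \<forall>u\<in>fib (pullback f V) p. \<beta> (f p) u = \<alpha> p u) \<and>
              (\<forall>\<beta>'. pers_hom V W \<beta>' \<and>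
                     (\<forall>p\<in>P. \<forall>u\<in>fib (pullback f V) p. \<beta>' (f p) u = \<alpha> p u) \<longrightarrow>
                     (\<forall>q. \<forall>v\<in>fib V q. \<beta>' q v = \<beta> q v))"
    proof (intro exI[of _ \<beta>] conjI ballI allI impI)
      show "pers_hom V W \<beta>" by (rule \<beta>hom)
      show "\<beta> (f p) u = \<alpha> p u" if "p \<in> P" "u \<in> fib (pullback f V) p" for p u
        using that \<beta>G fP ef by (simp add: pullback_def \<alpha>'_def)
      fix \<beta>' q v
      assume \<beta>': "pers_hom V W \<beta>' \<and> (\<forall>p\<in>P. \<forall>u\<in>fib (pullback f V) p. \<beta>' (f p) u = \<alpha> p u)"
        and v: "v \<in> fib V q"
      show "\<beta>' q v = \<beta> q v"
      proof (cases "above_grid T q")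
        case True
        let ?q = "cell_floor T q"
        obtain u where u: "u \<in> fib V ?q" "v = tmap V ?q q u" using ex[OF True v] by blast
        have "\<beta>' ?q u = \<alpha>' ?q u"
          using \<beta>' fe[OF flG[OF True]] u by (force simp: pullback_def \<alpha>'_def)
        then show ?thesis
          using u \<beta>[OF True u(1)] pers_homD(2)[of V W \<beta>', OF _ cell_floor_le[OF T True] u(1)] \<beta>' by simp
      next
        case False
        then have "v = 0" using tame_zero[OF tm] v by auto
        then show ?thesis
          using linear_between_zero[OF pers_homD(1) PersD(2)[OF V]] \<beta>' \<beta>hom by metis
      qed
    qed
  qed
  have U: "pullback f V \<in> Pers_on P rel"
    using V by (auto simp: Pers_on_def pullback_def rel_def)
  have "reflp_on P rel" "transp_on P rel" "antisymp_on P rel" "monotone_on P rel (\<le>) f"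
    unfolding rel_def reflp_on_def transp_on_def antisymp_on_def monotone_on_def
    using finj by (auto intro: antisym order_trans)
  then show ?thesis
    unfolding Pers_fp_def using V K U by (blast intro: finite_atLeastLessThan[of 0 "card G", folded P_def])
qed

lemma Pers_fp_iff_tame:
  "V \<in> Pers_fp \<longleftrightarrow> V \<in> Pers \<and> (\<exists>T. finite_grid T \<and> tame T V)"
  for V :: "('a::linorder ^ 'n::finite, 'k::field) pmod"
proof
  assume "V \<in> Pers_fp"
  then show "V \<in> Pers \<and> (\<exists>T. finite_grid T \<and> tame T V)"
    unfolding Pers_fp_def using left_Kan_extension_tame by blast
qed (use tame_left_Kan_extension in blast)

lemma Pers_fp_imp_Pers: "V \<in> Pers_fp \<Longrightarrow> V \<in> Pers"
  by (simp add: Pers_fp_def)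

section \<open>Finitely presented subobjects and quotients\<close>

definition fp_sub :: "('q::order, 'k::field) pmod \<Rightarrow> ('q \<Rightarrow> 'k poly set) \<Rightarrow> bool" where
  "fp_sub V S \<longleftrightarrow> S \<le> fib V \<and> submod V S \<in> Pers_fp"

lemma fib_submod [simp]: "fib (submod V S) = S"
  and tmap_submod [simp]: "tmap (submod V S) = tmap V"
  and submod_submod [simp]: "submod (submod V S) S' = submod V S'"
  and submod_fib [simp]: "submod V (fib V) = V"
  by (simp_all add: submod_def)

lemma fp_sub_fib: "V \<in> Pers_fp \<Longrightarrow> fp_sub V (fib V)"
  by (simp add: fp_sub_def)

lemma fp_sub_submod: "fp_sub (submod V A) B \<longleftrightarrow> fp_sub V B \<and> B \<le> A" if "fp_sub V A"
  using that by (auto simp: fp_sub_def intro: order_trans)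

lemma fp_subD:
  assumes "fp_sub V S"
  shows "submod V S \<in> Pers_fp" "submod V S \<in> Pers" "amb.subspace (S q)" "0 \<in> S q"
    and "v \<in> S q \<Longrightarrow> v \<in> fib V q"
    and "q \<le> r \<Longrightarrow> v \<in> S q \<Longrightarrow> tmap V q r v \<in> S r"
proof -
  show "submod V S \<in> Pers_fp" using assms by (simp add: fp_sub_def)
  then show P: "submod V S \<in> Pers" by (rule Pers_fp_imp_Pers)
  show "amb.subspace (S q)" "0 \<in> S q" using PersD(2,3)[OF P, of q] by auto
  show "v \<in> S q \<Longrightarrow> v \<in> fib V q" using assms by (auto simp: fp_sub_def le_fun_def)
  show "q \<le> r \<Longrightarrow> v \<in> S q \<Longrightarrow> tmap V q r v \<in> S r" using PersD(7)[OF P, of q r v] by simp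
qed

lemma fp_sub_subset: "fp_sub V S \<Longrightarrow> S q \<subseteq> fib V q"
  by (simp add: fp_sub_def le_fun_def)

lemma linear_between_restrict:
  "linear_between A B f \<Longrightarrow> A' \<subseteq> A \<Longrightarrow> linear_between A' B f"
  unfolding linear_between_def by blast

lemma submod_Pers:
  assumes V: "V \<in> Pers" and "\<And>q. amb.subspace (S q)" "\<And>q. S q \<subseteq> fib V q"
    and "\<And>q r v. q \<le> r \<Longrightarrow> v \<in> S q \<Longrightarrow> tmap V q r v \<in> S r"
  shows "submod V S \<in> Pers"
proof (rule PersI)
  show "fin_dim_subspace (fib (submod V S) q)" for q
    using fin_dim_subspace_subset[OF PersD(1)[OF V] assms(2,3)] by simp
  show "linear_between (fib (submod V S) q) (fib (submod V S) r) (tmap (submod V S) q r)" if "q \<le> r" for q r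
    using linear_between_subset[OF PersD(4)[OF V that] assms(3)] assms(4)[OF that] by auto
  show "tmap (submod V S) q q v = v" if "v \<in> fib (submod V S) q" for q v
    using that PersD(5)[OF V] assms(3) by auto
  show "tmap (submod V S) r s (tmap (submod V S) q r v) = tmap (submod V S) q s v"
    if "q \<le> r" "r \<le> s" "v \<in> fib (submod V S) q" for q r s v
    using PersD(6)[OF V that(1,2)] that(3) assms(3) by auto
qed

text \<open>
  On a cell of a tame module all fibres are identified. A subobject is tame for the same grid if and
  only if these identifications reflect membership in it.
\<close>

lemma tame_submodI:
  assumes V: "V \<in> Pers" "tame T V" and S: "submod V S \<in> Pers" "S \<le> fib V"
    and refl: "\<And>q r v. q \<le> r \<Longrightarrow> same_cell T q r \<Longrightarrow> v \<in> fib V q \<Longrightarrow> tmap V q r v \<in> S r \<Longrightarrow> v \<in> S q"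
  shows "tame T (submod V S)"
  unfolding tame_def
proof (intro conjI allI impI)
  fix q r assume qr: "q \<le> r" "same_cell T q r"
  have sub: "S x \<subseteq> fib V x" for x using S(2) by (simp add: le_fun_def)
  have b: "bij_betw (tmap V q r) (fib V q) (fib V r)" using tame_bij[OF V(2) qr] .
  have "tmap V q r ` S q = S r"
  proof
    show "tmap V q r ` S q \<subseteq> S r" using PersD(7)[OF S(1) qr(1)] by auto
    show "S r \<subseteq> tmap V q r ` S q"
    proof
      fix w assume w: "w \<in> S r"
      then have "w \<in> tmap V q r ` fib V q" using b sub[of r] by (auto simp: bij_betw_def)
      then obtain v where "v \<in> fib V q" "w = tmap V q r v" by blast
      then show "w \<in> tmap V q r ` S q" using refl[OF qr] w by blast
    qed
  qed
  then show "bij_betw (tmap (submod V S) q r) (fib (submod V S) q) (fib (submod V S) r)"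
    using b inj_on_subset[OF _ sub] by (auto simp: bij_betw_def)
next
  fix q assume "\<not> above_grid T q"
  then have "S q \<subseteq> {0}" using tame_zero[OF V(2)] S(2) by (metis le_funD)
  then show "fib (submod V S) q = {0}" using PersD(3)[OF S(1), of q] by auto
qed

lemma tame_sub_reflect:
  assumes "tame T V" "tame T (submod V S)" "S \<le> fib V"
    and "q \<le> r" "same_cell T q r" "v \<in> fib V q" "tmap V q r v \<in> S r"
  shows "v \<in> S q"
proof -
  have "bij_betw (tmap V q r) (S q) (S r)" using tame_bij[OF assms(2,4,5)] by simp
  then obtain s where s: "s \<in> S q" "tmap V q r s = tmap V q r v" using assms(7) by (force simp: bij_betw_def)
  have "s \<in> fib V q" using s assms(3) by (auto simp: le_fun_def)
  then have "s = v" using tame_bij[OF assms(1,4,5)] s assms(6) by (auto simp: bij_betw_def inj_on_def)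
  then show ?thesis using s by simp
qed

lemma fp_subI:
  fixes V :: "('a::linorder ^ 'n::finite, 'k::field) pmod"
  assumes V: "V \<in> Pers" "tame T V" "finite_grid T"
    and S: "\<And>q. amb.subspace (S q)" "\<And>q. S q \<subseteq> fib V q"
       "\<And>q r v. q \<le> r \<Longrightarrow> v \<in> S q \<Longrightarrow> tmap V q r v \<in> S r"
    and refl: "\<And>q r v. q \<le> r \<Longrightarrow> same_cell T q r \<Longrightarrow> v \<in> fib V q \<Longrightarrow> tmap V q r v \<in> S r \<Longrightarrow> v \<in> S q"
  shows "fp_sub V S" "tame T (submod V S)"
proof -
  have le: "S \<le> fib V" using S(2) by (simp add: le_fun_def)
  have P: "submod V S \<in> Pers" by (rule submod_Pers[OF V(1) S])
  show "tame T (submod V S)" by (rule tame_submodI[OF V(1,2) P le refl])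
  then show "fp_sub V S" using P le V(3) by (auto simp: fp_sub_def Pers_fp_iff_tame)
qed

lemma fp_sub_tame:
  fixes V :: "('a::linorder ^ 'n::finite, 'k::field) pmod"
  assumes "fp_sub V S"
  obtains T where "finite_grid T" "tame T (submod V S)"
  using assms by (auto simp: fp_sub_def Pers_fp_iff_tame)

lemma common_grid:
  fixes V W :: "('a::linorder ^ 'n::finite, 'k::field) pmod"
  assumes "V \<in> Pers_fp" "W \<in> Pers_fp" "fp_sub V A" "fp_sub W D"
  obtains T where "finite_grid T" "tame T V" "tame T W" "tame T (submod V A)" "tame T (submod W D)"
proof -
  obtain T1 where 1: "finite_grid T1" "tame T1 V" using assms by (auto simp: Pers_fp_iff_tame)
  obtain T2 where 2: "finite_grid T2" "tame T2 W" using assms by (auto simp: Pers_fp_iff_tame)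
  obtain T3 where 3: "finite_grid T3" "tame T3 (submod V A)" using assms fp_sub_tame by blast
  obtain T4 where 4: "finite_grid T4" "tame T4 (submod W D)" using assms fp_sub_tame by blast
  define T where "T i = T1 i \<union> T2 i \<union> (T3 i \<union> T4 i)" for i
  have "finite_grid T" using 1 2 3 4 by (auto simp: T_def finite_grid_def)
  moreover have "T1 i \<subseteq> T i" "T2 i \<subseteq> T i" "T3 i \<subseteq> T i" "T4 i \<subseteq> T i" for i by (auto simp: T_def)
  ultimately show ?thesis
    using that tame_mono[OF 1(2)] tame_mono[OF 2(2)] tame_mono[OF 3(2)] tame_mono[OF 4(2)] by blast
qed

lemma tame_sub_zero:
  fixes V :: "('a::linorder ^ 'n::finite, 'k::field) pmod"
  assumes P: "V \<in> Pers" and T: "tame T V" "finite_grid T"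
  shows "fp_sub V (\<lambda>_. {0})" "tame T (submod V (\<lambda>_. {0}))"
proof -
  have r: "v \<in> {0}" if "q \<le> r" "same_cell T q r" "v \<in> fib V q" "tmap V q r v \<in> {0}" for q r v
  proof -
    have "tmap V q r v = tmap V q r 0" using that PersD(8)[OF P] by simp
    then show ?thesis
      using tame_bij[OF T(1) that(1,2)] PersD(3)[OF P] that(3) by (auto simp: bij_betw_def inj_on_def)
  qed
  have "amb.subspace {0 :: 'k poly}" by (rule amb.subspace_single_0)
  moreover have "{0} \<subseteq> fib V q" for q using PersD(3)[OF P] by blast
  moreover have "tmap V q r v \<in> {0}" if "q \<le> r" "v \<in> {0}" for q r v using that PersD(8)[OF P] by simp
  ultimately show "fp_sub V (\<lambda>_. {0})" "tame T (submod V (\<lambda>_. {0}))"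
    using fp_subI[OF P T, of "\<lambda>_. {0}"] r by blast+
qed

lemma fp_sub_zero: "V \<in> Pers_fp \<Longrightarrow> fp_sub V (\<lambda>_. {0})"
  for V :: "('a::linorder ^ 'n::finite, 'k::field) pmod"
  using tame_sub_zero(1) by (auto simp: Pers_fp_iff_tame)

lemma fp_sub_preimage:
  fixes V W :: "('a::linorder ^ 'n::finite, 'k::field) pmod"
  assumes V: "V \<in> Pers_fp" and W: "W \<in> Pers_fp" and h: "pers_hom V W h"
    and A: "fp_sub V A" and D: "fp_sub W D"
  shows "fp_sub V (\<lambda>q. {v \<in> A q. h q v \<in> D q})"
proof -
  obtain T where T: "finite_grid T" "tame T V" "tame T W" "tame T (submod V A)" "tame T (submod W D)"
    by (rule common_grid[OF V W A D])
  show ?thesis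
  proof (rule fp_subI(1)[OF Pers_fp_imp_Pers[OF V] T(2,1)])
    show "amb.subspace {v \<in> A q. h q v \<in> D q}" for q
    proof (rule subspace_linear_preimage[OF _ fp_subD(3)[OF A] fp_subD(3)[OF D]])
      show "linear_between (A q) (fib W q) (h q)"
        by (rule linear_between_restrict[OF pers_homD(1)[OF h] fp_sub_subset[OF A]])
    qed
    show "{v \<in> A q. h q v \<in> D q} \<subseteq> fib V q" for q using fp_subD(5)[OF A] by blast
    show "tmap V q r v \<in> {v \<in> A r. h r v \<in> D r}" if "q \<le> r" "v \<in> {v \<in> A q. h q v \<in> D q}" for q r v
      using that fp_subD(5,6)[OF A, where q=q] fp_subD(6)[OF D that(1)] pers_homD(2)[OF h that(1)] by auto
    show "v \<in> {v \<in> A q. h q v \<in> D q}"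
      if "q \<le> r" "same_cell T q r" "v \<in> fib V q" "tmap V q r v \<in> {v \<in> A r. h r v \<in> D r}" for q r v
    proof -
      have "v \<in> A q" using tame_sub_reflect[OF T(2,4) _ that(1-3)] that(4) A by (auto simp: fp_sub_def)
      moreover have "tmap W q r (h q v) \<in> D r" using that pers_homD(2)[OF h that(1,3)] by auto
      then have "h q v \<in> D q"
        using tame_sub_reflect[OF T(3,5) _ that(1,2) pers_homD(3)[OF h that(3)]] D by (auto simp: fp_sub_def)
      ultimately show ?thesis by blast
    qed
  qed
qed

lemma pers_hom_id: "V \<in> Pers \<Longrightarrow> pers_hom V V (\<lambda>_ v. v)"
  by (auto simp: pers_hom_on_def linear_between_def)

lemma fp_sub_Int:
  fixes V :: "('a::linorder ^ 'n::finite, 'k::field) pmod"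
  assumes V: "V \<in> Pers_fp" and A: "fp_sub V A" and B: "fp_sub V B"
  shows "fp_sub V (\<lambda>q. A q \<inter> B q)"
  using fp_sub_preimage[OF V V pers_hom_id[OF Pers_fp_imp_Pers[OF V]] A B] by (simp add: Int_def)

lemma fp_sub_image:
  fixes V W :: "('a::linorder ^ 'n::finite, 'k::field) pmod"
  assumes V: "V \<in> Pers_fp" and W: "W \<in> Pers_fp" and h: "pers_hom V W h" and A: "fp_sub V A"
  shows "fp_sub W (\<lambda>q. h q ` A q)"
proof -
  obtain T where T: "finite_grid T" "tame T V" "tame T W" "tame T (submod V A)"
    using common_grid[OF V W A fp_sub_fib[OF W]] by blast
  have lin: "linear_between (A q) (fib W q) (h q)" for q
    by (rule linear_between_restrict[OF pers_homD(1)[OF h] fp_sub_subset[OF A]])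
  show ?thesis
  proof (rule fp_subI(1)[OF Pers_fp_imp_Pers[OF W] T(3,1)])
    show "amb.subspace (h q ` A q)" for q by (rule subspace_linear_image[OF lin fp_subD(3)[OF A]])
    show "h q ` A q \<subseteq> fib W q" for q using lin by (rule linear_between_image)
    have nat: "h r (tmap V q r v) = tmap W q r (h q v)" if "q \<le> r" "v \<in> A q" for q r v
      using pers_homD(2)[OF h that(1)] fp_subD(5)[OF A that(2)] .
    show "tmap W q r w \<in> h r ` A r" if "q \<le> r" "w \<in> h q ` A q" for q r w
    proof -
      obtain v where "v \<in> A q" "w = h q v" using \<open>w \<in> h q ` A q\<close> by auto
      then show ?thesis using nat[OF that(1)] fp_subD(6)[OF A that(1)] by (metis imageI)
    qed
    show "w \<in> h q ` A q"
      if "q \<le> r" "same_cell T q r" "w \<in> fib W q" "tmap W q r w \<in> h r ` A r" for q r w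
    proof -
      obtain a where a: "a \<in> A r" "tmap W q r w = h r a" using \<open>tmap W q r w \<in> h r ` A r\<close> by blast
      have "bij_betw (tmap V q r) (A q) (A r)" using tame_bij[OF T(4) that(1,2)] by simp
      then obtain a' where a': "a' \<in> A q" "a = tmap V q r a'" using a by (auto simp: bij_betw_def)
      have "tmap W q r w = tmap W q r (h q a')" using nat[OF that(1) a'(1)] a a' by simp
      moreover have "h q a' \<in> fib W q" using lin a'(1) linear_between_image by blast
      ultimately have "w = h q a'" using tame_bij[OF T(3) that(1,2)] that(3) by (auto simp: bij_betw_def inj_on_def)
      then show ?thesis using a' by blast
    qed
  qed
qed

lemma fp_sub_sum:
  fixes V :: "('a::linorder ^ 'n::finite, 'k::field) pmod"
  assumes V: "V \<in> Pers_fp" and A: "fp_sub V A" and B: "fp_sub V B"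
  shows "fp_sub V (\<lambda>q. {x + y | x y. x \<in> A q \<and> y \<in> B q})"
proof -
  obtain T where T: "finite_grid T" "tame T V" "tame T (submod V A)" "tame T (submod V B)"
    using common_grid[OF V V A B] by blast
  have P: "V \<in> Pers" using V by (rule Pers_fp_imp_Pers)
  note add = linear_between_add[OF PersD(4)[OF P]]
  show ?thesis
  proof (rule fp_subI(1)[OF P T(2,1)])
    show "amb.subspace {x + y | x y. x \<in> A q \<and> y \<in> B q}" for q
      by (rule amb.subspace_sums[OF fp_subD(3)[OF A] fp_subD(3)[OF B]])
    show "{x + y | x y. x \<in> A q \<and> y \<in> B q} \<subseteq> fib V q" for q
      using fp_subD(5)[OF A] fp_subD(5)[OF B] amb.subspace_add[OF PersD(2)[OF P]] by auto
    show "tmap V q r w \<in> {x + y | x y. x \<in> A r \<and> y \<in> B r}"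
      if "q \<le> r" "w \<in> {x + y | x y. x \<in> A q \<and> y \<in> B q}" for q r w
    proof -
      obtain a b where ab: "a \<in> A q" "b \<in> B q" "w = a + b"
        using \<open>w \<in> {x + y | x y. x \<in> A q \<and> y \<in> B q}\<close> by auto
      have "tmap V q r w = tmap V q r a + tmap V q r b"
        using ab add[OF that(1)] fp_subD(5)[OF A] fp_subD(5)[OF B] by simp
      then show ?thesis using ab fp_subD(6)[OF A that(1)] fp_subD(6)[OF B that(1)] by blast
    qed
    show "w \<in> {x + y | x y. x \<in> A q \<and> y \<in> B q}"
      if "q \<le> r" "same_cell T q r" "w \<in> fib V q" "tmap V q r w \<in> {x + y | x y. x \<in> A r \<and> y \<in> B r}" for q r w
    proof -
      obtain a b where ab: "a \<in> A r" "b \<in> B r" "tmap V q r w = a + b"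
        using \<open>tmap V q r w \<in> {x + y | x y. x \<in> A r \<and> y \<in> B r}\<close> by auto
      have "bij_betw (tmap V q r) (A q) (A r)" "bij_betw (tmap V q r) (B q) (B r)"
        using tame_bij[OF T(3) that(1,2)] tame_bij[OF T(4) that(1,2)] by simp_all
      then obtain a' b' where a': "a' \<in> A q" "a = tmap V q r a'" "b' \<in> B q" "b = tmap V q r b'"
        using ab unfolding bij_betw_def by (metis imageE)
      have in': "a' \<in> fib V q" "b' \<in> fib V q" using a' fp_subD(5)[OF A] fp_subD(5)[OF B] by auto
      then have "tmap V q r w = tmap V q r (a' + b')" using ab a' add[OF that(1)] by simp
      moreover have "a' + b' \<in> fib V q" using in' amb.subspace_add[OF PersD(2)[OF P]] by blast
      ultimately have "w = a' + b'" using tame_bij[OF T(2) that(1,2)] that(3) by (auto simp: bij_betw_def inj_on_def)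
      then show ?thesis using a' by blast
    qed
  qed
qed

text \<open>
  The quotient by a subobject is realised on fibrewise complements: compose the internal maps with the
  projections.
\<close>

lemma quotient_exists:
  fixes V :: "('a::linorder ^ 'n::finite, 'k::field) pmod"
  assumes V: "V \<in> Pers_fp" and B: "fp_sub V B"
  obtains C g where "C \<in> Pers_fp" "short_exact (submod V B) (\<lambda>_ v. v) V g C"
proof -
  have P: "V \<in> Pers" using V by (rule Pers_fp_imp_Pers)
  obtain T where T: "finite_grid T" "tame T V" "tame T (submod V B)"
    using common_grid[OF V V B B] by blast
  have "\<exists>g. linear_between (fib V q) (fib V q) g \<and> (\<forall>v\<in>B q. g v = 0) \<and> (\<forall>v\<in>fib V q. v - g v \<in> B q)" for q
  proof -
    have "B q \<subseteq> fib V q" using fp_subD(5)[OF B] by blast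
    then show ?thesis
      using projection_exists[OF fp_subD(3)[OF B] PersD(2)[OF P]] by metis
  qed
  then obtain g where g: "\<And>q. linear_between (fib V q) (fib V q) (g q)"
    "\<And>q v. v \<in> B q \<Longrightarrow> g q v = 0" "\<And>q v. v \<in> fib V q \<Longrightarrow> v - g q v \<in> B q"
    by metis
  have gin: "g q v \<in> fib V q" if "v \<in> fib V q" for q v using linear_between_image(2)[OF g(1) that] .
  have gdiff: "g q (u - v) = g q u - g q v" if "u \<in> fib V q" "v \<in> fib V q" for q u v
    using linear_between_diff[OF g(1) PersD(2)[OF P] that] .
  have geq: "g q u = g q v" if "u \<in> fib V q" "v \<in> fib V q" "u - v \<in> B q" for q u v
    using g(2)[OF that(3)] gdiff[OF that(1,2)] by simp
  have gg: "g q (g q v) = g q v" if "v \<in> fib V q" for q v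
    using geq[OF that gin[OF that] g(3)[OF that]] by simp
  have tdiff: "tmap V q r (u - v) = tmap V q r u - tmap V q r v" if "q \<le> r" "u \<in> fib V q" "v \<in> fib V q" for q r u v
    using linear_between_diff[OF PersD(4)[OF P that(1)] PersD(2)[OF P] that(2,3)] .
  have tg: "g r (tmap V q r (g q v)) = g r (tmap V q r v)" if "q \<le> r" "v \<in> fib V q" for q r v
  proof -
    have "tmap V q r (v - g q v) \<in> B r" using fp_subD(6)[OF B that(1) g(3)[OF that(2)]] .
    then have "tmap V q r v - tmap V q r (g q v) \<in> B r" using tdiff that gin by simp
    then show ?thesis using geq PersD(7)[OF P that(1)] gin that by metis
  qed
  have g0: "g q v = 0 \<longleftrightarrow> v \<in> B q" if "v \<in> fib V q" for q v
    using g(3)[OF that] g(2) by auto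
  define C where "C = \<lparr>fib = (\<lambda>q. g q ` fib V q), tmap = (\<lambda>q r v. g r (tmap V q r v))\<rparr>"
  have C: "C \<in> Pers"
  proof (rule PersI)
    show "fin_dim_subspace (fib C q)" for q
      using fin_dim_linear_image[OF g(1) PersD(1)[OF P]] by (simp add: C_def)
    show "linear_between (fib C q) (fib C r) (tmap C q r)" if "q \<le> r" for q r
    proof -
      have "linear_between (fib V q) (fib V r) (\<lambda>v. g r (tmap V q r v))"
        by (rule linear_between_comp[OF PersD(4)[OF P that] g(1)])
      then show ?thesis unfolding C_def using gin PersD(7)[OF P that]
        by (auto intro: linear_between_subset)
    qed
    show "tmap C q q v = v" if "v \<in> fib C q" for q v
      using that gg gin PersD(5)[OF P] by (auto simp: C_def)
    show "tmap C r s (tmap C q r v) = tmap C q s v"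
      if "q \<le> r" "r \<le> s" "v \<in> fib C q" for q r s v
      using that tg[OF that(2)] gin PersD(6)[OF P that(1,2)] PersD(7)[OF P that(1)] by (auto simp: C_def)
  qed
  have "tame T C"
    unfolding tame_def
  proof (intro conjI allI impI)
    fix q r assume qr: "q \<le> r" "same_cell T q r"
    have b: "bij_betw (tmap V q r) (fib V q) (fib V r)" using tame_bij[OF T(2) qr] .
    have "inj_on (tmap C q r) (fib C q)"
    proof (rule inj_onI)
      fix x y assume "x \<in> fib C q" "y \<in> fib C q" and eq: "tmap C q r x = tmap C q r y"
      then have xy: "x \<in> fib V q" "y \<in> fib V q" "g q x = x" "g q y = y"
        using gin gg by (auto simp: C_def)
      have d: "x - y \<in> fib V q" using amb.subspace_diff[OF PersD(2)[OF P] xy(1,2)] .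
      have "g r (tmap V q r (x - y)) = 0"
        using eq tdiff[OF qr(1) xy(1,2)] gdiff[OF PersD(7)[OF P qr(1) xy(1)] PersD(7)[OF P qr(1) xy(2)]]
        by (simp add: C_def)
      then have "tmap V q r (x - y) \<in> B r" using g0 PersD(7)[OF P qr(1) d] by blast
      then have "x - y \<in> B q"
        using tame_sub_reflect[OF T(2,3) _ qr d] B by (simp add: fp_sub_def)
      then show "x = y" using geq xy by metis
    qed
    moreover have "tmap C q r ` fib C q = fib C r"
    proof
      show "tmap C q r ` fib C q \<subseteq> fib C r" using PersD(7)[OF C qr(1)] by blast
      show "fib C r \<subseteq> tmap C q r ` fib C q"
      proof
        fix w assume "w \<in> fib C r"
        then obtain a where "a \<in> fib V r" "w = g r a" by (auto simp: C_def)
        moreover have "a \<in> tmap V q r ` fib V q" using b \<open>a \<in> fib V r\<close> by (simp add: bij_betw_def)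
        ultimately obtain a' where "a' \<in> fib V q" "w = g r (tmap V q r a')" by blast
        then have "w = tmap C q r (g q a')" "g q a' \<in> fib C q" using tg[OF qr(1)] by (simp_all add: C_def)
        then show "w \<in> tmap C q r ` fib C q" by blast
      qed
    qed
    ultimately show "bij_betw (tmap C q r) (fib C q) (fib C r)" by (simp add: bij_betw_def)
  next
    fix q assume "\<not> above_grid T q"
    then have "fib V q = {0}" by (rule tame_zero[OF T(2)])
    then show "fib C q = {0}" using g(2) fp_subD(4)[OF B] by (simp add: C_def)
  qed
  then have "C \<in> Pers_fp" using C T(1) by (auto simp: Pers_fp_iff_tame)
  moreover have "short_exact (submod V B) (\<lambda>_ v. v) V g C"
    unfolding short_exact_def
  proof (intro conjI allI)
    show "pers_hom (submod V B) V (\<lambda>_ v. v)"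
      using fp_subD(5)[OF B] by (auto simp: pers_hom_on_def linear_between_def)
    show "pers_hom V C g"
    proof (rule pers_homI)
      show "linear_between (fib V q) (fib C q) (g q)" for q
        using linear_between_subset[OF g(1)] by (auto simp: C_def)
      show "g r (tmap V q r v) = tmap C q r (g q v)" if "q \<le> r" "v \<in> fib V q" for q r v
        using tg[OF that] by (simp add: C_def)
    qed
    fix q
    show "(\<lambda>v. v) ` fib (submod V B) q = {v \<in> fib V q. g q v = 0}"
      using g0 fp_subD(5)[OF B] by auto
    show "g q ` fib V q = fib C q" by (simp add: C_def)
  qed simp
  ultimately show ?thesis using that by blast
qed

lemma translate_Pers_fp:
  fixes V :: "('a::linordered_idom ^ 'n::finite, 'k::field) pmod"
  assumes V: "V \<in> Pers_fp"
  shows "translate x V \<in> Pers_fp"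
proof -
  have P: "V \<in> Pers" using V by (rule Pers_fp_imp_Pers)
  obtain T where T: "finite_grid T" "tame T V" using V by (auto simp: Pers_fp_iff_tame)
  have mono: "x + q \<le> x + r" if "q \<le> r" for q r using that by (simp add: less_eq_vec_def)
  have fib: "fib (translate x V) q = fib V (x + q)" and tmap: "tmap (translate x V) q r = tmap V (x + q) (x + r)" for q r
    by (simp_all add: translate_def pullback_def)
  have TP: "translate x V \<in> Pers"
  proof (rule PersI, unfold fib tmap)
    show "fin_dim_subspace (fib V (x + q))" for q by (rule PersD(1)[OF P])
    show "linear_between (fib V (x + q)) (fib V (x + r)) (tmap V (x + q) (x + r))" if "q \<le> r" for q r
      by (rule PersD(4)[OF P mono[OF that]])
    show "tmap V (x + q) (x + q) v = v" if "v \<in> fib V (x + q)" for q v by (rule PersD(5)[OF P that])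
    show "tmap V (x + r) (x + s) (tmap V (x + q) (x + r) v) = tmap V (x + q) (x + s) v"
      if "q \<le> r" "r \<le> s" "v \<in> fib V (x + q)" for q r s v
      by (rule PersD(6)[OF P mono[OF that(1)] mono[OF that(2)] that(3)])
  qed
  define T' where "T' i = (\<lambda>t. t - x $ i) ` T i" for i
  have "finite_grid T'" using T(1) by (simp add: T'_def finite_grid_def)
  moreover have "tame T' (translate x V)"
    unfolding tame_def fib tmap
  proof (intro conjI allI impI)
    fix q r assume qr: "q \<le> r" "same_cell T' q r"
    have "same_cell T (x + q) (x + r)"
      using qr(2) by (auto simp: same_cell_def T'_def diff_le_eq add.commute)
    then show "bij_betw (tmap V (x + q) (x + r)) (fib V (x + q)) (fib V (x + r))"
      by (rule tame_bij[OF T(2) mono[OF qr(1)]])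
  next
    fix q assume "\<not> above_grid T' q"
    then have "\<not> above_grid T (x + q)" by (auto simp: above_grid_def T'_def diff_le_eq add.commute)
    then show "fib V (x + q) = {0}" by (rule tame_zero[OF T(2)])
  qed
  ultimately show ?thesis using TP by (auto simp: Pers_fp_iff_tame)
qed

section \<open>Central charges and energies of subobjects\<close>

lemma stability_condition_short_exact:
  assumes Z: "stability_condition Z" and ex: "short_exact U f V g W"
    and fp: "U \<in> Pers_fp" "V \<in> Pers_fp" "W \<in> Pers_fp"
  shows "Z (K_class V) = Z (K_class U) + Z (K_class W)"
proof -
  let ?S = "Pers_fp :: ('a, 'b) pmod set"
  define G where "G = free_Abelian_group ?S"
  define R where "R = {frag_of V - frag_of U - frag_of W | U V W.
        U \<in> ?S \<and> V \<in> ?S \<and> W \<in> ?S \<and> (\<exists>f g. short_exact U f V g W)}"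
  interpret G: comm_group G unfolding G_def by (rule abelian_free_Abelian_group)
  have R: "R \<subseteq> carrier G"
  proof
    fix x assume "x \<in> R"
    then obtain U V W where x: "x = frag_of V - frag_of U - frag_of W" "U \<in> ?S" "V \<in> ?S" "W \<in> ?S"
      by (auto simp: R_def)
    have "Poly_Mapping.keys x \<subseteq> {U, V, W}"
      unfolding x(1) using keys_diff[of "frag_of V - frag_of U" "frag_of W"] keys_diff[of "frag_of V" "frag_of U"]
      by auto
    then show "x \<in> carrier G" using x by (auto simp: G_def)
  qed
  have K: "K_relations = generate G R" unfolding K_relations_def G_def R_def ..
  have sub: "subgroup K_relations G" unfolding K by (rule G.generate_is_subgroup[OF R])
  then interpret N: normal K_relations G by (rule G.subgroup_imp_normal)
  have cl: "K_class X = K_relations #>\<^bsub>G\<^esub> frag_of X" for X by (simp add: K_class_def G_def)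
  have in': "frag_of X \<in> carrier G" if "X \<in> ?S" for X using that by (simp add: G_def)
  define d where "d = frag_of V - frag_of U - frag_of W"
  have "d \<in> R" unfolding R_def d_def using fp ex by blast
  then have dK: "d \<in> K_relations" unfolding K by (rule generate.incl)
  have dG: "d \<in> carrier G" using \<open>d \<in> R\<close> R by blast
  have UW: "frag_of U \<otimes>\<^bsub>G\<^esub> frag_of W \<in> carrier G" using in' fp by blast
  have "frag_of V = d \<otimes>\<^bsub>G\<^esub> (frag_of U \<otimes>\<^bsub>G\<^esub> frag_of W)" by (simp add: G_def d_def)
  then have "K_class V = (K_relations #>\<^bsub>G\<^esub> d) #>\<^bsub>G\<^esub> (frag_of U \<otimes>\<^bsub>G\<^esub> frag_of W)"
    unfolding cl using G.coset_mult_assoc[OF N.subset dG UW] by simp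
  also have "\<dots> = K_relations #>\<^bsub>G\<^esub> (frag_of U \<otimes>\<^bsub>G\<^esub> frag_of W)"
    using G.coset_join2[OF dG sub dK] by simp
  also have "\<dots> = K_class U <#>\<^bsub>G\<^esub> K_class W"
    unfolding cl using N.rcos_sum[OF in' in'] fp by simp
  finally have eq: "K_class V = K_class U \<otimes>\<^bsub>K_group\<^esub> K_class W"
    by (simp add: K_group_def G_def FactGroup_def)
  have "K_class X \<in> carrier K_group" if "X \<in> ?S" for X
    using in'[OF that] by (auto simp: K_group_def FactGroup_def RCOSETS_def cl G_def)
  then show ?thesis
    using Z fp unfolding eq stability_condition_def by (simp add: hom_def complex_add_group_def)
qed

definition energy :: "('q::order, 'k::field) stab \<Rightarrow> real \<Rightarrow> ('q, 'k) pmod \<Rightarrow> real" where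
  "energy Z \<theta> V = Im (Z (K_class V)) - \<theta> * Re (Z (K_class V))"

locale stability =
  fixes Z :: "('a::linorder ^ 'n::finite, 'k::field) stab"
  assumes stab: "stability_condition Z"
begin

abbreviation charge :: "('a ^ 'n, 'k) pmod \<Rightarrow> complex" where
  "charge V \<equiv> Z (K_class V)"

lemmas charge_short_exact = stability_condition_short_exact[OF stab]

lemma charge_pos: "V \<in> Pers_fp \<Longrightarrow> nonzero_pmod V \<Longrightarrow> Re (charge V) > 0"
  using stab by (simp add: stability_condition_def)

lemma charge_zero:
  assumes "V \<in> Pers_fp" "\<not> nonzero_pmod V"
  shows "charge V = 0"
proof -
  have "fib V q = {0}" for q using assms(2) by (auto simp: nonzero_pmod_def)
  then have "short_exact V (\<lambda>_ v. v) V (\<lambda>_ _. 0) V"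
    using PersD(8)[OF Pers_fp_imp_Pers[OF assms(1)]]
    by (auto simp: short_exact_def pers_hom_on_def linear_between_def)
  from charge_short_exact[OF this assms(1,1,1)] show ?thesis by simp
qed

lemma charge_zero_sub: "V \<in> Pers_fp \<Longrightarrow> charge (submod V (\<lambda>_. {0})) = 0"
  using fp_sub_zero[of V] by (intro charge_zero) (auto simp: fp_sub_def nonzero_pmod_def)

lemma Re_charge_nonneg: "V \<in> Pers_fp \<Longrightarrow> Re (charge V) \<ge> 0"
  using charge_pos[of V] charge_zero[of V] by (cases "nonzero_pmod V") auto

lemma charge_image:
  assumes V: "V \<in> Pers_fp" and W: "W \<in> Pers_fp" and h: "pers_hom V W h" and A: "fp_sub V A"
  shows "charge (submod V A) =
     charge (submod V (\<lambda>q. {v \<in> A q. h q v = 0})) + charge (submod W (\<lambda>q. h q ` A q))"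
proof (rule charge_short_exact)
  let ?K = "\<lambda>q. {v \<in> A q. h q v = 0}" and ?I = "\<lambda>q. h q ` A q"
  have K: "fp_sub V ?K" using fp_sub_preimage[OF V W h A fp_sub_zero[OF W]] by simp
  have I: "fp_sub W ?I" by (rule fp_sub_image[OF V W h A])
  show "submod V ?K \<in> Pers_fp" "submod W ?I \<in> Pers_fp" "submod V A \<in> Pers_fp"
    using fp_subD(1) K I A by blast+
  show "short_exact (submod V ?K) (\<lambda>_ v. v) (submod V A) h (submod W ?I)"
    unfolding short_exact_def
  proof (intro conjI allI)
    show "pers_hom (submod V ?K) (submod V A) (\<lambda>_ v. v)"
      by (auto simp: pers_hom_on_def linear_between_def)
    show "pers_hom (submod V A) (submod W ?I) h"
    proof (rule pers_homI)
      show "linear_between (fib (submod V A) q) (fib (submod W ?I) q) (h q)" for q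
        using linear_between_subset[OF pers_homD(1)[OF h] fp_sub_subset[OF A], of q "?I q"] by simp
      show "h r (tmap (submod V A) q r v) = tmap (submod W ?I) q r (h q v)"
        if "q \<le> r" "v \<in> fib (submod V A) q" for q r v
        using pers_homD(2)[OF h that(1)] fp_subD(5)[OF A] that(2) by simp
    qed
  qed auto
qed

text \<open>
  The difference of the two charges is the charge of the quotient, which has positive real part unless
  it vanishes.
\<close>

lemma charge_sub_mono:
  assumes V: "V \<in> Pers_fp" and A: "fp_sub V A" and B: "fp_sub V B" and le: "B \<le> A"
  shows "Re (charge (submod V B)) \<le> Re (charge (submod V A))"
    and "Re (charge (submod V B)) = Re (charge (submod V A)) \<Longrightarrow> A = B"
proof -
  have B': "fp_sub (submod V A) B" using fp_sub_submod[OF A] B le by simp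
  obtain C g where C: "C \<in> Pers_fp" and ex: "short_exact (submod V B) (\<lambda>_ v. v) (submod V A) g C"
    using quotient_exists[OF fp_subD(1)[OF A] B'] by auto
  have ch: "charge (submod V A) = charge (submod V B) + charge C"
    using charge_short_exact[OF ex fp_subD(1)[OF B] fp_subD(1)[OF A] C] .
  then show "Re (charge (submod V B)) \<le> Re (charge (submod V A))"
    using Re_charge_nonneg[OF C] by simp
  assume "Re (charge (submod V B)) = Re (charge (submod V A))"
  then have "\<not> nonzero_pmod C" using ch charge_pos[OF C] by auto
  then have "g q ` A q = {0}" for q using ex by (auto simp: short_exact_def nonzero_pmod_def)
  then have "{v \<in> A q. g q v = 0} = A q" for q by blast
  then have "A q = B q" for q using ex by (auto simp: short_exact_def)
  then show "A = B" by blast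
qed

text \<open>
  Both sides of the modular law differ by the charge of the same quotient: the projection of \<open>A + B\<close>
  along \<open>B\<close> maps \<open>A\<close> onto it with kernel \<open>A \<inter> B\<close>.
\<close>

lemma charge_modular:
  assumes V: "V \<in> Pers_fp" and A: "fp_sub V A" and B: "fp_sub V B"
  shows "charge (submod V (\<lambda>q. {x + y | x y. x \<in> A q \<and> y \<in> B q})) + charge (submod V (\<lambda>q. A q \<inter> B q))
     = charge (submod V A) + charge (submod V B)"
proof -
  let ?S = "\<lambda>q. {x + y | x y. x \<in> A q \<and> y \<in> B q}"
  have S: "fp_sub V ?S" by (rule fp_sub_sum[OF V A B])
  have AS: "A q \<subseteq> ?S q" and BS: "B q \<subseteq> ?S q" for q
    using fp_subD(4)[OF A, of q] fp_subD(4)[OF B, of q] by (force, force)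
  have A': "fp_sub (submod V ?S) A" and B': "fp_sub (submod V ?S) B"
    using fp_sub_submod[OF S] A B AS BS by (simp_all add: le_fun_def)
  obtain C g where C: "C \<in> Pers_fp" and ex: "short_exact (submod V B) (\<lambda>_ v. v) (submod V ?S) g C"
    using quotient_exists[OF fp_subD(1)[OF S] B'] by auto
  have g: "pers_hom (submod V ?S) C g" and ker: "\<And>q. B q = {v \<in> ?S q. g q v = 0}"
    and surj: "\<And>q. g q ` ?S q = fib C q"
    using ex by (auto simp: short_exact_def)
  have "g q ` A q = fib C q" for q
  proof -
    have "g q w \<in> g q ` A q" if "w \<in> ?S q" for w
    proof -
      obtain x y where xy: "x \<in> A q" "y \<in> B q" "w = x + y" using \<open>w \<in> ?S q\<close> by blast
      have "g q w = g q x + g q y"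
        using linear_between_add[OF pers_homD(1)[OF g, of q], of x y] subsetD[OF AS xy(1)] subsetD[OF BS xy(2)] xy(3)
        by simp
      moreover have "y \<in> {v \<in> ?S q. g q v = 0}" by (rule subsetD[OF equalityD1[OF ker] xy(2)])
      then have "g q y = 0" by simp
      ultimately show ?thesis using xy(1) by simp
    qed
    then have "g q ` ?S q \<subseteq> g q ` A q" by (rule image_subsetI)
    moreover have "g q ` A q \<subseteq> g q ` ?S q" by (rule image_mono[OF AS])
    ultimately show ?thesis using surj[of q] by (metis subset_antisym)
  qed
  then have im: "submod C (\<lambda>q. g q ` A q) = C" by (simp add: submod_def)
  have "{v \<in> A q. g q v = 0} = A q \<inter> B q" for q
  proof -
    have "v \<in> B q \<longleftrightarrow> v \<in> ?S q \<and> g q v = 0" for v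
      using equalityD1[OF ker[of q]] equalityD2[OF ker[of q]] by blast
    then show ?thesis using AS[of q] by blast
  qed
  then have "charge (submod V A) = charge (submod V (\<lambda>q. A q \<inter> B q)) + charge C"
    using charge_image[OF fp_subD(1)[OF S] C g A'] im by simp
  moreover have "charge (submod V ?S) = charge (submod V B) + charge C"
    using charge_short_exact[OF ex fp_subD(1)[OF B] fp_subD(1)[OF S] C] .
  ultimately show ?thesis by simp
qed

lemma energy_image:
  assumes "V \<in> Pers_fp" "W \<in> Pers_fp" "pers_hom V W h" "fp_sub V A"
  shows "energy Z \<theta> (submod V A) =
     energy Z \<theta> (submod V (\<lambda>q. {v \<in> A q. h q v = 0})) + energy Z \<theta> (submod W (\<lambda>q. h q ` A q))"
  using charge_image[OF assms] by (simp add: energy_def algebra_simps)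

lemma energy_modular:
  assumes "V \<in> Pers_fp" "fp_sub V A" "fp_sub V B"
  shows "energy Z \<theta> (submod V (\<lambda>q. {x + y | x y. x \<in> A q \<and> y \<in> B q})) + energy Z \<theta> (submod V (\<lambda>q. A q \<inter> B q))
     = energy Z \<theta> (submod V A) + energy Z \<theta> (submod V B)"
proof -
  have "c - \<theta> * a + (d - \<theta> * b) = c' - \<theta> * a' + (d' - \<theta> * b')"
    if "a + b = a' + b'" "c + d = c' + d'" for a b c d a' b' c' d' :: real
  proof -
    have "\<theta> * (a + b) = \<theta> * (a' + b')" using that by simp
    then show ?thesis using that unfolding distrib_left by linarith
  qed
  from this[OF arg_cong[OF charge_modular[OF assms], of Re, simplified]
      arg_cong[OF charge_modular[OF assms], of Im, simplified]]
  show ?thesis unfolding energy_def .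
qed

lemma energy_zero_sub: "V \<in> Pers_fp \<Longrightarrow> energy Z \<theta> (submod V (\<lambda>_. {0})) = 0"
  by (simp add: energy_def charge_zero_sub)

lemma energy_slope: "V \<in> Pers_fp \<Longrightarrow> nonzero_pmod V \<Longrightarrow> energy Z \<theta> V = (slope Z V - \<theta>) * Re (charge V)"
  using charge_pos[of V] by (simp add: energy_def slope_def field_simps)

section \<open>Largest maximisers of the energy\<close>

text \<open>
  The subobject \<open>\<langle>V, Z\<rangle>\<^sup>\<theta>\<close> is the largest among the subobjects of maximal energy. This
  description does not refer to filtrations, and it is what makes the construction functorial.
\<close>

definition largest_max :: "real \<Rightarrow> ('a ^ 'n, 'k) pmod \<Rightarrow> ('a ^ 'n \<Rightarrow> 'k poly set) \<Rightarrow> bool" where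
  "largest_max \<theta> V S \<longleftrightarrow> fp_sub V S \<and>
     (\<forall>A. fp_sub V A \<longrightarrow> energy Z \<theta> (submod V A) \<le> energy Z \<theta> (submod V S) \<and>
        (energy Z \<theta> (submod V A) = energy Z \<theta> (submod V S) \<longrightarrow> A \<le> S))"

lemma largest_max_unique: "largest_max \<theta> V S \<Longrightarrow> largest_max \<theta> V S' \<Longrightarrow> S = S'"
  unfolding largest_max_def by (meson order_antisym)

text \<open>
  Let \<open>A\<close> be the source maximiser, \<open>B\<close> its image, and \<open>S\<close> the target maximiser. The part of \<open>A\<close> mapped
  into \<open>S\<close> has at most the energy of \<open>A\<close>, and both have the same kernel, so \<open>B \<inter> S\<close> has at most the
  energy of \<open>B\<close>. By modularity \<open>B + S\<close> is a maximiser.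
\<close>

lemma largest_max_hom:
  assumes V: "V \<in> Pers_fp" and W: "W \<in> Pers_fp" and h: "pers_hom V W h"
    and A: "largest_max \<theta> V A" and S: "largest_max \<theta> W S"
  shows "h q ` A q \<subseteq> S q"
proof -
  have fA: "fp_sub V A" and fS: "fp_sub W S" using A S by (auto simp: largest_max_def)
  define B where "B q = h q ` A q" for q
  define A' where "A' q = {v \<in> A q. h q v \<in> S q}" for q
  have fB: "fp_sub W B" unfolding B_def by (rule fp_sub_image[OF V W h fA])
  have fA': "fp_sub V A'" unfolding A'_def by (rule fp_sub_preimage[OF V W h fA fS])
  have "energy Z \<theta> (submod V A') \<le> energy Z \<theta> (submod V A)" using A fA' by (simp add: largest_max_def)
  moreover have "(\<lambda>q. {v \<in> A' q. h q v = 0}) = (\<lambda>q. {v \<in> A q. h q v = 0})"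
    using fp_subD(4)[OF fS] by (auto simp: A'_def)
  moreover have "(\<lambda>q. h q ` A' q) = (\<lambda>q. B q \<inter> S q)" by (auto simp: A'_def B_def)
  ultimately have "energy Z \<theta> (submod W (\<lambda>q. B q \<inter> S q)) \<le> energy Z \<theta> (submod W B)"
    using energy_image[OF V W h fA, of \<theta>] energy_image[OF V W h fA', of \<theta>] by (simp add: B_def[abs_def])
  moreover let ?T = "\<lambda>q. {x + y | x y. x \<in> B q \<and> y \<in> S q}"
  have fT: "fp_sub W ?T" by (rule fp_sub_sum[OF W fB fS])
  ultimately have "energy Z \<theta> (submod W S) \<le> energy Z \<theta> (submod W ?T)"
    using energy_modular[OF W fB fS, of \<theta>] by simp
  then have "?T \<le> S" using S fT unfolding largest_max_def by (meson order_antisym)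
  then have "?T q \<subseteq> S q" by (simp add: le_fun_def)
  moreover have "B q \<subseteq> ?T q" using fp_subD(4)[OF fS, of q] by force
  ultimately show ?thesis by (auto simp: B_def)
qed

section \<open>Harder-Narasimhan filtrations and maximisers\<close>

lemma HN_slope_antimono:
  assumes "HN_filtration Z V l F C" "0 < j" "j \<le> k" "k \<le> l"
  shows "slope Z (C k) \<le> slope Z (C j)"
  using assms(3,4)
proof (induction k rule: dec_induct)
  case base
  then show ?case by simp
next
  case (step m)
  then have "slope Z (C (Suc m)) < slope Z (C m)" using assms(1,2) by (auto simp: HN_filtration_def)
  then show ?case using step by simp
qed

text \<open>
  Intersect a subobject \<open>A\<close> with the filtration. The graded piece of \<open>A\<close> at step \<open>Suc j\<close> embeds into
  the semistable module \<open>C (Suc j)\<close>. Below the cut it has at most the energy of \<open>C (Suc j)\<close>, above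
  the cut it has negative energy unless it vanishes.
\<close>

lemma HN_piece:
  fixes \<theta> :: real
  assumes V: "V \<in> Pers_fp" and HN: "HN_filtration Z V l F C" and A: "fp_sub V A" and j: "j < l"
  defines "e \<equiv> \<lambda>j. energy Z \<theta> (submod V (\<lambda>q. A q \<inter> F j q))" and "f \<equiv> \<lambda>j. energy Z \<theta> (submod V (F j))"
  shows "\<theta> \<le> slope Z (C (Suc j)) \<Longrightarrow> e (Suc j) - e j \<le> f (Suc j) - f j"
    and "slope Z (C (Suc j)) < \<theta> \<Longrightarrow> e (Suc j) \<le> e j"
    and "slope Z (C (Suc j)) < \<theta> \<Longrightarrow> e (Suc j) = e j \<Longrightarrow> A q \<inter> F (Suc j) q = A q \<inter> F j q"
proof -
  define C' where "C' = C (Suc j)"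
  have HNj: "submod V (F i) \<in> Pers_fp" if "i \<le> l" for i using HN that by (auto simp: HN_filtration_def)
  have lt: "F j < F (Suc j)" and ss: "semistable Z C'" using HN j by (auto simp: HN_filtration_def C'_def)
  obtain g where ex: "short_exact (submod V (F j)) (\<lambda>_ v. v) (submod V (F (Suc j))) g C'"
    using HN j by (auto simp: HN_filtration_def C'_def)
  have Fle: "F (Suc i) \<le> F k" if "Suc i \<le> k" "k \<le> l" for i k
    using that
  proof (induction k rule: dec_induct)
    case (step m)
    then have "F m < F (Suc m)" using HN by (auto simp: HN_filtration_def)
    then show ?case using step by auto
  qed simp
  have FV: "F (Suc j) \<le> fib V" using Fle[of j l] j HN by (auto simp: HN_filtration_def)
  have F0: "fp_sub V (F j)" "fp_sub V (F (Suc j))"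
    using FV lt HNj[of j] HNj[of "Suc j"] j by (auto simp: fp_sub_def)
  define D where "D q = A q \<inter> F (Suc j) q" for q
  have fD: "fp_sub V D" unfolding D_def by (rule fp_sub_Int[OF V A F0(2)])
  have D: "fp_sub (submod V (F (Suc j))) D"
    using fD fp_sub_submod[OF F0(2)] by (simp add: D_def le_fun_def)
  have C': "C' \<in> Pers_fp" "nonzero_pmod C'" using ss by (auto simp: semistable_def)
  have g: "pers_hom (submod V (F (Suc j))) C' g" and ker: "\<And>q. F j q = {v \<in> F (Suc j) q. g q v = 0}"
    using ex by (auto simp: short_exact_def)
  define I where "I q = g q ` D q" for q
  have fI: "fp_sub C' I"
    unfolding I_def by (rule fp_sub_image[OF fp_subD(1)[OF F0(2)] C'(1) g D])
  have kerD: "(\<lambda>q. {v \<in> D q. g q v = 0}) = (\<lambda>q. A q \<inter> F j q)"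
  proof
    fix q
    show "{v \<in> D q. g q v = 0} = A q \<inter> F j q" using ker[of q] by (auto simp: D_def)
  qed
  have e: "e (Suc j) = e j + energy Z \<theta> (submod C' I)"
    using energy_image[OF fp_subD(1)[OF F0(2)] C'(1) g D, of \<theta>] kerD
    by (simp add: e_def D_def[abs_def] I_def[abs_def])
  have f: "f (Suc j) = f j + energy Z \<theta> C'"
    using charge_short_exact[OF ex fp_subD(1)[OF F0(1)] fp_subD(1)[OF F0(2)] C'(1)]
    by (simp add: f_def energy_def algebra_simps)
  have I_le: "I \<le> fib C'" and I_fp: "submod C' I \<in> Pers_fp" using fI by (auto simp: fp_sub_def)
  have ReI: "0 \<le> Re (charge (submod C' I))" "Re (charge (submod C' I)) \<le> Re (charge C')"
    using Re_charge_nonneg[OF I_fp] charge_sub_mono(1)[OF C'(1) fp_sub_fib[OF C'(1)] fI I_le] by auto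
  have EI: "energy Z \<theta> (submod C' I) \<le> (slope Z C' - \<theta>) * Re (charge (submod C' I))"
  proof (cases "nonzero_pmod (submod C' I)")
    case True
    then have "slope Z (submod C' I) \<le> slope Z C'" using ss I_le I_fp by (auto simp: semistable_def)
    then show ?thesis using energy_slope[OF I_fp True, of \<theta>] ReI by (simp add: mult_right_mono)
  next
    case False
    then show ?thesis using charge_zero[OF I_fp] by (simp add: energy_def)
  qed
  show "e (Suc j) - e j \<le> f (Suc j) - f j" if "\<theta> \<le> slope Z (C (Suc j))"
  proof -
    have "(slope Z C' - \<theta>) * Re (charge (submod C' I)) \<le> (slope Z C' - \<theta>) * Re (charge C')"
      using that ReI by (intro mult_left_mono) (auto simp: C'_def)
    then show ?thesis using e f EI energy_slope[OF C', of \<theta>] by simp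
  qed
  show "e (Suc j) \<le> e j" if "slope Z (C (Suc j)) < \<theta>"
  proof -
    have "(slope Z C' - \<theta>) * Re (charge (submod C' I)) \<le> 0"
      using that ReI by (intro mult_nonpos_nonneg) (auto simp: C'_def)
    then show ?thesis using e EI by simp
  qed
  show "A q \<inter> F (Suc j) q = A q \<inter> F j q" if "slope Z (C (Suc j)) < \<theta>" "e (Suc j) = e j"
  proof -
    have "0 \<le> (slope Z C' - \<theta>) * Re (charge (submod C' I))" using e EI that by simp
    then have "Re (charge (submod C' I)) \<le> 0" using that by (auto simp: C'_def zero_le_mult_iff)
    then have "\<not> nonzero_pmod (submod C' I)" using charge_pos[OF I_fp] by auto
    then have "g q ` D q = {0}" by (simp add: nonzero_pmod_def I_def)
    then have "{v \<in> D q. g q v = 0} = D q" by blast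
    then show ?thesis using fun_cong[OF kerD, of q] by (simp add: D_def)
  qed
qed

lemma HN_cut_largest_max:
  assumes V: "V \<in> Pers_fp" and HN: "HN_filtration Z V l F C" and i: "i \<le> l"
    and above: "i = 0 \<or> slope Z (C i) \<ge> \<theta>" and below: "i = l \<or> \<theta> > slope Z (C (Suc i))"
  shows "largest_max \<theta> V (F i)"
  unfolding largest_max_def
proof (intro conjI allI impI)
  have Fle: "F j \<le> F k" if "j \<le> k" "k \<le> l" for j k
    using that
  proof (induction k rule: dec_induct)
    case (step m)
    then have "F m < F (Suc m)" using HN by (auto simp: HN_filtration_def)
    then show ?case using step by auto
  qed simp
  show Fi: "fp_sub V (F i)" using HN i Fle[of i l] by (auto simp: HN_filtration_def fp_sub_def)
  fix A assume A: "fp_sub V A"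
  define e where "e j = energy Z \<theta> (submod V (\<lambda>q. A q \<inter> F j q))" for j
  define f where "f j = energy Z \<theta> (submod V (F j))" for j
  note piece = HN_piece[OF V HN A, where \<theta> = \<theta>, folded e_def f_def]
  have "A q \<inter> F 0 q = {0}" for q using fp_subD(4)[OF A, of q] HN by (auto simp: HN_filtration_def)
  then have e0: "e 0 = f 0" using HN by (simp add: e_def f_def HN_filtration_def)
  have "A q \<inter> F l q = A q" for q using fp_sub_subset[OF A, of q] HN by (auto simp: HN_filtration_def)
  then have el: "e l = energy Z \<theta> (submod V A)" by (simp add: e_def)
  have lo: "\<theta> \<le> slope Z (C (Suc j))" if "j < i" for j
    using above HN_slope_antimono[OF HN, of "Suc j" i] that i by auto
  have hi: "slope Z (C (Suc j)) < \<theta>" if "i \<le> j" "j < l" for j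
    using below HN_slope_antimono[OF HN, of "Suc i" "Suc j"] that i by auto
  have "e j \<le> f j" if "j \<le> i" for j
    using that
  proof (induction j)
    case (Suc j)
    then show ?case using piece(1)[of j] lo[of j] i by simp
  qed (simp add: e0)
  then have ei: "e i \<le> f i" by simp
  have up: "e k \<le> e i \<and> (e k = e i \<longrightarrow> (\<forall>q. A q \<inter> F k q = A q \<inter> F i q))" if "i \<le> k" "k \<le> l" for k
    using that
  proof (induction k rule: dec_induct)
    case (step m)
    have "e (Suc m) \<le> e m" using piece(2)[of m] hi[of m] step by simp
    moreover have "A q \<inter> F (Suc m) q = A q \<inter> F m q" if "e (Suc m) = e m" for q
      using piece(3)[of m] hi[of m] step that by simp
    ultimately show ?case using step by force
  qed simp
  show "energy Z \<theta> (submod V A) \<le> energy Z \<theta> (submod V (F i))"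
    using ei up[OF i order_refl] el by (simp add: f_def)
  show "A \<le> F i" if "energy Z \<theta> (submod V A) = energy Z \<theta> (submod V (F i))"
  proof -
    have "e l = e i" using that ei up[OF i order_refl] el by (simp add: f_def)
    then have "A q \<inter> F l q = A q \<inter> F i q" for q using up[OF i order_refl] by blast
    then show ?thesis using \<open>\<And>q. A q \<inter> F l q = A q\<close> by (force simp: le_fun_def)
  qed
qed

lemma HN_cut_exists:
  assumes HN: "HN_filtration Z V l F C"
  shows "\<exists>i\<le>l. (i = 0 \<or> slope Z (C i) \<ge> \<theta>) \<and> (i = l \<or> \<theta> > slope Z (C (Suc i)))"
proof -
  let ?P = "\<lambda>i. i \<le> l \<and> (i = 0 \<or> slope Z (C i) \<ge> \<theta>)"
  have "?P 0" by simp
  then have "?P (GREATEST i. ?P i)" by (rule GreatestI_nat[where b = l]) simp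
  moreover define i where "i = (GREATEST i. ?P i)"
  ultimately have i: "?P i" by simp
  have "\<theta> > slope Z (C (Suc i))" if "i \<noteq> l"
  proof (rule ccontr)
    assume "\<not> \<theta> > slope Z (C (Suc i))"
    then have "?P (Suc i)" using i that by auto
    then have "Suc i \<le> i" unfolding i_def by (rule Greatest_le_nat[where b = l]) simp
    then show False by simp
  qed
  then show ?thesis using i by blast
qed

text \<open>
  Since largest maximisers are unique, all cuts of all filtrations at \<open>\<theta>\<close> coincide, and the definite
  description in \<^const>\<open>HN_sub\<close> denotes one of them.
\<close>

lemma HN_sub_largest_max:
  assumes V: "V \<in> Pers_fp" and ex: "nonzero_pmod V \<Longrightarrow> \<exists>l F C. HN_filtration Z V l F C"
  shows "largest_max \<theta> V (HN_sub Z V \<theta>)"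
proof (cases "nonzero_pmod V")
  case True
  let ?Q = "\<lambda>S. \<exists>l F C i. HN_filtration Z V l F C \<and> i \<le> l \<and> S = F i \<and>
              (i = 0 \<or> slope Z (C i) \<ge> \<theta>) \<and> (i = l \<or> \<theta> > slope Z (C (Suc i)))"
  obtain l F C where HN: "HN_filtration Z V l F C" using ex[OF True] by blast
  obtain i where "i \<le> l" "i = 0 \<or> slope Z (C i) \<ge> \<theta>" "i = l \<or> \<theta> > slope Z (C (Suc i))"
    using HN_cut_exists[OF HN] by blast
  then have Q: "?Q (F i)" using HN by blast
  have lm: "largest_max \<theta> V S" if "?Q S" for S
  proof -
    obtain l F C i where "HN_filtration Z V l F C" "i \<le> l" "S = F i"
      "i = 0 \<or> slope Z (C i) \<ge> \<theta>" "i = l \<or> \<theta> > slope Z (C (Suc i))"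
      using \<open>?Q S\<close> by (elim exE conjE) (rule that)
    then show ?thesis using HN_cut_largest_max[OF V] by simp
  qed
  have "?Q (THE S. ?Q S)"
  proof (rule theI[of ?Q, OF Q])
    show "S = F i" if "?Q S" for S by (rule largest_max_unique[OF lm[OF that] lm[OF Q]])
  qed
  then show ?thesis using lm True unfolding HN_sub_def by simp
next
  case False
  then have z: "fib V q = {0}" for q by (simp add: nonzero_pmod_def)
  have "A = (\<lambda>_. {0})" if "fp_sub V A" for A
    using fp_subD(4)[OF that] fp_sub_subset[OF that] z by (intro ext) blast
  then have "largest_max \<theta> V (\<lambda>_. {0})"
    using fp_sub_zero[OF V] unfolding largest_max_def by (metis order_refl)
  then show ?thesis using False by (simp add: HN_sub_def)
qed

end

section \<open>Existence of Harder-Narasimhan filtrations\<close>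

lemma small_perturbation:
  fixes r f :: "'b \<Rightarrow> real"
  assumes "finite X" "\<And>x. x \<in> X \<Longrightarrow> f x > 0"
  obtains \<epsilon> where "\<epsilon> > 0" "\<And>x. x \<in> X \<Longrightarrow> \<epsilon> * r x < f x"
proof -
  have "\<forall>\<^sub>F \<epsilon> in at_right 0. \<epsilon> * r x < f x" if "x \<in> X" for x
  proof (rule order_tendstoD(2)[OF _ assms(2)[OF that]])
    have "((\<lambda>\<epsilon>. \<epsilon> * r x) \<longlongrightarrow> 0 * r x) (at_right 0)" by (intro tendsto_intros)
    then show "((\<lambda>\<epsilon>. \<epsilon> * r x) \<longlongrightarrow> 0) (at_right 0)" by simp
  qed
  then have "\<forall>\<^sub>F \<epsilon> in at_right 0. \<forall>x\<in>X. \<epsilon> * r x < f x"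
    using assms(1) by (simp add: eventually_ball_finite)
  moreover have "\<forall>\<^sub>F \<epsilon> in at_right (0::real). \<epsilon> > 0" by (simp add: eventually_at_right_less)
  ultimately have "\<forall>\<^sub>F \<epsilon> in at_right (0::real). \<epsilon> > 0 \<and> (\<forall>x\<in>X. \<epsilon> * r x < f x)"
    by eventually_elim auto
  then obtain \<epsilon> where "\<epsilon> > 0 \<and> (\<forall>x\<in>X. \<epsilon> * r x < f x)"
    using eventually_happens'[OF trivial_limit_at_right_real] by blast
  then show ?thesis using that by blast
qed

text \<open>
  Finitely presented modules need not satisfy a chain condition. All that the existence of filtrations of
  \<open>V\<close> needs is a family \<open>L\<close> of subobjects with finitely many charges in which every
  energy is maximised.
\<close>

locale dominated = stability Z
  for Z :: "('a::linorder ^ 'n::finite, 'k::field) stab" +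
  fixes V :: "('a ^ 'n, 'k) pmod" and L :: "('a ^ 'n \<Rightarrow> 'k poly set) set"
  assumes V: "V \<in> Pers_fp"
    and L_sub: "S \<in> L \<Longrightarrow> fp_sub V S"
    and zero_L: "(\<lambda>_. {0}) \<in> L" and fib_L: "fib V \<in> L"
    and finite_charges: "finite ((\<lambda>S. charge (submod V S)) ` L)"
    and dominated: "fp_sub V A \<Longrightarrow> \<exists>S\<in>L. energy Z \<theta> (submod V A) \<le> energy Z \<theta> (submod V S)"
begin

abbreviation E :: "real \<Rightarrow> ('a ^ 'n \<Rightarrow> 'k poly set) \<Rightarrow> real" where
  "E \<theta> S \<equiv> energy Z \<theta> (submod V S)"

abbreviation R :: "('a ^ 'n \<Rightarrow> 'k poly set) \<Rightarrow> real" where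
  "R S \<equiv> Re (charge (submod V S))"

lemma E_shift: "E (\<theta> - \<epsilon>) S = E \<theta> S + \<epsilon> * R S"
  by (simp add: energy_def algebra_simps)

lemma R_nonneg: "fp_sub V S \<Longrightarrow> 0 \<le> R S"
  using Re_charge_nonneg fp_subD(1) by blast

lemma finite_image_charge:
  assumes "M \<subseteq> L" shows "finite ((\<lambda>S. \<phi> (charge (submod V S))) ` M)"
proof -
  have "(\<lambda>S. \<phi> (charge (submod V S))) ` M \<subseteq> \<phi> ` (\<lambda>S. charge (submod V S)) ` L"
    using assms by auto
  then show ?thesis using finite_charges finite_subset by blast
qed

text \<open>
  Among the maximisers in \<open>L\<close> take one, \<open>M\<close>, with largest real part of the charge. If a maximiser
  \<open>A\<close> were not below \<open>M\<close>, then \<open>A + M\<close> would be a maximiser with larger real part, hence of larger energy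
  than every member of \<open>L\<close> after lowering \<open>\<theta>\<close> slightly, contradicting domination there.
\<close>

lemma largest_max_exists: "\<exists>M\<in>L. largest_max \<theta> V M"
proof -
  have finE: "finite (E \<theta> ` L)" using finite_image_charge[of L "\<lambda>c. Im c - \<theta> * Re c"] by (simp add: energy_def)
  define e where "e = Max (E \<theta> ` L)"
  have e_ge: "E \<theta> S \<le> e" if "S \<in> L" for S using that finE by (simp add: e_def)
  define M0 where "M0 = {S \<in> L. E \<theta> S = e}"
  have "e \<in> E \<theta> ` L" unfolding e_def using finE zero_L by (intro Max_in) auto
  then have M0: "M0 \<noteq> {}" by (auto simp: M0_def)
  have finR: "finite (R ` M0)" by (rule finite_image_charge) (auto simp: M0_def)
  have "Max (R ` M0) \<in> R ` M0" using finR M0 by (intro Max_in) auto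
  then obtain M where "Max (R ` M0) = R M" "M \<in> M0" by (rule imageE)
  then have M: "M \<in> M0" "R M = Max (R ` M0)" by simp_all
  have M_max: "R S \<le> R M" if "S \<in> M0" for S unfolding M(2) using finR that by simp
  have M_in: "M \<in> L" "E \<theta> M = e" and fM: "fp_sub V M" using M(1) L_sub by (auto simp: M0_def)
  have le: "E \<theta> A \<le> e" if "fp_sub V A" for A using dominated[OF that, of \<theta>] e_ge by fastforce
  have "A \<le> M" if A: "fp_sub V A" "E \<theta> A = e" for A
  proof (rule ccontr)
    assume "\<not> A \<le> M"
    define B where "B q = {x + y | x y. x \<in> A q \<and> y \<in> M q}" for q
    have fB: "fp_sub V B" unfolding B_def by (rule fp_sub_sum[OF V A(1) fM])
    have AB: "A \<le> B" and MB: "M \<le> B"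
      using fp_subD(4)[OF fM] fp_subD(4)[OF A(1)] by (force simp: B_def le_fun_def)+
    have "E \<theta> B + E \<theta> (\<lambda>q. A q \<inter> M q) = 2 * e"
      using energy_modular[OF V A(1) fM, of \<theta>] A(2) M_in(2) by (simp add: B_def[abs_def])
    then have EB: "E \<theta> B = e" using le[OF fB] le[OF fp_sub_Int[OF V A(1) fM]] by simp
    have "B \<noteq> M" using AB \<open>\<not> A \<le> M\<close> by auto
    then have RB: "R M < R B" using charge_sub_mono[OF V fB fM MB] by fastforce
    let ?X = "(\<lambda>S. charge (submod V S)) ` (L - M0)"
    have "finite ?X" using finite_image_charge[of "L - M0" id] by simp
    moreover have "0 < e - (Im c - \<theta> * Re c)" if "c \<in> ?X" for c
    proof -
      obtain S where "S \<in> L" "E \<theta> S \<noteq> e" "c = charge (submod V S)" using \<open>c \<in> ?X\<close> by (auto simp: M0_def)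
      then show ?thesis using e_ge[of S] by (simp add: energy_def)
    qed
    ultimately obtain \<epsilon> where \<epsilon>: "\<epsilon> > 0" "\<And>c. c \<in> ?X \<Longrightarrow> \<epsilon> * Re c < e - (Im c - \<theta> * Re c)"
      using small_perturbation[of ?X "\<lambda>c. e - (Im c - \<theta> * Re c)" Re] by metis
    have "E (\<theta> - \<epsilon>) S < E (\<theta> - \<epsilon>) B" if "S \<in> L" for S
    proof (cases "S \<in> M0")
      case True
      then have "\<epsilon> * R S < \<epsilon> * R B" using M_max[OF True] RB \<epsilon>(1) by simp
      then show ?thesis using True EB unfolding E_shift M0_def by simp
    next
      case False
      then have "\<epsilon> * R S < e - E \<theta> S" using \<epsilon>(2)[of "charge (submod V S)"] that by (simp add: energy_def)
      moreover have "0 \<le> \<epsilon> * R B" using \<epsilon>(1) R_nonneg[OF fB] by simp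
      ultimately show ?thesis using EB unfolding E_shift by simp
    qed
    then show False using dominated[OF fB, of "\<theta> - \<epsilon>"] by force
  qed
  then have "largest_max \<theta> V M" using le M_in fM by (auto simp: largest_max_def)
  then show ?thesis using M_in by blast
qed

text \<open>
  From a largest maximiser \<open>S\<close> for \<open>\<theta>\<^sub>0\<close>, lower the parameter until \<open>S\<close> ties with a larger member of \<open>L\<close>:
  this happens at the largest slope \<open>\<theta>\<^sub>1\<close> of \<open>S' / S\<close> for \<open>S'\<close> in \<open>L\<close>.
\<close>

lemma next_maximiser:
  assumes S: "S \<in> L" "largest_max \<theta>0 V S" and ne: "S \<noteq> fib V"
  obtains S' \<theta>1 where "S' \<in> L" "largest_max \<theta>1 V S'" "\<theta>1 < \<theta>0" "S < S'" "E \<theta>1 S = E \<theta>1 S'"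
proof -
  have fS: "fp_sub V S" using L_sub S by blast
  define M where "M = {A \<in> L. R S < R A}"
  define \<sigma> where "\<sigma> c = (Im c - Im (charge (submod V S))) / (Re c - R S)" for c
  have "S \<le> fib V" using fS by (simp add: fp_sub_def)
  then have "R S < R (fib V)"
    using charge_sub_mono[OF V fp_sub_fib[OF V] fS] ne by fastforce
  then have "fib V \<in> M" using fib_L by (simp add: M_def)
  then have M: "M \<noteq> {}" by blast
  have fin: "finite ((\<lambda>A. \<sigma> (charge (submod V A))) ` M)" by (rule finite_image_charge) (auto simp: M_def)
  define \<theta>1 where "\<theta>1 = Max ((\<lambda>A. \<sigma> (charge (submod V A))) ` M)"
  have E\<sigma>: "E \<theta> A - E \<theta> S = (\<sigma> (charge (submod V A)) - \<theta>) * (R A - R S)" if "A \<in> M" for A \<theta>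
  proof -
    have "R A - R S \<noteq> 0" using that by (auto simp: M_def)
    then have "\<sigma> (charge (submod V A)) * (R A - R S) = Im (charge (submod V A)) - Im (charge (submod V S))"
      by (simp add: \<sigma>_def)
    then show ?thesis by (simp add: energy_def algebra_simps)
  qed
  have \<sigma>_le: "\<sigma> (charge (submod V A)) \<le> \<theta>1" if "A \<in> M" for A unfolding \<theta>1_def using fin that by simp
  have "\<theta>1 \<in> (\<lambda>A. \<sigma> (charge (submod V A))) ` M" unfolding \<theta>1_def using fin M by (intro Max_in) auto
  then obtain A where A: "A \<in> M" "\<theta>1 = \<sigma> (charge (submod V A))" by auto
  have fA: "fp_sub V A" and RA: "R S < R A" using A L_sub by (auto simp: M_def)
  have "E \<theta>0 A < E \<theta>0 S"
  proof -
    have "\<not> A \<le> S" using charge_sub_mono(1)[OF V fS fA] RA by auto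
    then show ?thesis using S(2) fA unfolding largest_max_def by (meson order_le_less)
  qed
  then have "(\<theta>1 - \<theta>0) * (R A - R S) < 0" using E\<sigma>[OF A(1), of \<theta>0] A(2) by simp
  then have lt: "\<theta>1 < \<theta>0" using RA by (simp add: mult_less_0_iff)
  have EA: "E \<theta>1 A = E \<theta>1 S" using E\<sigma>[OF A(1), of \<theta>1] A(2) by simp
  have LS: "E \<theta>1 B \<le> E \<theta>1 S" if "B \<in> L" for B
  proof (cases "B \<in> M")
    case True
    have "(\<sigma> (charge (submod V B)) - \<theta>1) * (R B - R S) \<le> 0"
      using \<sigma>_le[OF True] True by (intro mult_nonpos_nonneg) (auto simp: M_def)
    then show ?thesis using E\<sigma>[OF True, of \<theta>1] by simp
  next
    case False
    then have "(\<theta>0 - \<theta>1) * R B \<le> (\<theta>0 - \<theta>1) * R S" using lt that by (intro mult_left_mono) (auto simp: M_def)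
    moreover have "E \<theta>0 B \<le> E \<theta>0 S" using S(2) L_sub[OF that] by (simp add: largest_max_def)
    ultimately show ?thesis using E_shift[of \<theta>0 "\<theta>0 - \<theta>1"] by simp
  qed
  obtain S' where S': "S' \<in> L" "largest_max \<theta>1 V S'" using largest_max_exists by blast
  have max: "E \<theta>1 B \<le> E \<theta>1 S'" "E \<theta>1 B = E \<theta>1 S' \<Longrightarrow> B \<le> S'" if "fp_sub V B" for B
    using S'(2) that by (auto simp: largest_max_def)
  have eq: "E \<theta>1 S = E \<theta>1 S'" using LS[OF S'(1)] max(1)[OF fS] by simp
  have "S \<le> S'" "A \<le> S'" using max(2)[OF fS] max(2)[OF fA] eq EA by auto
  moreover have "S \<noteq> S'"
    using \<open>A \<le> S'\<close> charge_sub_mono(1)[OF V fS fA] RA by auto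
  ultimately show ?thesis using that S' lt eq by (simp add: order_less_le)
qed

text \<open>
  A subobject of the quotient pulls back to one between \<open>S\<close> and \<open>S'\<close>. Its energy cannot exceed the common
  maximum attained at \<open>S\<close> and \<open>S'\<close>, so the subobject has nonpositive energy, that is, slope at most \<open>\<theta>\<close>.
\<close>

lemma quotient_semistable:
  assumes fS: "fp_sub V S" and S': "largest_max \<theta> V S'" and lt: "S < S'" and eq: "E \<theta> S = E \<theta> S'"
    and C: "C \<in> Pers_fp" and ex: "short_exact (submod V S) (\<lambda>_ v. v) (submod V S') g C"
  shows "semistable Z C" "slope Z C = \<theta>"
proof -
  have fS': "fp_sub V S'" using S' by (simp add: largest_max_def)
  have ch: "charge (submod V S') = charge (submod V S) + charge C"
    using charge_short_exact[OF ex fp_subD(1)[OF fS] fp_subD(1)[OF fS'] C] .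
  have "R S \<noteq> R S'" using charge_sub_mono(2)[OF V fS' fS order_less_imp_le[OF lt]] lt by auto
  then have nz: "nonzero_pmod C" using ch charge_zero[OF C] by fastforce
  have "energy Z \<theta> C = 0" using ch eq by (simp add: energy_def algebra_simps)
  then show slope: "slope Z C = \<theta>" using energy_slope[OF C nz, of \<theta>] charge_pos[OF C nz] by simp
  have g: "pers_hom (submod V S') C g" and ker: "\<And>q. S q = {v \<in> S' q. g q v = 0}"
    and surj: "\<And>q. g q ` S' q = fib C q"
    using ex by (auto simp: short_exact_def)
  show "semistable Z C"
    unfolding semistable_def
  proof (intro conjI allI impI)
    fix D assume D: "D \<le> fib C" "submod C D \<in> Pers_fp" "nonzero_pmod (submod C D)"
    define A where "A q = {v \<in> S' q. g q v \<in> D q}" for q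
    have fD: "fp_sub C D" using D by (simp add: fp_sub_def)
    have A: "fp_sub (submod V S') A"
      unfolding A_def using fp_sub_preimage[OF fp_subD(1)[OF fS'] C g fp_sub_fib[OF fp_subD(1)[OF fS']] fD] by simp
    then have fA: "fp_sub V A" using fp_sub_submod[OF fS'] by blast
    have "g q ` A q = D q" for q
    proof
      show "g q ` A q \<subseteq> D q" by (auto simp: A_def)
      show "D q \<subseteq> g q ` A q"
      proof
        fix w assume w: "w \<in> D q"
        then have "w \<in> g q ` S' q" using D(1) surj[of q] by (auto simp: le_fun_def)
        then show "w \<in> g q ` A q" using w by (auto simp: A_def)
      qed
    qed
    moreover have "{v \<in> A q. g q v = 0} = S q" for q
      using ker[of q] fp_subD(4)[OF fD, of q] by (auto simp: A_def)
    ultimately have "energy Z \<theta> (submod V A) = energy Z \<theta> (submod V S) + energy Z \<theta> (submod C D)"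
      using energy_image[OF fp_subD(1)[OF fS'] C g A, of \<theta>] by simp
    then have "energy Z \<theta> (submod C D) \<le> 0" using S' fA eq by (auto simp: largest_max_def)
    then show "slope Z (submod C D) \<le> slope Z C"
      using energy_slope[OF D(2,3), of \<theta>] charge_pos[OF D(2,3)] slope by (simp add: mult_le_0_iff)
  qed (use C nz in auto)
qed

text \<open>
  Iterating \<open>next_maximiser\<close> terminates because the real part of the charge increases within a finite
  set.
\<close>

lemma filtration_from:
  assumes "S \<in> L" "largest_max \<theta>0 V S"
  shows "\<exists>l F C. F 0 = S \<and> F l = fib V \<and> (\<forall>j\<le>l. submod V (F j) \<in> Pers_fp) \<and>
     (\<forall>j<l. F j < F (Suc j) \<and>
        (\<exists>g. short_exact (submod V (F j)) (\<lambda>_ v. v) (submod V (F (Suc j))) g (C (Suc j))) \<and>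
        semistable Z (C (Suc j)) \<and> slope Z (C (Suc j)) < \<theta>0) \<and>
     (\<forall>j. 0 < j \<and> j < l \<longrightarrow> slope Z (C (Suc j)) < slope Z (C j))"
  using assms
proof (induction "card {r \<in> R ` L. R S < r}" arbitrary: S \<theta>0 rule: less_induct)
  case less
  have fS: "fp_sub V S" using L_sub less.prems by blast
  show ?case
  proof (cases "S = fib V")
    case True
    then show ?thesis using V by (intro exI[of _ 0] exI[of _ "\<lambda>_. S"]) simp
  next
    case False
    obtain S' \<theta>1 where S': "S' \<in> L" "largest_max \<theta>1 V S'" "\<theta>1 < \<theta>0" "S < S'" "E \<theta>1 S = E \<theta>1 S'"
      by (rule next_maximiser[OF less.prems False])
    have fS': "fp_sub V S'" using L_sub S' by blast
    have "fp_sub (submod V S') S" using fp_sub_submod[OF fS'] fS S'(4) by auto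
    then obtain C1 g where C1: "C1 \<in> Pers_fp" "short_exact (submod V S) (\<lambda>_ v. v) (submod V S') g C1"
      using quotient_exists[OF fp_subD(1)[OF fS'], of S] by auto
    note ss = quotient_semistable[OF fS S'(2,4,5) C1]
    have "R S < R S'" using charge_sub_mono[OF V fS' fS] S'(4) by fastforce
    then have "{r \<in> R ` L. R S' < r} \<subset> {r \<in> R ` L. R S < r}" using S'(1) by auto
    moreover have "finite {r \<in> R ` L. R S < r}" using finite_image_charge[of L Re] by simp
    ultimately have "card {r \<in> R ` L. R S' < r} < card {r \<in> R ` L. R S < r}" by (rule psubset_card_mono[rotated])
    from less.hyps[OF this S'(1,2)] obtain l F C where
      F: "F 0 = S'" "F l = fib V" "\<And>j. j \<le> l \<Longrightarrow> submod V (F j) \<in> Pers_fp"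
      and step: "\<And>j. j < l \<Longrightarrow> F j < F (Suc j) \<and>
        (\<exists>g. short_exact (submod V (F j)) (\<lambda>_ v. v) (submod V (F (Suc j))) g (C (Suc j))) \<and>
        semistable Z (C (Suc j)) \<and> slope Z (C (Suc j)) < \<theta>1"
      and dec: "\<And>j. 0 < j \<and> j < l \<Longrightarrow> slope Z (C (Suc j)) < slope Z (C j)" by metis
    define F' where "F' = case_nat S F"
    define C' where "C' = case_nat V (case_nat C1 (\<lambda>j. C (Suc j)))"
    have "F' 0 = S" "F' (Suc l) = fib V" using F by (simp_all add: F'_def)
    moreover have "submod V (F' j) \<in> Pers_fp" if "j \<le> Suc l" for j
      using that F(3) fp_subD(1)[OF fS] by (cases j) (auto simp: F'_def)
    moreover have "F' j < F' (Suc j) \<and>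
        (\<exists>g. short_exact (submod V (F' j)) (\<lambda>_ v. v) (submod V (F' (Suc j))) g (C' (Suc j))) \<and>
        semistable Z (C' (Suc j)) \<and> slope Z (C' (Suc j)) < \<theta>0" if "j < Suc l" for j
    proof (cases j)
      case 0
      then show ?thesis using S'(3,4) F(1) C1 ss by (auto simp: F'_def C'_def)
    next
      case (Suc i)
      then show ?thesis using step[of i] that S'(3) by (auto simp: F'_def C'_def)
    qed
    moreover have "slope Z (C' (Suc j)) < slope Z (C' j)" if "0 < j \<and> j < Suc l" for j
    proof -
      obtain i where i: "j = Suc i" using \<open>0 < j \<and> j < Suc l\<close> by (cases j) auto
      show ?thesis
      proof (cases i)
        case 0
        then show ?thesis using i step[of 0] that ss by (simp add: C'_def)
      next
        case (Suc k)
        then show ?thesis using i dec[of i] that by (simp add: C'_def)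
      qed
    qed
    ultimately show ?thesis by (intro exI[of _ "Suc l"] exI[of _ F'] exI[of _ C']) simp
  qed
qed

text \<open>
  The iteration starts at the zero subobject, which is the largest maximiser once \<open>\<theta>\<close> exceeds all slopes.
  If \<open>m\<close> bounds the slopes in \<open>L\<close>, then by domination no subobject has positive energy at \<open>m\<close>, and at
  \<open>m + 1\<close> the energy of a nonzero subobject is strictly negative.
\<close>

lemma HN_filtration_exists: "\<exists>l F C. HN_filtration Z V l F C"
proof -
  let ?X = "(\<lambda>S. Im (charge (submod V S)) / R S) ` L"
  have finX: "finite ?X" using finite_image_charge[of L "\<lambda>c. Im c / Re c"] by simp
  define m where "m = Max ?X"
  have "E m S \<le> 0" if "S \<in> L" for S
  proof (cases "nonzero_pmod (submod V S)")
    case True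
    have "slope Z (submod V S) \<le> m" unfolding m_def slope_def using finX that by simp
    then show ?thesis
      using energy_slope[OF fp_subD(1)[OF L_sub[OF that]] True, of m] charge_pos[OF fp_subD(1)[OF L_sub[OF that]] True]
      by (simp add: mult_nonpos_nonneg)
  next
    case False
    then show ?thesis using charge_zero[OF fp_subD(1)[OF L_sub[OF that]]] by (simp add: energy_def)
  qed
  then have Em: "E m A \<le> 0" if "fp_sub V A" for A using dominated[OF that, of m] by force
  have z: "fp_sub V (\<lambda>_. {0})" by (rule fp_sub_zero[OF V])
  have E1: "E (m + 1) A = E m A - R A" for A by (simp add: energy_def algebra_simps)
  have "largest_max (m + 1) V (\<lambda>_. {0})"
    unfolding largest_max_def
  proof (intro conjI allI impI)
    fix A assume A: "fp_sub V A"
    have E0: "E (m + 1) (\<lambda>_. {0}) = 0" by (rule energy_zero_sub[OF V])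
    show "E (m + 1) A \<le> E (m + 1) (\<lambda>_. {0})" using Em[OF A] R_nonneg[OF A] E0 E1[of A] by simp
    assume "E (m + 1) A = E (m + 1) (\<lambda>_. {0})"
    then have "R A = 0" using Em[OF A] R_nonneg[OF A] E0 E1[of A] by simp
    then have "\<not> nonzero_pmod (submod V A)" using charge_pos[OF fp_subD(1)[OF A]] by auto
    then show "A \<le> (\<lambda>_. {0})" by (simp add: nonzero_pmod_def le_fun_def)
  qed (rule z)
  from filtration_from[OF zero_L this] show ?thesis
    unfolding HN_filtration_def by metis
qed

end

section \<open>Integration over cubes\<close>

text \<open>
  The properties of the coordinate measure that the argument uses. They hold for Lebesgue measure and
  for counting measure.
\<close>

class measured_coord = grid_coord + second_countable_topology +
  assumes sets_coord_measure_open: "sets (coord_measure :: 'a measure) = sigma_sets UNIV {U. open U}"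
    and sigma_finite_coord_measure: "sigma_finite_measure (coord_measure :: 'a measure)"
    and coord_measure_Ico_pos: "a < b \<Longrightarrow> emeasure (coord_measure :: 'a measure) {a..<b} \<noteq> 0"
    and coord_measure_Ico_finite: "emeasure (coord_measure :: 'a measure) {a..<b} < \<infinity>"
    and open_subset_Ico: "a < b \<Longrightarrow> \<exists>U. open U \<and> U \<noteq> {} \<and> U \<subseteq> {a..<b}"

instance real :: measured_coord
proof
  show "sets (coord_measure :: real measure) = sigma_sets UNIV {U. open U}"
    "sigma_finite_measure (coord_measure :: real measure)"
    by (simp_all add: coord_measure_real_def lborel.sigma_finite_measure_axioms sets_borel)
  show "emeasure (coord_measure :: real measure) {a..<b} \<noteq> 0" if "a < b" for a b :: real
    using that by (simp add: coord_measure_real_def)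
  show "emeasure (coord_measure :: real measure) {a..<b} < \<infinity>" for a b :: real
    by (cases "a \<le> b") (simp_all add: coord_measure_real_def)
  show "\<exists>U. open U \<and> U \<noteq> {} \<and> U \<subseteq> {a..<b}" if "a < b" for a b :: real
    using that by (intro exI[of _ "{a<..<b}"]) auto
qed

instance int :: second_countable_topology
proof
  let ?B = "range (\<lambda>x::int. {x})"
  have "generate_topology ?B S" for S
  proof -
    have "generate_topology ?B (\<Union>x\<in>S. {x})"
      by (intro generate_topology_Union) (auto intro: generate_topology.Basis)
    then show ?thesis by simp
  qed
  then have "open = generate_topology ?B" by (auto simp: open_discrete fun_eq_iff)
  then show "\<exists>B::int set set. countable B \<and> open = generate_topology B"
    by (intro exI[of _ ?B]) simp
qed

instance int :: measured_coord
proof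
  have "S \<in> sigma_sets UNIV {U. open U}" for S :: "int set"
    by (rule sigma_sets.Basic) (simp add: open_discrete)
  then show "sets (coord_measure :: int measure) = sigma_sets UNIV {U. open U}"
    by (auto simp: coord_measure_int_def)
  show "sigma_finite_measure (coord_measure :: int measure)"
    unfolding coord_measure_int_def by (rule sigma_finite_measure_count_space)
  show "emeasure (coord_measure :: int measure) {a..<b} \<noteq> 0" if "a < b" for a b :: int
    using that by (simp add: coord_measure_int_def emeasure_count_space)
  show "emeasure (coord_measure :: int measure) {a..<b} < \<infinity>" for a b :: int
    by (simp add: coord_measure_int_def emeasure_count_space of_nat_less_top)
  show "\<exists>U. open U \<and> U \<noteq> {} \<and> U \<subseteq> {a..<b}" if "a < b" for a b :: int
    using that by (intro exI[of _ "{a..<b}"]) (simp add: open_discrete)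
qed

lemma sets_coord_measure: "sets (coord_measure :: 'a::measured_coord measure) = sets borel"
  by (simp add: sets_coord_measure_open sets_borel)

lemma measurable_vec_nth [measurable]:
  "(\<lambda>q :: 'a::topological_space ^ 'n::finite. q $ i) \<in> borel \<rightarrow>\<^sub>M borel"
  by (rule borel_measurableI) (simp add: open_vimage_vec_nth)

text \<open>
  By second countability an open set is a countable union of boxes, whose preimages are finite
  intersections of measurable sets.
\<close>

lemma measurable_vec_lambda:
  fixes f :: "'b \<Rightarrow> 'n::finite \<Rightarrow> 'a::second_countable_topology"
  assumes [measurable]: "\<And>i. (\<lambda>x. f x i) \<in> M \<rightarrow>\<^sub>M borel"
  shows "(\<lambda>x. \<chi> i. f x i) \<in> M \<rightarrow>\<^sub>M borel"
proof (rule borel_measurableI)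
  fix U :: "('a ^ 'n) set" assume U: "open U"
  obtain B :: "'a set set" where B: "countable B" "topological_basis B" using ex_countable_basis by blast
  define J where "J = {j \<in> PiE UNIV (\<lambda>_::'n. B). box_of j \<subseteq> U}"
  have cJ: "countable J"
    unfolding J_def using B(1) by (intro countable_Collect countable_PiE) auto
  have "U = (\<Union>j\<in>J. box_of j)"
  proof
    show "(\<Union>j\<in>J. box_of j) \<subseteq> U" by (auto simp: J_def)
    show "U \<subseteq> (\<Union>j\<in>J. box_of j)"
    proof
      fix x assume "x \<in> U"
      then obtain S where S: "\<And>i. open (S i) \<and> x $ i \<in> S i" "\<And>y. (\<forall>i. y $ i \<in> S i) \<Longrightarrow> y \<in> U"
        using U unfolding open_vec_def by metis
      have "\<exists>b\<in>B. x $ i \<in> b \<and> b \<subseteq> S i" for i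
        using topological_basisE[OF B(2)] S(1) by metis
      then obtain j where "\<And>i. j i \<in> B" "\<And>i. x $ i \<in> j i" "\<And>i. j i \<subseteq> S i" by metis
      then have "j \<in> J" "x \<in> box_of j" using S(2) by (auto simp: J_def box_of_def subset_iff)
      then show "x \<in> (\<Union>j\<in>J. box_of j)" by blast
    qed
  qed
  then have eq: "(\<lambda>x. \<chi> i. f x i) -` U \<inter> space M = (\<Union>j\<in>J. {x \<in> space M. \<forall>i. f x i \<in> j i})"
  proof -
    have "(\<chi> i. f x i) \<in> U \<longleftrightarrow> (\<exists>j\<in>J. \<forall>i. f x i \<in> j i)" for x
      by (subst \<open>U = (\<Union>j\<in>J. box_of j)\<close>) (simp add: box_of_def)
    then show ?thesis by blast
  qed
  have "{x \<in> space M. \<forall>i. f x i \<in> j i} \<in> sets M" if "j \<in> J" for j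
  proof -
    have "j i \<in> B" for i using that by (auto simp: J_def)
    then have "j i \<in> sets borel" for i using topological_basis_open[OF B(2)] by simp
    then show ?thesis by measurable
  qed
  then show "(\<lambda>x. \<chi> i. f x i) -` U \<inter> space M \<in> sets M"
    unfolding eq using cJ by (intro sets.countable_UN') auto
qed

text \<open>
  The parametrisation of the plane through \<open>c\<close> along which \<^const>\<open>cube_measure\<close> is pushed forward.
\<close>

definition cube_embed :: "('a::topological_space ^ 'n::finite) set \<Rightarrow> ('n \<Rightarrow> 'a) \<Rightarrow> 'a ^ 'n" where
  "cube_embed c y = (\<chi> i. if i \<in> cube_dirs c then y i else the_elem ((\<lambda>q. q $ i) ` c))"

lemma measurable_coord_eq:
  "measurable M (coord_measure :: 'a::measured_coord measure) = measurable M borel"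
  by (rule measurable_cong_sets) (simp_all add: sets_coord_measure)

lemma measurable_cube_embed [measurable]:
  fixes c :: "('a::measured_coord ^ 'n::finite) set"
  shows "cube_embed c \<in> Pi\<^sub>M (cube_dirs c) (\<lambda>_. coord_measure) \<rightarrow>\<^sub>M borel"
  unfolding cube_embed_def[abs_def]
proof (rule measurable_vec_lambda)
  fix i
  show "(\<lambda>x. if i \<in> cube_dirs c then x i else the_elem ((\<lambda>q. q $ i) ` c))
    \<in> Pi\<^sub>M (cube_dirs c) (\<lambda>_. coord_measure) \<rightarrow>\<^sub>M borel"
  proof (cases "i \<in> cube_dirs c")
    case True
    then show ?thesis
      using measurable_component_singleton[OF True, of "\<lambda>_. coord_measure :: 'a measure"]
      by (simp add: measurable_coord_eq)
  qed simp
qed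

lemma cube_measure_alt:
  "cube_measure c = distr (Pi\<^sub>M (cube_dirs c) (\<lambda>_. coord_measure)) borel (cube_embed c)"
  by (simp add: cube_measure_def cube_embed_def[abs_def])

lemma sets_cube_measure [simp, measurable_cong]: "sets (cube_measure c) = sets borel"
  and space_cube_measure [simp]: "space (cube_measure c) = UNIV"
  by (simp_all add: cube_measure_def)

definition upd :: "'n \<Rightarrow> 'a ^ 'n::finite \<Rightarrow> 'a \<Rightarrow> 'a ^ 'n" where
  "upd i q y = (\<chi> j. if j = i then y else q $ j)"

lemma upd_nth: "upd i q y $ j = (if j = i then y else q $ j)"
  by (simp add: upd_def)

lemma upd_upd [simp]: "upd i (upd i q x) y = upd i q y"
  and upd_same [simp]: "upd i q (q $ i) = q"
  by (simp_all add: vec_eq_iff upd_nth)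

lemma integrable_mult_bounded:
  fixes F k :: "'a::measured_coord ^ 'n::finite \<Rightarrow> real"
  assumes "integrable (cube_measure c) F" "k \<in> borel_measurable borel" "\<exists>B. \<forall>q. norm (k q) \<le> B"
  shows "integrable (cube_measure c) (\<lambda>q. F q * k q)"
proof -
  obtain B where B: "\<And>q. norm (k q) \<le> B" using assms(3) by blast
  have [measurable]: "F \<in> borel_measurable borel" "k \<in> borel_measurable borel"
    using borel_measurable_integrable[OF assms(1)] assms(2) by (simp_all cong: measurable_cong_sets)
  show ?thesis
  proof (rule Bochner_Integration.integrable_bound)
    show "integrable (cube_measure c) (\<lambda>q. B * F q)" using assms(1) by simp
    show "(\<lambda>q. F q * k q) \<in> borel_measurable (cube_measure c)" by measurable
    have "norm (F q * k q) \<le> norm (B * F q)" for q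
    proof -
      have "\<bar>F q\<bar> * \<bar>k q\<bar> \<le> \<bar>F q\<bar> * \<bar>B\<bar>"
        using B[of q] by (intro mult_left_mono) auto
      then show ?thesis by (simp add: abs_mult mult.commute)
    qed
    then show "AE q in cube_measure c. norm (F q * k q) \<le> norm (B * F q)" by simp
  qed
qed

text \<open>
  Fubini along one coordinate: on a slab where \<open>f\<close> does not depend on the coordinate \<open>i\<close>, its integral
  over a subslab is proportional to the thickness.
\<close>

lemma integral_slab:
  fixes c :: "('a::measured_coord ^ 'n::finite) set" and f :: "'a ^ 'n \<Rightarrow> real"
  assumes f: "integrable (cube_measure c) f" and i: "i \<in> cube_dirs c"
    and const: "\<And>q y. y \<in> I \<Longrightarrow> f (upd i q y) = f (upd i q a)"
  shows "\<exists>K. \<forall>J\<in>sets borel. J \<subseteq> I \<longrightarrow>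
    (\<integral>q. indicator J (q $ i) * f q \<partial>cube_measure c) = measure coord_measure J * K"
proof -
  interpret coord: sigma_finite_measure "coord_measure :: 'a measure" by (rule sigma_finite_coord_measure)
  interpret P: product_sigma_finite "\<lambda>_::'n. coord_measure :: 'a measure" ..
  let ?D = "cube_dirs c" and ?M = "\<lambda>_::'n. coord_measure :: 'a measure"
  let ?D' = "?D - {i}"
  have space_coord: "space (coord_measure :: 'a measure) = UNIV"
    by (simp add: sets_eq_imp_space_eq[OF sets_coord_measure])
  have D: "insert i ?D' = ?D" using i by blast
  have f_meas [measurable]: "f \<in> borel_measurable borel"
    using borel_measurable_integrable[OF f] by (simp cong: measurable_cong_sets)
  have emb_upd: "cube_embed c (x(i := y)) = upd i (cube_embed c x) y" for x y
    using i by (simp add: vec_eq_iff cube_embed_def upd_nth)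
  define K where "K = (\<integral>x. f (upd i (cube_embed c x) a) \<partial>Pi\<^sub>M ?D' ?M)"
  have "(\<integral>q. indicator J (q $ i) * f q \<partial>cube_measure c) = measure coord_measure J * K"
    if J [measurable]: "J \<in> sets borel" and sub: "J \<subseteq> I" for J
  proof -
    define g where "g q = indicator J (q $ i) * f q" for q
    have [measurable]: "g \<in> borel_measurable borel" unfolding g_def[abs_def] by measurable
    have "{q :: 'a ^ 'n. q $ i \<in> J} \<in> sets (cube_measure c)" by measurable
    then have "integrable (cube_measure c) (\<lambda>q. indicator {q. q $ i \<in> J} q *\<^sub>R f q)"
      by (rule integrable_mult_indicator[OF _ f])
    then have "integrable (cube_measure c) g" by (simp add: g_def[abs_def] indicator_def)
    then have int: "integrable (Pi\<^sub>M ?D ?M) (\<lambda>x. g (cube_embed c x))"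
      unfolding cube_measure_alt by (subst (asm) integrable_distr_eq) simp_all
    have "(\<integral>q. g q \<partial>cube_measure c) = (\<integral>x. g (cube_embed c x) \<partial>Pi\<^sub>M ?D ?M)"
      unfolding cube_measure_alt by (subst integral_distr) simp_all
    also have "\<dots> = (\<integral>x. (\<integral>y. g (cube_embed c (x(i := y))) \<partial>coord_measure) \<partial>Pi\<^sub>M ?D' ?M)"
      using P.product_integral_insert[of ?D' i "\<lambda>x. g (cube_embed c x)"] int unfolding D by simp
    also have "\<dots> = (\<integral>x. measure coord_measure J * f (upd i (cube_embed c x) a) \<partial>Pi\<^sub>M ?D' ?M)"
    proof (rule arg_cong[where f = "integral\<^sup>L _"], rule ext)
      fix x
      have "g (cube_embed c (x(i := y))) = indicator J y * f (upd i (cube_embed c x) a)" for y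
        using const[of y] sub by (auto simp: g_def emb_upd upd_nth indicator_def)
      then show "(\<integral>y. g (cube_embed c (x(i := y))) \<partial>coord_measure) =
          measure coord_measure J * f (upd i (cube_embed c x) a)"
        by (simp add: space_coord)
    qed
    also have "\<dots> = measure coord_measure J * K" by (simp add: K_def)
    finally show ?thesis by (simp add: g_def)
  qed
  then show ?thesis by blast
qed

section \<open>Comparing a function with its restrictions to two slices of a slab\<close>

text \<open>
  The function \<open>h\<close> takes two values along the coordinate \<open>i\<close> in the slab \<open>I\<close>: those of \<open>hl\<close> before \<open>t\<close> and
  those of \<open>hh\<close> from \<open>t\<close> on.
\<close>

locale slab =
  fixes i :: "'n::finite" and I :: "'a::measured_coord set" and a t :: 'a
    and h hl hh :: "'a ^ 'n \<Rightarrow> real"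
  assumes a_in: "a \<in> I"
    and measurable_h: "h \<in> borel_measurable borel" "hl \<in> borel_measurable borel" "hh \<in> borel_measurable borel"
    and bounded_h: "\<exists>B. \<forall>q. norm (h q) \<le> B" "\<exists>B. \<forall>q. norm (hl q) \<le> B" "\<exists>B. \<forall>q. norm (hh q) \<le> B"
    and h_lo: "\<And>q. q $ i \<notin> I \<or> \<not> t \<le> q $ i \<Longrightarrow> h q = hl q"
    and h_hi: "\<And>q. q $ i \<in> I \<Longrightarrow> t \<le> q $ i \<Longrightarrow> h q = hh q"
    and outside: "\<And>q. q $ i \<notin> I \<Longrightarrow> hl q = hh q"
    and lo_le_hi: "\<And>q. hl q \<le> hh q"
    and slab_const: "\<And>q y. y \<in> I \<Longrightarrow> hl (upd i q y) = hl (upd i q a)"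
      "\<And>q y. y \<in> I \<Longrightarrow> hh (upd i q y) = hh (upd i q a)"
begin

lemma h_le_hi: "h q \<le> hh q" and lo_le_h: "hl q \<le> h q"
  using h_lo[of q] h_hi[of q] lo_le_hi[of q] by (cases "q $ i \<in> I \<and> t \<le> q $ i"; force)+

lemma integrable_slab:
  assumes "integrable (cube_measure c) F"
  shows "integrable (cube_measure c) (\<lambda>q. F q * h q)" "integrable (cube_measure c) (\<lambda>q. F q * hl q)"
    "integrable (cube_measure c) (\<lambda>q. F q * hh q)"
  using integrable_mult_bounded[OF assms] measurable_h bounded_h by blast+

text \<open>
  If the density \<open>F\<close> does not depend on the coordinate \<open>i\<close> in the slab, the integral of \<open>h\<close> divides the
  interval between those of \<open>hl\<close> and \<open>hh\<close> in the proportion of the two parts of the slab: the difference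
  \<open>F * (hh - hl)\<close> is supported on the slab and contributes to \<open>h\<close> only from \<open>t\<close> on.
\<close>

lemma integral_uniform:
  fixes c :: "('a ^ 'n) set"
  assumes F: "integrable (cube_measure c) F" and i: "i \<in> cube_dirs c"
    and const: "\<And>q y. y \<in> I \<Longrightarrow> F (upd i q y) = F (upd i q a)"
    and I: "I = {a..<b}" "a < t" "t < b"
  shows "(\<integral>q. F q * h q \<partial>cube_measure c) - (\<integral>q. F q * hl q \<partial>cube_measure c) =
    measure coord_measure {t..<b} / measure coord_measure {a..<b} *
    ((\<integral>q. F q * hh q \<partial>cube_measure c) - (\<integral>q. F q * hl q \<partial>cube_measure c))"
proof -
  note int = integrable_slab[OF F]
  define f where "f q = F q * hh q - F q * hl q" for q
  have f: "integrable (cube_measure c) f" unfolding f_def[abs_def] using int by simp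
  have "f (upd i q y) = f (upd i q a)" if "y \<in> I" for q y
    using that by (simp add: f_def const slab_const)
  from integral_slab[OF f i this, of I] obtain K where K: "\<And>J. J \<in> sets borel \<Longrightarrow> J \<subseteq> I \<Longrightarrow>
    (\<integral>q. indicator J (q $ i) * f q \<partial>cube_measure c) = measure coord_measure J * K"
    by auto
  have "indicator {t..<b} (q $ i) * f q = F q * h q - F q * hl q" for q
    using h_lo[of q] h_hi[of q] I by (auto simp: f_def indicator_def)
  then have 1: "(\<integral>q. F q * h q \<partial>cube_measure c) - (\<integral>q. F q * hl q \<partial>cube_measure c) =
      measure coord_measure {t..<b} * K"
    using K[of "{t..<b}"] I int by auto
  have "indicator {a..<b} (q $ i) * f q = F q * hh q - F q * hl q" for q
    using outside[of q] I by (auto simp: f_def indicator_def)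
  then have 2: "(\<integral>q. F q * hh q \<partial>cube_measure c) - (\<integral>q. F q * hl q \<partial>cube_measure c) =
      measure coord_measure {a..<b} * K"
    using K[of "{a..<b}"] I int by auto
  have "emeasure (coord_measure :: 'a measure) {a..<b} \<noteq> 0" "emeasure (coord_measure :: 'a measure) {a..<b} \<noteq> \<infinity>"
    using coord_measure_Ico_pos[of a b] coord_measure_Ico_finite[of a b] I by auto
  then have "measure (coord_measure :: 'a measure) {a..<b} \<noteq> 0"
    by (simp add: measure_def enn2real_eq_0_iff)
  then show ?thesis unfolding 1 2 by simp
qed

lemma integral_avoiding:
  assumes "\<And>q. q $ i \<in> I \<Longrightarrow> t \<le> q $ i \<Longrightarrow> F q = 0"
  shows "(\<integral>q. F q * h q \<partial>M) = (\<integral>q. F q * hl q \<partial>M)"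
proof -
  have "(\<lambda>q. F q * h q) = (\<lambda>q. F q * hl q)" using assms h_lo by fastforce
  then show ?thesis by (rule arg_cong)
qed

lemma integral_between:
  assumes F: "integrable (cube_measure c) F" and nonneg: "\<And>q. q $ i \<in> I \<Longrightarrow> 0 \<le> F q"
  shows "(\<integral>q. F q * hl q \<partial>cube_measure c) \<le> (\<integral>q. F q * h q \<partial>cube_measure c)"
    and "(\<integral>q. F q * h q \<partial>cube_measure c) \<le> (\<integral>q. F q * hh q \<partial>cube_measure c)"
proof -
  have eq: "hl q = h q" "h q = hh q" if "q $ i \<notin> I" for q
    using that h_lo[of q] outside[of q] by auto
  have "F q * hl q \<le> F q * h q" for q
    using nonneg[of q] lo_le_h[of q] eq(1)[of q] by (cases "q $ i \<in> I") (auto intro: mult_left_mono)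
  then show "(\<integral>q. F q * hl q \<partial>cube_measure c) \<le> (\<integral>q. F q * h q \<partial>cube_measure c)"
    by (intro integral_mono integrable_slab[OF F])
  have "F q * h q \<le> F q * hh q" for q
    using nonneg[of q] h_le_hi[of q] eq(2)[of q] by (cases "q $ i \<in> I") (auto intro: mult_left_mono)
  then show "(\<integral>q. F q * h q \<partial>cube_measure c) \<le> (\<integral>q. F q * hh q \<partial>cube_measure c)"
    by (intro integral_mono integrable_slab[OF F])
qed

end

section \<open>Grid functions\<close>

lemma Ico_borel: "{x..<y} \<in> sets (borel :: 'a::linorder_topology measure)"
  unfolding atLeastLessThan_def
  by (rule sets.Int[OF borel_closed[OF closed_atLeast] borel_open[OF open_lessThan]])

definition thresholds :: "('a, 'n::finite) grid \<Rightarrow> 'n \<Rightarrow> 'a set" where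
  "thresholds G i = (\<lambda>p. gmap G i (p $ i)) ` grid_dom G"

lemma grid_fun_nth [simp]: "grid_fun G p $ i = gmap G i (p $ i)"
  by (simp add: grid_fun_def)

lemma grid_dom_nth: "p \<in> grid_dom G \<Longrightarrow> p $ i \<in> gdom G i"
  by (simp add: grid_dom_def box_of_def)

lemma grid_dom_upd: "p \<in> grid_dom G \<Longrightarrow> p' \<in> grid_dom G \<Longrightarrow> upd i p (p' $ i) \<in> grid_dom G"
  by (simp add: grid_dom_def box_of_def upd_nth)

lemma gmap_le_iff:
  fixes G :: "('a::linorder, 'n::finite) grid"
  assumes "grid_function G" "p \<in> grid_dom G" "p' \<in> grid_dom G"
  shows "gmap G i (p $ i) \<le> gmap G i (p' $ i) \<longleftrightarrow> p $ i \<le> p' $ i"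
proof (rule strict_mono_on_less_eq)
  show "strict_mono_on (gdom G i) (gmap G i)" using assms(1) by (simp add: grid_function_def)
qed (use assms grid_dom_nth in auto)

lemma grid_floor_cong:
  fixes q r :: "'a::linorder ^ 'n::finite"
  assumes "\<And>p. p \<in> grid_dom G \<Longrightarrow> grid_fun G p \<le> q \<longleftrightarrow> grid_fun G p \<le> r"
  shows "grid_floor G q = grid_floor G r"
proof -
  have "(\<lambda>p. p \<in> grid_dom G \<and> grid_fun G p \<le> q) = (\<lambda>p. p \<in> grid_dom G \<and> grid_fun G p \<le> r)"
    using assms by blast
  moreover have "(\<exists>p\<in>grid_dom G. grid_fun G p \<le> q) \<longleftrightarrow> (\<exists>p\<in>grid_dom G. grid_fun G p \<le> r)"
    using assms by blast
  ultimately show ?thesis by (simp add: grid_floor_def)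
qed

lemma grid_floor_eqI:
  assumes "x \<in> grid_dom G" "grid_fun G x \<le> q"
    and "\<And>p. p \<in> grid_dom G \<Longrightarrow> grid_fun G p \<le> q \<Longrightarrow> p \<le> x"
  shows "grid_floor G q = Some x"
proof -
  have "(GREATEST p. p \<in> grid_dom G \<and> grid_fun G p \<le> q) = x"
    by (rule Greatest_equality) (use assms in auto)
  then show ?thesis using assms(1,2) by (auto simp: grid_floor_def)
qed

locale fin_grid_function =
  fixes G :: "('a::measured_coord, 'n::finite) grid"
  assumes fin: "finite_grid_function G"
begin

lemma G: "grid_function G" and finite_dom: "finite (grid_dom G)"
  using fin by (auto simp: finite_grid_function_def)

lemma finite_thresholds: "finite_grid (thresholds G)"
  using finite_dom by (simp add: finite_grid_def thresholds_def)

lemma grid_floor_SomeD: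
  assumes "grid_floor G q = Some x"
  shows "x \<in> grid_dom G" "grid_fun G x \<le> q" "\<And>p. p \<in> grid_dom G \<Longrightarrow> grid_fun G p \<le> q \<Longrightarrow> p \<le> x"
proof -
  define P where "P = {p \<in> grid_dom G. grid_fun G p \<le> q}"
  have P: "finite P" "P \<noteq> {}"
    using finite_dom assms by (auto simp: P_def grid_floor_def split: if_splits)
  define y where "y = (\<chi> i. Max ((\<lambda>p. p $ i) ` P))"
  have "\<exists>p\<in>P. y $ i = p $ i" for i
  proof -
    have "y $ i \<in> (\<lambda>p. p $ i) ` P" unfolding y_def using P by (simp del: Max_in) (intro Max_in; simp)
    then show ?thesis by auto
  qed
  then have "y $ i \<in> gdom G i \<and> gmap G i (y $ i) \<le> q $ i" for i
  proof -
    obtain p where "p \<in> P" "y $ i = p $ i" using \<open>\<And>i. \<exists>p\<in>P. y $ i = p $ i\<close> by blast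
    then show ?thesis using grid_dom_nth[of p G i] by (simp add: P_def less_eq_vec_def)
  qed
  then have y: "y \<in> grid_dom G" "grid_fun G y \<le> q"
    by (auto simp: grid_dom_def box_of_def less_eq_vec_def)
  have y_max: "p \<le> y" if "p \<in> grid_dom G" "grid_fun G p \<le> q" for p
    using that P(1) by (auto simp: y_def P_def less_eq_vec_def)
  have "x = y" using grid_floor_eqI[OF y y_max] assms by simp
  then show "x \<in> grid_dom G" "grid_fun G x \<le> q" "\<And>p. p \<in> grid_dom G \<Longrightarrow> grid_fun G p \<le> q \<Longrightarrow> p \<le> x"
    using y y_max by auto
qed

lemma grid_floor_point: "x \<in> grid_dom G \<Longrightarrow> grid_floor G (grid_fun G x) = Some x"
  by (rule grid_floor_eqI) (auto simp: less_eq_vec_def gmap_le_iff[OF G])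

text \<open>
  The lower corner of the box is the grid point of \<open>x\<close>. Moving this corner up in direction \<open>i\<close> leaves the
  cell exactly when the next threshold is reached.
\<close>

lemma cub_eq_box:
  assumes x: "x \<in> grid_dom G" and eq: "cub G (Some x) = box_of (\<lambda>i. {\<alpha> i..<\<beta> i})"
  shows "\<alpha> i < \<beta> i" "\<alpha> i \<in> thresholds G i" "\<beta> i \<in> thresholds G i"
    and "\<And>z. z \<in> thresholds G i \<Longrightarrow> \<not> (\<alpha> i < z \<and> z < \<beta> i)"
proof -
  have in_box: "q \<in> cub G (Some x) \<longleftrightarrow> (\<forall>i. \<alpha> i \<le> q $ i \<and> q $ i < \<beta> i)" for q
    by (simp add: eq box_of_def)
  have gx: "grid_fun G x \<in> cub G (Some x)" using grid_floor_point[OF x] by (simp add: cub_def)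
  have lt: "\<alpha> i < \<beta> i" for i using gx in_box[of "grid_fun G x"] by (meson order_le_less_trans)
  show "\<alpha> i < \<beta> i" by (rule lt)
  have a_in: "(\<chi> i. \<alpha> i) \<in> cub G (Some x)" using in_box[of "\<chi> i. \<alpha> i"] lt by simp
  then have "grid_floor G (\<chi> i. \<alpha> i) = Some x" by (simp add: cub_def)
  from grid_floor_SomeD(2)[OF this] have "gmap G i (x $ i) \<le> \<alpha> i" for i
    by (simp add: less_eq_vec_def)
  then have gx_eq: "gmap G i (x $ i) = \<alpha> i" for i
    using gx in_box[of "grid_fun G x"] by (auto intro: antisym)
  show "\<alpha> i \<in> thresholds G i" using x gx_eq[of i] by (force simp: thresholds_def)
  have gap: "\<not> (\<alpha> i < z \<and> z < \<beta> i)" if "z \<in> thresholds G i" for z i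
  proof
    assume z: "\<alpha> i < z \<and> z < \<beta> i"
    obtain p where p: "p \<in> grid_dom G" "z = gmap G i (p $ i)"
      using \<open>z \<in> thresholds G i\<close> by (auto simp: thresholds_def)
    define q where "q = upd i (\<chi> i. \<alpha> i) z"
    have "q \<in> cub G (Some x)" using z lt in_box[of q] by (simp add: q_def upd_nth)
    then have "grid_floor G q = Some x" by (simp add: cub_def)
    moreover have "grid_fun G (upd i x (p $ i)) \<le> q"
      using p gx_eq by (simp add: less_eq_vec_def q_def upd_nth)
    ultimately have "upd i x (p $ i) \<le> x"
      using grid_floor_SomeD(3) grid_dom_upd[OF x p(1)] by blast
    then have "p $ i \<le> x $ i" by (auto simp: less_eq_vec_def upd_nth split: if_splits)
    then have "z \<le> \<alpha> i" using gmap_le_iff[OF G p(1) x, of i] p(2) gx_eq[of i] by simp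
    then show False using z by simp
  qed
  show "\<And>z. z \<in> thresholds G i \<Longrightarrow> \<not> (\<alpha> i < z \<and> z < \<beta> i)" by (rule gap)
  define q where "q = upd i (\<chi> i. \<alpha> i) (\<beta> i)"
  have "q \<notin> cub G (Some x)" using in_box[of q] by (auto simp: q_def upd_nth)
  moreover have gxq: "grid_fun G x \<le> q"
    using gx_eq lt[of i] by (auto simp: less_eq_vec_def q_def upd_nth)
  ultimately have "\<exists>p\<in>grid_dom G. grid_fun G p \<le> q \<and> \<not> p \<le> x"
    using grid_floor_eqI[OF x] by (auto simp: cub_def)
  then obtain p j where p: "p \<in> grid_dom G" "grid_fun G p \<le> q" "x $ j < p $ j"
    by (auto simp: less_eq_vec_def not_le)
  have "\<alpha> j < gmap G j (p $ j)"
    using gmap_le_iff[OF G p(1) x, of j] p(3) gx_eq[of j] by simp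
  moreover have le: "gmap G j (p $ j) \<le> q $ j" using p(2) by (simp add: less_eq_vec_def)
  ultimately have "j = i" by (auto simp: q_def upd_nth split: if_splits)
  with \<open>\<alpha> j < gmap G j (p $ j)\<close> le have "\<alpha> i < gmap G i (p $ i)" "gmap G i (p $ i) \<le> \<beta> i"
    by (auto simp: q_def upd_nth)
  moreover have "gmap G i (p $ i) \<in> thresholds G i" using p(1) by (auto simp: thresholds_def)
  ultimately show "\<beta> i \<in> thresholds G i" using gap[of "gmap G i (p $ i)" i] by force
qed

text \<open>
  The end points \<open>\<alpha>\<close> and \<open>\<beta>\<close> of the underlying cell are kept as parameters because a face that is a point
  in direction \<open>i\<close> does not determine them.
\<close>

definition face_shape :: "('a ^ 'n) set \<Rightarrow> ('n \<Rightarrow> 'a set) \<Rightarrow> ('n \<Rightarrow> 'a) \<Rightarrow> ('n \<Rightarrow> 'a) \<Rightarrow> bool" where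
  "face_shape c J \<alpha> \<beta> \<longleftrightarrow> c = box_of J \<and> (\<forall>i. \<alpha> i < \<beta> i \<and> \<alpha> i \<in> thresholds G i \<and> \<beta> i \<in> thresholds G i \<and>
     (\<forall>z\<in>thresholds G i. \<not> (\<alpha> i < z \<and> z < \<beta> i)) \<and> (J i = {\<alpha> i..<\<beta> i} \<or> J i = {\<alpha> i} \<or> J i = {\<beta> i}))"

lemma grid_faces_shape:
  assumes "c \<in> grid_faces G"
  shows "\<exists>J \<alpha> \<beta>. face_shape c J \<alpha> \<beta>"
proof -
  obtain x where x: "x \<in> grid_dom G" "c \<in> faces (cub G (Some x))"
    using assms by (auto simp: grid_faces_def)
  then obtain J \<alpha> \<beta> where J: "c = box_of J" "cub G (Some x) = box_of (\<lambda>i. {\<alpha> i..<\<beta> i})"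
    "\<And>i. J i \<in> {{\<alpha> i..<\<beta> i}, {\<alpha> i}, {\<beta> i}}"
    by (auto simp: faces_def)
  have "face_shape c J \<alpha> \<beta>"
    unfolding face_shape_def
  proof (intro conjI allI ballI)
    show "c = box_of J" by (rule J(1))
    fix i
    show "J i = {\<alpha> i..<\<beta> i} \<or> J i = {\<alpha> i} \<or> J i = {\<beta> i}" using J(3)[of i] by simp
  qed (rule cub_eq_box[OF x(1) J(2)], assumption?)+
  then show ?thesis by blast
qed

lemma face_proj:
  assumes "face_shape c J \<alpha> \<beta>"
  shows "(\<lambda>q. q $ i) ` c = J i"
proof
  show "(\<lambda>q. q $ i) ` c \<subseteq> J i" using assms by (auto simp: face_shape_def box_of_def)
  show "J i \<subseteq> (\<lambda>q. q $ i) ` c"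
  proof
    fix y assume y: "y \<in> J i"
    have "J j \<noteq> {}" for j
    proof -
      have "\<alpha> j < \<beta> j" "J j = {\<alpha> j..<\<beta> j} \<or> J j = {\<alpha> j} \<or> J j = {\<beta> j}" using assms by (auto simp: face_shape_def)
      then show ?thesis by auto
    qed
    then have p: "(SOME y. y \<in> J j) \<in> J j" for j by (simp add: some_in_eq)
    define p where "p j = (SOME y. y \<in> J j)" for j
    have "upd i (vec_lambda p) y \<in> c" using assms p y by (auto simp: face_shape_def box_of_def upd_nth p_def)
    then show "y \<in> (\<lambda>q. q $ i) ` c" by (force simp: upd_nth)
  qed
qed

lemma face_dirs:
  assumes "face_shape c J \<alpha> \<beta>" "J i = {\<alpha> i..<\<beta> i}"
  shows "i \<in> cube_dirs c"
proof -
  have "\<alpha> i < \<beta> i" using assms by (simp add: face_shape_def)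
  then obtain U where "open U" "U \<noteq> {}" "U \<subseteq> {\<alpha> i..<\<beta> i}" using open_subset_Ico by blast
  then have "interior {\<alpha> i..<\<beta> i} \<noteq> {}" using interior_maximal by blast
  then show ?thesis using face_proj[OF assms(1), of i] assms(2) by (simp add: cube_dirs_def)
qed

lemma face_measurable:
  assumes "face_shape c J \<alpha> \<beta>"
  shows "c \<in> sets borel" "J i \<in> sets borel"
proof -
  show J [measurable]: "J i \<in> sets borel" for i
  proof -
    have "J i = {\<alpha> i..<\<beta> i} \<or> J i = {\<alpha> i} \<or> J i = {\<beta> i}" using assms by (auto simp: face_shape_def)
    then show ?thesis
      using Ico_borel[of "\<alpha> i" "\<beta> i"] borel_closed[OF closed_singleton] by metis
  qed
  have "c = {q \<in> space borel. \<forall>i. q $ i \<in> J i}" using assms by (auto simp: face_shape_def box_of_def)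
  also have "\<dots> \<in> sets borel" by measurable
  finally show "c \<in> sets borel" .
qed

lemma coord_measure_singleton: "emeasure (coord_measure :: 'a measure) {y} < \<infinity>"
proof -
  have "{y..<y + 1} \<in> sets (coord_measure :: 'a measure)"
    unfolding sets_coord_measure by (rule Ico_borel)
  then have "emeasure (coord_measure :: 'a measure) {y} \<le> emeasure coord_measure {y..<y + 1}"
    by (intro emeasure_mono) auto
  then show ?thesis using coord_measure_Ico_finite[of y "y + 1"] by (rule order_le_less_trans)
qed

lemma integrable_face:
  assumes c: "face_shape c J \<alpha> \<beta>"
  shows "integrable (cube_measure c) (indicator c :: 'a ^ 'n \<Rightarrow> real)"
proof -
  interpret coord: sigma_finite_measure "coord_measure :: 'a measure" by (rule sigma_finite_coord_measure)
  interpret P: product_sigma_finite "\<lambda>_::'n. coord_measure :: 'a measure" ..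
  let ?D = "cube_dirs c"
  let ?P = "Pi\<^sub>M ?D (\<lambda>_. coord_measure :: 'a measure)"
  note m [measurable] = face_measurable[OF c]
  have J: "J i \<in> sets (coord_measure :: 'a measure)" for i using m(2) by (simp add: sets_coord_measure)
  have "emeasure (cube_measure c) c = emeasure ?P (cube_embed c -` c \<inter> space ?P)"
    unfolding cube_measure_alt by (rule emeasure_distr) (use m in auto)
  also have "\<dots> \<le> emeasure ?P (Pi\<^sub>E ?D J)"
  proof (rule emeasure_mono)
    show "cube_embed c -` c \<inter> space ?P \<subseteq> Pi\<^sub>E ?D J"
    proof
      fix y assume y: "y \<in> cube_embed c -` c \<inter> space ?P"
      then have "\<forall>i. cube_embed c y $ i \<in> J i" using c by (auto simp: face_shape_def box_of_def)
      then have "y i \<in> J i" if "i \<in> ?D" for i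
      proof -
        have "cube_embed c y $ i \<in> J i" using \<open>\<forall>i. cube_embed c y $ i \<in> J i\<close> by (rule spec)
        then show ?thesis using that by (simp add: cube_embed_def)
      qed
      then show "y \<in> Pi\<^sub>E ?D J" using y by (auto simp: space_PiM PiE_iff)
    qed
    show "Pi\<^sub>E ?D J \<in> sets ?P" using J by (intro sets_PiM_I_finite) auto
  qed
  also have "\<dots> = (\<Prod>i\<in>?D. emeasure coord_measure (J i))"
    using J by (intro P.emeasure_PiM) auto
  also have "\<dots> < \<infinity>"
  proof -
    have "emeasure (coord_measure :: 'a measure) (J i) < \<infinity>" for i
    proof -
      have "J i = {\<alpha> i..<\<beta> i} \<or> J i = {\<alpha> i} \<or> J i = {\<beta> i}" using c by (auto simp: face_shape_def)
      then show ?thesis using coord_measure_Ico_finite coord_measure_singleton by auto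
    qed
    then show ?thesis by (simp add: ennreal_prod_eq_top less_top[symmetric])
  qed
  finally show ?thesis using m by (intro integrable_real_indicator) auto
qed

end

text \<open>
  The second grid is the one by which the densities of a stability condition are discretised. Inside the
  bounding cube of \<open>G\<close> it has no further thresholds.
\<close>

locale grid_pair = fin_grid_function G for G :: "('a::measured_coord, 'n::finite) grid" +
  fixes G' :: "('a, 'n) grid"
  assumes ext: "grid_extension G G'"
begin

text \<open>
  Replace the coordinate \<open>i\<close> of a grid point of \<open>G\<close> by \<open>z\<close>. The result is a point of \<open>G'\<close>, and it lies in the cube
  that cuts out \<open>G\<close> by convexity in direction \<open>i\<close>.
\<close>

lemma thresholds_between:
  assumes z: "z \<in> thresholds G' i" and "\<alpha> \<in> thresholds G i" "\<beta> \<in> thresholds G i" "\<alpha> \<le> z" "z \<le> \<beta>"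
  shows "z \<in> thresholds G i"
proof -
  obtain c where c: "is_cube c" "grid_fun G ` grid_dom G = grid_fun G' ` grid_dom G' \<inter> c"
    using ext by (auto simp: grid_extension_def)
  obtain J where J: "\<And>i. order_convex (J i)" "c = box_of J" using c(1) by (auto simp: is_cube_def)
  obtain p where p: "p \<in> grid_dom G'" "z = gmap G' i (p $ i)" using z by (auto simp: thresholds_def)
  obtain x y where xy: "x \<in> grid_dom G" "y \<in> grid_dom G" "\<alpha> = gmap G i (x $ i)" "\<beta> = gmap G i (y $ i)"
    using assms by (auto simp: thresholds_def)
  have "grid_fun G x \<in> grid_fun G' ` grid_dom G'" "grid_fun G x \<in> c" "grid_fun G y \<in> c" using c(2) xy by auto
  then obtain x' where x': "x' \<in> grid_dom G'" "grid_fun G' x' = grid_fun G x" by auto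
  have inJ: "gmap G j (x $ j) \<in> J j" "gmap G j (y $ j) \<in> J j" for j
    using \<open>grid_fun G x \<in> c\<close> \<open>grid_fun G y \<in> c\<close> J(2) by (force simp: box_of_def)+
  then have "z \<in> J i" using J(1)[of i] assms(4,5) xy unfolding order_convex_def by (metis atLeastAtMost_iff subsetD)
  moreover have x'_nth: "gmap G' j (x' $ j) = gmap G j (x $ j)" for j
    using arg_cong[OF x'(2), of "\<lambda>v. v $ j"] by simp
  ultimately have "grid_fun G' (upd i x' (p $ i)) \<in> c"
    using p(2) inJ J(2) by (auto simp: box_of_def upd_nth)
  then have "grid_fun G' (upd i x' (p $ i)) \<in> grid_fun G ` grid_dom G"
    using c(2) grid_dom_upd[OF x'(1) p(1)] by blast
  then obtain w where w: "w \<in> grid_dom G" "grid_fun G' (upd i x' (p $ i)) = grid_fun G w" by auto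
  have "gmap G i (w $ i) = z" using arg_cong[OF w(2), of "\<lambda>v. v $ i"] p(2) by (simp add: upd_nth)
  then show ?thesis using w(1) by (auto simp: thresholds_def)
qed

definition inside :: "'n \<Rightarrow> 'a \<Rightarrow> bool" where
  "inside i y \<longleftrightarrow> (\<exists>\<alpha>\<in>thresholds G i. \<alpha> \<le> y) \<and> (\<exists>\<beta>\<in>thresholds G i. y < \<beta>)"

text \<open>
  A function discretised by \<open>G'\<close> depends only on which thresholds of \<open>G'\<close> have been passed. In directions
  where \<open>q\<close> lies between thresholds of \<open>G\<close>, the nearby thresholds of \<open>G'\<close> are those of \<open>G\<close>.
\<close>

lemma discretisable_cong:
  assumes f: "discretisable_fun G' f"
    and qr: "\<And>j. q $ j = r $ j \<or> (inside j (q $ j) \<and> (\<forall>z\<in>thresholds G j. z \<le> q $ j \<longleftrightarrow> z \<le> r $ j))"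
  shows "f q = f r"
proof -
  have "z \<le> q $ j \<longleftrightarrow> z \<le> r $ j" if z: "z \<in> thresholds G' j" for z j
  proof (cases "q $ j = r $ j")
    case False
    then have in': "inside j (q $ j)" and iff: "\<And>z. z \<in> thresholds G j \<Longrightarrow> z \<le> q $ j \<longleftrightarrow> z \<le> r $ j"
      using qr[of j] by auto
    obtain \<alpha> \<beta> where ab: "\<alpha> \<in> thresholds G j" "\<beta> \<in> thresholds G j" "\<alpha> \<le> q $ j" "q $ j < \<beta>"
      using in' by (auto simp: inside_def)
    have ab': "\<alpha> \<le> r $ j" "r $ j < \<beta>" using iff[OF ab(1)] iff[OF ab(2)] ab by auto
    show ?thesis
    proof (cases "\<alpha> \<le> z \<and> z \<le> \<beta>")
      case True
      then show ?thesis using thresholds_between[OF z ab(1,2)] iff by blast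
    next
      case False
      then show ?thesis using ab ab' by auto
    qed
  qed simp
  then have "grid_floor G' q = grid_floor G' r"
    by (intro grid_floor_cong) (auto simp: less_eq_vec_def thresholds_def)
  then show ?thesis using f by (auto simp: discretisable_fun_def)
qed

context
  fixes a :: "'a ^ 'n \<Rightarrow> real"
  assumes a: "discretisable_fun G' a"
    and null: "\<forall>x \<in> insert None (Some ` grid_dom G). \<not> bounded_set (cub G x) \<longrightarrow> (\<forall>q\<in>cub G x. a q = 0)"
begin

text \<open>A point that is not between thresholds in some direction lies in an unbounded cell.\<close>

lemma null_outside:
  assumes out: "\<not> inside i (q $ i)"
  shows "a q = 0"
proof -
  define x where "x = grid_floor G q"
  have x: "x \<in> insert None (Some ` grid_dom G)"
    using grid_floor_SomeD(1)[of q] by (cases x) (auto simp: x_def)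
  have q: "q \<in> cub G x" by (simp add: cub_def x_def)
  have "\<not> bounded_set (cub G x)"
  proof
    assume "bounded_set (cub G x)"
    then obtain l u where lu: "\<And>r. r \<in> cub G x \<Longrightarrow> l \<le> r" "\<And>r. r \<in> cub G x \<Longrightarrow> r \<le> u"
      by (auto simp: bounded_set_def bdd_above_def bdd_below_def)
    show False
    proof (cases "\<exists>\<alpha>\<in>thresholds G i. \<alpha> \<le> q $ i")
      case True
      then have all: "z \<le> q $ i" if "z \<in> thresholds G i" for z
        using out that by (auto simp: inside_def not_less)
      define r where "r = upd i q (max (q $ i) (u $ i) + 1)"
      have "grid_floor G r = grid_floor G q"
      proof (rule grid_floor_cong)
        fix p assume p: "p \<in> grid_dom G"
        have "gmap G i (p $ i) \<le> q $ i" using all p by (auto simp: thresholds_def)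
        moreover have "q $ i \<le> max (q $ i) (u $ i) + 1" by (simp add: max_def add_increasing2)
        ultimately show "grid_fun G p \<le> r \<longleftrightarrow> grid_fun G p \<le> q"
          unfolding less_eq_vec_def r_def by (auto simp: upd_nth intro: order_trans)
      qed
      then have "r \<le> u" using lu(2) by (simp add: cub_def x_def)
      then have "max (q $ i) (u $ i) + 1 \<le> u $ i" by (auto simp: less_eq_vec_def r_def upd_nth split: if_splits)
      then show False by (simp add: max_def split: if_splits)
    next
      case False
      define r where "r = upd i q (min (q $ i) (l $ i) - 1)"
      have r_le: "r $ i \<le> q $ i" by (simp add: r_def upd_nth min_def diff_le_eq add_increasing2)
      have "grid_floor G r = grid_floor G q"
      proof (rule grid_floor_cong)
        fix p assume p: "p \<in> grid_dom G"
        have "\<not> gmap G i (p $ i) \<le> q $ i" using False p by (auto simp: thresholds_def)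
        moreover from this have "\<not> gmap G i (p $ i) \<le> r $ i" using r_le by auto
        ultimately show "grid_fun G p \<le> r \<longleftrightarrow> grid_fun G p \<le> q"
          unfolding less_eq_vec_def grid_fun_nth by blast
      qed
      then have "l \<le> r" using lu(1) by (simp add: cub_def x_def)
      then have "l $ i \<le> min (q $ i) (l $ i) - 1" by (auto simp: less_eq_vec_def r_def upd_nth split: if_splits)
      then show False by (simp add: min_def split: if_splits)
    qed
  qed
  then show ?thesis using null x q by blast
qed

lemma density_cell_const:
  assumes "same_cell (thresholds G) q r"
  shows "a q = a r"
proof (cases "\<forall>i. inside i (q $ i)")
  case True
  then show ?thesis using assms by (intro discretisable_cong[OF a]) (auto simp: same_cell_def)
next
  case False
  then obtain i where i: "\<not> inside i (q $ i)" by blast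
  moreover have "inside i (q $ i) \<longleftrightarrow> inside i (r $ i)"
    using assms unfolding inside_def same_cell_def by (meson not_le)
  ultimately show ?thesis using null_outside[of i q] null_outside[of i r] by simp
qed

end

end

section \<open>Functions constant on the cells of a finite grid\<close>

text \<open>
  Such a function is a function of the set of passed thresholds, which has finitely many possible values.
\<close>

lemma cell_const_regular:
  fixes f :: "'a::measured_coord ^ 'n::finite \<Rightarrow> real"
  assumes T: "finite_grid T" and const: "\<And>q r. same_cell T q r \<Longrightarrow> f q = f r"
  shows "f \<in> borel_measurable borel" "\<exists>B. \<forall>q. norm (f q) \<le> B"
proof -
  define P where "P = (SIGMA i:UNIV. T i)"
  have P: "finite P" using T by (auto simp: P_def finite_grid_def)
  define s where "s q = {x \<in> P. snd x \<le> q $ fst x}" for q :: "'a ^ 'n"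
  have s_eq: "f q = f r" if "s q = s r" for q r
  proof (rule const)
    show "same_cell T q r"
      unfolding same_cell_def
    proof (intro allI ballI)
      fix i t assume "t \<in> T i"
      then have "(i, t) \<in> s q \<longleftrightarrow> t \<le> q $ i" "(i, t) \<in> s r \<longleftrightarrow> t \<le> r $ i" by (auto simp: s_def P_def)
      then show "t \<le> q $ i \<longleftrightarrow> t \<le> r $ i" using that by simp
    qed
  qed
  define k where "k S = f (SOME q. s q = S)" for S
  have k: "f q = k (s q)" for q
    unfolding k_def by (rule s_eq) (rule someI[of "\<lambda>r. s r = s q", symmetric], rule refl)
  have "s \<in> borel \<rightarrow>\<^sub>M count_space (Pow P)"
  proof (subst measurable_count_space_eq2)
    show "finite (Pow P)" using P by simp
    show "s \<in> space borel \<rightarrow> Pow P \<and> (\<forall>S\<in>Pow P. s -` {S} \<inter> space borel \<in> sets borel)"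
    proof (intro conjI ballI)
      show "s \<in> space borel \<rightarrow> Pow P" by (auto simp: s_def)
      fix S assume "S \<in> Pow P"
      then have "s q = S \<longleftrightarrow> (\<forall>x\<in>P. snd x \<le> q $ fst x \<longleftrightarrow> x \<in> S)" for q unfolding s_def by blast
      then have "s -` {S} \<inter> space borel = {q \<in> space borel. \<forall>x\<in>P. q $ fst x \<in> {snd x..} \<longleftrightarrow> x \<in> S}"
        by (simp add: set_eq_iff)
      also have "\<dots> \<in> sets borel"
      proof (rule sets.sets_Collect_finite_All[OF _ P])
        fix x assume "x \<in> P"
        have "{q :: 'a ^ 'n \<in> space borel. q $ fst x \<in> {snd x..}} \<in> sets borel"
          by measurable
        then show "{q \<in> space borel. q $ fst x \<in> {snd x..} \<longleftrightarrow> x \<in> S} \<in> sets borel"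
          by (cases "x \<in> S") (auto dest: sets.compl_sets simp: Collect_neg_eq Compl_eq_Diff_UNIV)
      qed
      finally show "s -` {S} \<inter> space borel \<in> sets borel" .
    qed
  qed
  from measurable_compose[OF this, of k borel] show "f \<in> borel_measurable borel" by (simp add: k[abs_def])
  have "finite (k ` Pow P)" using P by simp
  moreover have "f q \<in> k ` Pow P" for q unfolding k by (auto simp: s_def)
  ultimately have "finite (range f)" by (meson finite_subset image_subsetI)
  then have "bounded (range f)" by (rule finite_imp_bounded)
  then show "\<exists>B. \<forall>q. norm (f q) \<le> B" by (auto simp: bounded_iff)
qed

context grid_pair
begin

text \<open>
  The function is bounded and vanishes outside the box between the extreme thresholds of \<open>G\<close>.
\<close>

lemma integrable_density:
  fixes a :: "'a ^ 'n \<Rightarrow> real"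
  assumes a: "discretisable_fun G' a"
    and null: "\<forall>x \<in> insert None (Some ` grid_dom G). \<not> bounded_set (cub G x) \<longrightarrow> (\<forall>q\<in>cub G x. a q = 0)"
  shows "integrable (cube_measure UNIV) a"
proof -
  interpret coord: sigma_finite_measure "coord_measure :: 'a measure" by (rule sigma_finite_coord_measure)
  interpret P: product_sigma_finite "\<lambda>_::'n. coord_measure :: 'a measure" ..
  note reg = cell_const_regular[OF finite_thresholds, of a, OF density_cell_const[OF a null]]
  note m [measurable] = reg(1)
  obtain B where B: "\<And>q. norm (a q) \<le> B" using reg(2) by blast
  have B0: "0 \<le> B" using B[of 0] norm_ge_zero order_trans by blast
  define l u where "l i = Min (thresholds G i)" and "u i = Max (thresholds G i)" for i
  define c :: "('a ^ 'n) set" where "c = {q. \<forall>i. q $ i \<in> {l i..<u i}}"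
  have fint: "finite (thresholds G i)" for i using finite_thresholds by (simp add: finite_grid_def)
  have Ico [measurable]: "{x..<y} \<in> sets (borel :: 'a measure)" for x y
    by (rule Ico_borel)
  have supp: "q \<in> c" if "a q \<noteq> 0" for q
  proof -
    have "inside i (q $ i)" for i using null_outside[OF a null] that by blast
    then have "l i \<le> q $ i \<and> q $ i < u i" for i
      unfolding inside_def l_def u_def by (meson fint Min_le Max_ge order_trans order_less_le_trans)
    then show ?thesis by (simp add: c_def)
  qed
  have c_meas: "c \<in> sets borel"
  proof -
    have "c = {q \<in> space borel. \<forall>i. q $ i \<in> {l i..<u i}}" by (simp add: c_def)
    also have "\<dots> \<in> sets borel" by measurable
    finally show ?thesis .
  qed
  have "emeasure (cube_measure UNIV) c = emeasure (Pi\<^sub>M UNIV (\<lambda>_. coord_measure)) (cube_embed UNIV -` c \<inter> space (Pi\<^sub>M UNIV (\<lambda>_. coord_measure)))"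
    unfolding cube_measure_alt cube_dirs_UNIV
    using measurable_cube_embed[of "UNIV :: ('a ^ 'n) set"] c_meas
    by (intro emeasure_distr) (auto simp: cube_dirs_UNIV)
  also have "cube_embed UNIV -` c \<inter> space (Pi\<^sub>M UNIV (\<lambda>_. coord_measure)) = Pi\<^sub>E UNIV (\<lambda>i. {l i..<u i})"
    using sets_eq_imp_space_eq[OF sets_coord_measure[where 'a = 'a]]
    by (auto simp: c_def cube_embed_def cube_dirs_UNIV space_PiM PiE_iff)
  also have "emeasure (Pi\<^sub>M UNIV (\<lambda>_::'n. coord_measure)) \<dots> = (\<Prod>i\<in>UNIV. emeasure coord_measure {l i..<u i})"
    using Ico by (intro P.emeasure_PiM) (auto simp: sets_coord_measure)
  also have "\<dots> < \<infinity>"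
    using coord_measure_Ico_finite[where 'a = 'a] by (simp add: ennreal_prod_eq_top less_top[symmetric])
  finally have "integrable (cube_measure UNIV) (indicator c :: 'a ^ 'n \<Rightarrow> real)"
    using c_meas by (intro integrable_real_indicator) auto
  then have "integrable (cube_measure UNIV) (\<lambda>q. B * indicator c q)" by simp
  then show ?thesis
  proof (rule Bochner_Integration.integrable_bound)
    show "a \<in> borel_measurable (cube_measure UNIV)" by measurable
    have "norm (a q) \<le> norm (B * indicator c q)" for q
      using B[of q] B0 supp[of q] by (cases "a q = 0") auto
    then show "AE q in cube_measure UNIV. norm (a q) \<le> norm (B * indicator c q)" by simp
  qed
qed

end

section \<open>Slices of subobjects\<close>

lemma dim_zero_space: "amb.dim {0} = 0"
  using amb.dim_le_card[of "{0}" "{}"] by simp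

text \<open>
  Points of one cell need not be comparable, but both lie above the floor of the cell.
\<close>

lemma dim_fun_cell_const:
  fixes V :: "('a::linorder ^ 'n::finite, 'k::field) pmod"
  assumes V: "V \<in> Pers" and T: "finite_grid T" "tame T V" and qr: "same_cell T q r"
  shows "dim_fun V q = dim_fun V r"
proof (cases "above_grid T q")
  case True
  have *: "dim_fun V (cell_floor T x) = dim_fun V x" if "above_grid T x" for x
  proof -
    let ?f = "tmap V (cell_floor T x) x"
    have le: "cell_floor T x \<le> x" by (rule cell_floor_le[OF T(1) that])
    have b: "bij_betw ?f (fib V (cell_floor T x)) (fib V x)"
      by (rule tame_bij[OF T(2) le same_cell_floor[OF T(1) that]])
    show ?thesis
      using dim_linear_image_inj[OF PersD(4)[OF V le] PersD(1)[OF V]] b by (simp add: bij_betw_def dim_fun_def)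
  qed
  have "above_grid T r" using True above_grid_cong[OF qr] by simp
  then show ?thesis using *[OF True] *[of r] cell_floor_cong[OF qr] by simp
next
  case False
  then have "\<not> above_grid T r" using above_grid_cong[OF qr] by simp
  then show ?thesis using tame_zero[OF T(2)] False by (simp add: dim_fun_def)
qed

text \<open>
  Precompose a subobject with a monotone map \<open>\<rho>\<close> of the index set, where the fibres of \<open>V\<close> at \<open>q\<close> and
  \<open>\<rho> q\<close> are identified through a common lower point \<open>\<sigma> q\<close> in the same cell.
\<close>

locale slice =
  fixes V :: "('a::linorder ^ 'n::finite, 'k::field) pmod" and T T' T'' :: "'n \<Rightarrow> 'a set"
    and S :: "'a ^ 'n \<Rightarrow> 'k poly set" and \<sigma> \<rho> :: "'a ^ 'n \<Rightarrow> 'a ^ 'n"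
  assumes V: "V \<in> Pers" and T: "tame T V" "finite_grid T"
    and S: "fp_sub V S" "tame T' (submod V S)"
    and T': "\<And>i. T i \<subseteq> T' i" and T'': "\<And>i. T i \<subseteq> T'' i" "finite_grid T''"
    and le: "\<And>q. \<sigma> q \<le> q" "\<And>q. \<sigma> q \<le> \<rho> q"
    and mono: "\<And>q r. q \<le> r \<Longrightarrow> \<sigma> q \<le> \<sigma> r" "\<And>q r. q \<le> r \<Longrightarrow> \<rho> q \<le> \<rho> r"
    and cell: "\<And>q. same_cell T (\<sigma> q) q" "\<And>q. same_cell T (\<sigma> q) (\<rho> q)"
    and cell': "\<And>q r. q \<le> r \<Longrightarrow> same_cell T'' q r \<Longrightarrow> same_cell T' (\<rho> q) (\<rho> r)"
begin

text \<open>
  The slice of \<open>S\<close> at \<open>\<rho> q\<close>, seen in the fibre at the common lower point.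
\<close>

definition U :: "'a ^ 'n \<Rightarrow> 'k poly set" where
  "U q = {u \<in> fib V (\<sigma> q). tmap V (\<sigma> q) (\<rho> q) u \<in> S (\<rho> q)}"

definition slice_sub :: "'a ^ 'n \<Rightarrow> 'k poly set" where
  "slice_sub q = tmap V (\<sigma> q) q ` U q"

lemma bij_q: "bij_betw (tmap V (\<sigma> q) q) (fib V (\<sigma> q)) (fib V q)"
  and bij_\<rho>: "bij_betw (tmap V (\<sigma> q) (\<rho> q)) (fib V (\<sigma> q)) (fib V (\<rho> q))"
  by (rule tame_bij[OF T(1) le(1) cell(1)], rule tame_bij[OF T(1) le(2) cell(2)])

lemma U_subset: "U q \<subseteq> fib V (\<sigma> q)"
  by (auto simp: U_def)

lemma U_fin: "fin_dim_subspace (U q)"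
proof (rule fin_dim_subspace_subset[OF PersD(1)[OF V] _ U_subset])
  show "amb.subspace (U q)"
    unfolding U_def by (rule subspace_linear_preimage[OF PersD(4)[OF V le(2)] PersD(2)[OF V] fp_subD(3)[OF S(1)]])
qed

lemma slice_sub_nat:
  assumes qr: "q \<le> r" and u: "u \<in> fib V (\<sigma> q)"
  shows "tmap V q r (tmap V (\<sigma> q) q u) = tmap V (\<sigma> r) r (tmap V (\<sigma> q) (\<sigma> r) u)"
    and "tmap V (\<sigma> r) (\<rho> r) (tmap V (\<sigma> q) (\<sigma> r) u) = tmap V (\<rho> q) (\<rho> r) (tmap V (\<sigma> q) (\<rho> q) u)"
  using PersD(6)[OF V le(1) qr u] PersD(6)[OF V mono(1)[OF qr] le(1) u]
    PersD(6)[OF V mono(1)[OF qr] le(2) u] PersD(6)[OF V le(2) mono(2)[OF qr] u] by simp_all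

lemma slice_sub: "fp_sub V slice_sub" "tame T'' (submod V slice_sub)"
proof -
  have 1: "amb.subspace (slice_sub q)" for q
    unfolding slice_sub_def
    using subspace_linear_image[OF linear_between_restrict[OF PersD(4)[OF V le(1)] U_subset]] U_fin
    by (simp add: fin_dim_subspace_def)
  have 2: "slice_sub q \<subseteq> fib V q" for q
    unfolding slice_sub_def using U_subset[of q] PersD(7)[OF V le(1)] by blast
  have 3: "tmap V q r v \<in> slice_sub r" if qr: "q \<le> r" and "v \<in> slice_sub q" for q r v
  proof -
    obtain u where u: "u \<in> U q" "v = tmap V (\<sigma> q) q u" using \<open>v \<in> slice_sub q\<close> by (auto simp: slice_sub_def)
    then have uV: "u \<in> fib V (\<sigma> q)" using U_subset by blast
    have "tmap V (\<sigma> q) (\<sigma> r) u \<in> U r"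
      using u(1) slice_sub_nat(2)[OF qr uV] fp_subD(6)[OF S(1) mono(2)[OF qr]] PersD(7)[OF V mono(1)[OF qr] uV]
      by (simp add: U_def)
    then show ?thesis using slice_sub_nat(1)[OF qr uV] u(2) by (simp add: slice_sub_def)
  qed
  have 4: "v \<in> slice_sub q"
    if qr: "q \<le> r" "same_cell T'' q r" and v: "v \<in> fib V q" "tmap V q r v \<in> slice_sub r" for q r v
  proof -
    obtain u where u: "u \<in> fib V (\<sigma> q)" "v = tmap V (\<sigma> q) q u"
      using bij_q[of q] v(1) by (auto simp: bij_betw_def)
    obtain u' where u': "u' \<in> U r" "tmap V q r v = tmap V (\<sigma> r) r u'" using v(2) by (auto simp: slice_sub_def)
    have in': "tmap V (\<sigma> q) (\<sigma> r) u \<in> fib V (\<sigma> r)" by (rule PersD(7)[OF V mono(1)[OF qr(1)] u(1)])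
    have "tmap V (\<sigma> r) r u' = tmap V (\<sigma> r) r (tmap V (\<sigma> q) (\<sigma> r) u)"
      using slice_sub_nat(1)[OF qr(1) u(1)] u' u(2) by simp
    then have "u' = tmap V (\<sigma> q) (\<sigma> r) u"
      using bij_q[of r] u'(1) in' U_subset[of r] by (auto simp: bij_betw_def inj_on_def)
    then have "tmap V (\<rho> q) (\<rho> r) (tmap V (\<sigma> q) (\<rho> q) u) \<in> S (\<rho> r)"
      using u'(1) slice_sub_nat(2)[OF qr(1) u(1)] by (simp add: U_def)
    then have "tmap V (\<sigma> q) (\<rho> q) u \<in> S (\<rho> q)"
      using tame_sub_reflect[OF tame_mono[OF T(1) T'] S(2) _ mono(2)[OF qr(1)] cell'[OF qr] PersD(7)[OF V le(2) u(1)]] S(1)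
      by (simp add: fp_sub_def)
    then show ?thesis using u by (auto simp: slice_sub_def U_def)
  qed
  show "fp_sub V slice_sub"
    by (rule fp_subI(1)[OF V tame_mono[OF T(1) T''(1)] T''(2)], fact 1, fact 2, fact 3, fact 4)
  show "tame T'' (submod V slice_sub)"
    by (rule fp_subI(2)[OF V tame_mono[OF T(1) T''(1)] T''(2)], fact 1, fact 2, fact 3, fact 4)
qed

lemma dim_slice_sub: "dim_fun (submod V slice_sub) q = dim_fun (submod V S) (\<rho> q)"
proof -
  have inj: "inj_on (tmap V (\<sigma> q) q) (U q)" "inj_on (tmap V (\<sigma> q) (\<rho> q)) (U q)"
    using bij_q[of q] bij_\<rho>[of q] U_subset[of q] by (auto simp: bij_betw_def intro: inj_on_subset)
  have "amb.dim (slice_sub q) = amb.dim (U q)"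
    unfolding slice_sub_def
    by (rule dim_linear_image_inj[OF linear_between_restrict[OF PersD(4)[OF V le(1)] U_subset] U_fin inj(1)])
  moreover have "tmap V (\<sigma> q) (\<rho> q) ` U q = S (\<rho> q)"
  proof
    show "tmap V (\<sigma> q) (\<rho> q) ` U q \<subseteq> S (\<rho> q)" by (auto simp: U_def)
    show "S (\<rho> q) \<subseteq> tmap V (\<sigma> q) (\<rho> q) ` U q"
    proof
      fix w assume w: "w \<in> S (\<rho> q)"
      then have "w \<in> tmap V (\<sigma> q) (\<rho> q) ` fib V (\<sigma> q)"
        using bij_\<rho>[of q] fp_subD(5)[OF S(1)] by (simp add: bij_betw_def)
      then show "w \<in> tmap V (\<sigma> q) (\<rho> q) ` U q" using w by (auto simp: U_def)
    qed
  qed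
  then have "amb.dim (S (\<rho> q)) = amb.dim (U q)"
    using dim_linear_image_inj[OF linear_between_restrict[OF PersD(4)[OF V le(2)] U_subset] U_fin inj(2)] by simp
  ultimately show ?thesis by (simp add: dim_fun_def)
qed

end

section \<open>The energy as an integral\<close>

text \<open>
  A member of \<open>\<Z>(Q)\<close>, unfolded: densities \<open>b\<close> and \<open>a\<close> for the real and imaginary parts, and weights \<open>lam\<close>
  of the faces.
\<close>

locale integral_stability = grid_pair G G' + stability Z
  for G :: "('a::measured_coord, 'n::finite) grid" and G' and Z :: "('a ^ 'n, 'k::field) stab" +
  fixes a b :: "'a ^ 'n \<Rightarrow> real" and lam :: "('a ^ 'n) set \<Rightarrow> real"
  assumes a: "discretisable_fun G' a" and b: "discretisable_fun G' b"
    and null: "\<forall>x \<in> insert None (Some ` grid_dom G). \<not> bounded_set (cub G x) \<longrightarrow> (\<forall>q\<in>cub G x. a q = 0)"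
    and b_pos: "\<And>q. b q > 0" and b_int: "integrable (cube_measure UNIV) b"
    and lam_nonneg: "\<And>c. c \<in> grid_faces G \<Longrightarrow> lam c \<ge> 0"
    and charge_eq: "\<And>V. V \<in> Pers_fp \<Longrightarrow> Z (K_class V) =
      (LINT q|cube_measure UNIV. Complex (b q) (a q) * of_nat (dim_fun V q)) +
      \<i> * of_real (\<Sum>c\<in>grid_faces G. lam c * cube_average c (\<lambda>q. real (dim_fun V q)))"
begin

lemma dim_regular:
  fixes V :: "('a ^ 'n, 'k) pmod"
  assumes "V \<in> Pers_fp"
  shows "(\<lambda>q. real (dim_fun V q)) \<in> borel_measurable borel" "\<exists>B. \<forall>q. norm (real (dim_fun V q)) \<le> B"
proof -
  obtain T where "finite_grid T" "tame T V" "V \<in> Pers" using assms by (auto simp: Pers_fp_iff_tame)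
  then have "real (dim_fun V q) = real (dim_fun V r)" if "same_cell T q r" for q r
    using dim_fun_cell_const that by fastforce
  from cell_const_regular[OF \<open>finite_grid T\<close>, of "\<lambda>q. real (dim_fun V q)", OF this]
  show "(\<lambda>q. real (dim_fun V q)) \<in> borel_measurable borel" "\<exists>B. \<forall>q. norm (real (dim_fun V q)) \<le> B"
    by blast+
qed

lemma energy_eq:
  assumes V: "V \<in> Pers_fp"
  shows "energy Z \<theta> V = (\<integral>q. (a q - \<theta> * b q) * real (dim_fun V q) \<partial>cube_measure UNIV) +
    (\<Sum>c\<in>grid_faces G. lam c * cube_average c (\<lambda>q. real (dim_fun V q)))"
proof -
  let ?M = "cube_measure (UNIV :: ('a ^ 'n) set)" and ?h = "\<lambda>q. real (dim_fun V q)"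
  let ?s = "\<Sum>c\<in>grid_faces G. lam c * cube_average c ?h"
  have ia: "integrable ?M (\<lambda>q. a q * ?h q)"
    by (rule integrable_mult_bounded[OF integrable_density[OF a null] dim_regular[OF V]])
  have ib: "integrable ?M (\<lambda>q. b q * ?h q)"
    by (rule integrable_mult_bounded[OF b_int dim_regular[OF V]])
  have split: "Complex (b q) (a q) * of_nat (dim_fun V q) =
      complex_of_real (b q * ?h q) + \<i> * complex_of_real (a q * ?h q)" for q
    by (simp add: complex_eq_iff)
  have "(LINT q|?M. Complex (b q) (a q) * of_nat (dim_fun V q)) =
      complex_of_real (\<integral>q. b q * ?h q \<partial>?M) + \<i> * complex_of_real (\<integral>q. a q * ?h q \<partial>?M)"
  proof -
    have "integrable ?M (\<lambda>q. complex_of_real (b q * ?h q))" "integrable ?M (\<lambda>q. complex_of_real (a q * ?h q))"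
      by (rule integrable_of_real[OF ib], rule integrable_of_real[OF ia])
    then have "(LINT q|?M. Complex (b q) (a q) * of_nat (dim_fun V q)) =
      (LINT q|?M. complex_of_real (b q * ?h q)) + \<i> * (LINT q|?M. complex_of_real (a q * ?h q))"
      unfolding split by (subst Bochner_Integration.integral_add) simp_all
    then show ?thesis by (simp only: integral_of_real[OF ia] integral_of_real[OF ib])
  qed
  then have "energy Z \<theta> V = (\<integral>q. a q * ?h q \<partial>?M) - \<theta> * (\<integral>q. b q * ?h q \<partial>?M) + ?s"
    unfolding energy_def charge_eq[OF V] by simp
  also have "(\<integral>q. a q * ?h q \<partial>?M) - \<theta> * (\<integral>q. b q * ?h q \<partial>?M) = (\<integral>q. (a q - \<theta> * b q) * ?h q \<partial>?M)"
    using ia ib by (simp add: left_diff_distrib mult.assoc)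
  finally show ?thesis .
qed

lemma cube_average_eq:
  "\<exists>k\<ge>0. \<forall>f. cube_average c f = k * (\<integral>q. indicator c q * f q \<partial>cube_measure c)"
proof (intro exI conjI allI)
  show "1 / (LINT q:c|cube_measure c. 1) \<ge> (0 :: real)"
    unfolding set_lebesgue_integral_def by (intro divide_nonneg_nonneg integral_nonneg_AE) auto
  show "cube_average c f = 1 / (LINT q:c|cube_measure c. 1) * (\<integral>q. indicator c q * f q \<partial>cube_measure c)" for f
    by (simp add: cube_average_def set_lebesgue_integral_def)
qed


section \<open>Removing a threshold\<close>

text \<open>
  The heart of the existence proof. Let \<open>S\<close> be a subobject that jumps at a threshold \<open>t\<close> at which
  neither \<open>V\<close> nor the grid of \<open>Z\<close> does, and let \<open>I\<close> be the slab from the threshold before \<open>t\<close> to the one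
  after it, if any. Replace \<open>S\<close> throughout the slab by its slice at the lower end or by its slice at \<open>t\<close>. If the
  slab lies between thresholds of \<open>Z\<close>, the energy density does not depend on the coordinate \<open>i\<close> there, so
  up to the terms of faces perpendicular to \<open>i\<close> the energy of \<open>S\<close> is a convex combination of the two
  new energies; and those terms only grow, because they have nonnegative weights and the slices are at
  least as large as \<open>S\<close> at the lower end. Otherwise \<open>a\<close> vanishes on the slab and the density has the sign
  of \<open>- \<theta>\<close>.
\<close>

lemma remove_threshold:
  assumes V: "V \<in> Pers_fp" and T: "finite_grid T" "tame T V" "\<And>j. thresholds G j \<subseteq> T j"
    and T': "finite_grid T'" "\<And>j. T j \<subseteq> T' j" and S: "fp_sub V S" "tame T' (submod V S)"
    and t: "t \<in> T' i" "t \<notin> T i" and pred: "\<exists>s\<in>T' i. s < t"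
  shows "\<exists>S'. fp_sub V S' \<and> tame (T'(i := T' i - {t})) (submod V S') \<and>
    energy Z \<theta> (submod V S) \<le> energy Z \<theta> (submod V S')"
proof -
  define T'' where "T'' = T'(i := T' i - {t})"
  have P: "V \<in> Pers" using V by (rule Pers_fp_imp_Pers)
  have fin': "finite (T' j)" for j using T'(1) by (simp add: finite_grid_def)
  have T''_sub: "T j \<subseteq> T'' j" for j using T'(2)[of j] t(2) by (auto simp: T''_def)
  have fin'': "finite_grid T''" using T'(1) by (auto simp: T''_def finite_grid_def)
  define s where "s = Max {z \<in> T' i. z < t}"
  have "s \<in> {z \<in> T' i. z < t}" unfolding s_def using fin' pred by (intro Max_in) auto
  then have s: "s \<in> T' i" "s < t" by auto
  have s_max: "z \<le> s" if "z \<in> T' i" "z < t" for z unfolding s_def using fin' that by (intro Max_ge) auto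
  define I where "I = {y. s \<le> y \<and> (\<forall>z\<in>T' i. z \<le> y \<longrightarrow> z \<le> t)}"
  have sI: "s \<in> I" and tI: "t \<in> I" using s by (auto simp: I_def)
  have below: "z \<le> y \<longleftrightarrow> z \<le> s" if "y \<in> I" "z \<in> T' i" "z \<noteq> t" for y z
    using that s_max[of z] by (fastforce simp: I_def)
  have belowT: "z \<le> y \<longleftrightarrow> z \<le> s" if "y \<in> I" "z \<in> T i" for y z
    using below[OF that(1)] that(2) T'(2)[of i] t(2) by blast
  \<comment> \<open>\<open>\<rho> \<tau>\<close> moves the slab to the slice at \<open>\<tau>\<close>; only \<open>\<tau> = s\<close> and \<open>\<tau> = t\<close> occur.\<close>
  define \<rho> where "\<rho> \<tau> q = (if q $ i \<in> I then upd i q \<tau> else q)" for \<tau> q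
  have mono: "\<rho> \<tau> q \<le> \<rho> \<tau> r" if "\<tau> \<in> {s, t}" "q \<le> r" for \<tau> q r
  proof -
    have \<tau>: "s \<le> \<tau>" "\<tau> \<le> t" using that(1) s(2) by auto
    have le: "q $ j \<le> r $ j" for j using that(2) by (simp add: less_eq_vec_def)
    have 1: "\<tau> \<le> r $ i" if "q $ i \<in> I" "r $ i \<notin> I"
    proof -
      have "s \<le> r $ i" using le[of i] that(1) by (auto simp: I_def)
      then obtain z where "z \<in> T' i" "z \<le> r $ i" "\<not> z \<le> t" using \<open>r $ i \<notin> I\<close> by (auto simp: I_def)
      then show ?thesis using \<tau> by auto
    qed
    have 2: "q $ i \<le> \<tau>" if "q $ i \<notin> I" "r $ i \<in> I"
    proof -
      have "\<not> s \<le> q $ i" using that le[of i] by (auto simp: I_def)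
      then show ?thesis using \<tau> by auto
    qed
    show ?thesis using le 1 2 by (auto simp: \<rho>_def less_eq_vec_def upd_nth)
  qed
  have lo_le: "\<rho> s q \<le> q" "\<rho> s q \<le> \<rho> \<tau> q" if "\<tau> \<in> {s, t}" for q \<tau>
    using s(2) that by (auto simp: \<rho>_def less_eq_vec_def upd_nth I_def)
  have cell: "same_cell T (\<rho> s q) q" "same_cell T (\<rho> s q) (\<rho> \<tau> q)" if "\<tau> \<in> {s, t}" for q \<tau>
  proof -
    have upd: "same_cell T (upd i q s) (upd i q y)" if "y \<in> I" for y
      unfolding same_cell_def
    proof (intro allI ballI)
      fix j z assume z: "z \<in> T j"
      show "z \<le> upd i q s $ j \<longleftrightarrow> z \<le> upd i q y $ j"
      proof (cases "j = i")
        case True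
        then show ?thesis using belowT[OF that, of z] z by (simp add: upd_nth)
      qed (simp add: upd_nth)
    qed
    show "same_cell T (\<rho> s q) q"
      using upd[of "q $ i"] by (simp add: \<rho>_def same_cell_refl)
    have "\<tau> \<in> I" using that sI tI by auto
    then show "same_cell T (\<rho> s q) (\<rho> \<tau> q)"
      using upd[of \<tau>] by (simp add: \<rho>_def same_cell_refl)
  qed
  have I_alt: "y \<in> I \<longleftrightarrow> s \<le> y \<and> (\<forall>z\<in>T'' i. z \<le> y \<longrightarrow> z \<le> t)" for y
    by (auto simp: I_def T''_def)
  have sT'': "s \<in> T'' i" using s by (simp add: T''_def)
  have cell': "same_cell T' (\<rho> \<tau> q) (\<rho> \<tau> r)" if qr: "same_cell T'' q r" for \<tau> q r
  proof -
    have pat: "z \<le> q $ j \<longleftrightarrow> z \<le> r $ j" if "z \<in> T'' j" for j z using qr that by (simp add: same_cell_def)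
    \<comment> \<open>Membership in the slab is visible after the removal of \<open>t\<close>, and outside the slab \<open>t\<close> and \<open>s\<close> are passed together.\<close>
    have I_iff: "q $ i \<in> I \<longleftrightarrow> r $ i \<in> I" unfolding I_alt using pat sT'' by blast
    have t_iff: "t \<le> y \<longleftrightarrow> s \<le> y" if "y \<notin> I" for y
      using that s(2) by (auto simp: I_def)
    have "z \<le> \<rho> \<tau> q $ j \<longleftrightarrow> z \<le> \<rho> \<tau> r $ j" if z: "z \<in> T' j" for j z
    proof (cases "j = i")
      case True
      show ?thesis
      proof (cases "q $ i \<in> I")
        case False
        have "t \<le> q $ i \<longleftrightarrow> t \<le> r $ i" using t_iff False I_iff pat[OF sT''] by simp
        then show ?thesis using True False I_iff z pat[of z i] by (cases "z = t") (simp_all add: \<rho>_def T''_def)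
      qed (use True I_iff in \<open>simp add: \<rho>_def upd_nth\<close>)
    next
      case False
      then show ?thesis using pat[of z j] z I_iff by (simp add: \<rho>_def upd_nth T''_def)
    qed
    then show ?thesis by (simp add: same_cell_def)
  qed
  have slice: "slice V T T' T'' S (\<rho> s) (\<rho> \<tau>)" if "\<tau> \<in> {s, t}" for \<tau>
  proof
    show "V \<in> Pers" "tame T V" "finite_grid T" "fp_sub V S" "tame T' (submod V S)" "finite_grid T''"
      by (fact P T S fin'')+
    show "T j \<subseteq> T' j" "T j \<subseteq> T'' j" for j by (fact T'(2) T''_sub)+
    show "\<rho> s q \<le> q" "\<rho> s q \<le> \<rho> \<tau> q" for q by (fact lo_le[OF that])+
    show "same_cell T (\<rho> s q) q" "same_cell T (\<rho> s q) (\<rho> \<tau> q)" for q by (fact cell[OF that])+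
    show "\<rho> s q \<le> \<rho> s r" if "q \<le> r" for q r by (rule mono[OF _ that]) simp
    show "\<rho> \<tau> q \<le> \<rho> \<tau> r" if "q \<le> r" for q r by (rule mono[OF \<open>\<tau> \<in> {s, t}\<close> that])
    show "same_cell T' (\<rho> \<tau> q) (\<rho> \<tau> r)" if "same_cell T'' q r" for q r by (rule cell'[OF that])
  qed
  interpret lo: slice V T T' T'' S "\<rho> s" "\<rho> s" by (rule slice) simp
  interpret hi: slice V T T' T'' S "\<rho> s" "\<rho> t" by (rule slice) simp
  define h where "h q = real (dim_fun (submod V S) q)" for q
  define hl where "hl q = real (dim_fun (submod V lo.slice_sub) q)" for q
  define hh where "hh q = real (dim_fun (submod V hi.slice_sub) q)" for q
  have hl: "hl q = h (\<rho> s q)" and hh: "hh q = h (\<rho> t q)" for q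
    by (simp_all add: h_def hl_def hh_def lo.dim_slice_sub hi.dim_slice_sub)
  have h_cell: "h q = h r" if "same_cell T' q r" for q r
    unfolding h_def using dim_fun_cell_const[OF fp_subD(2)[OF S(1)] T'(1) S(2) that] by simp
  interpret slab i I s t h hl hh
  proof
    show "s \<in> I" by (rule sI)
    show "h \<in> borel_measurable borel" "\<exists>B. \<forall>q. norm (h q) \<le> B"
      unfolding h_def[abs_def] by (rule dim_regular[OF fp_subD(1)[OF S(1)]])+
    show "hl \<in> borel_measurable borel" "\<exists>B. \<forall>q. norm (hl q) \<le> B"
      unfolding hl_def[abs_def] by (rule dim_regular[OF fp_subD(1)[OF lo.slice_sub(1)]])+
    show "hh \<in> borel_measurable borel" "\<exists>B. \<forall>q. norm (hh q) \<le> B"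
      unfolding hh_def[abs_def] by (rule dim_regular[OF fp_subD(1)[OF hi.slice_sub(1)]])+
    show "h q = hl q" if "q $ i \<notin> I \<or> \<not> t \<le> q $ i" for q
    proof (cases "q $ i \<in> I")
      case True
      then have "same_cell T' q (upd i q s)"
        using below[OF True] that s(2) by (auto simp: same_cell_def upd_nth)
      then show ?thesis using h_cell True by (simp add: hl \<rho>_def)
    qed (simp add: hl \<rho>_def)
    show "h q = hh q" if "q $ i \<in> I" "t \<le> q $ i" for q
    proof -
      have "same_cell T' q (upd i q t)"
        using that by (auto simp: same_cell_def upd_nth I_def)
      then show ?thesis using h_cell that by (simp add: hh \<rho>_def)
    qed
    show "hl q = hh q" if "q $ i \<notin> I" for q using that by (simp add: hl hh \<rho>_def)
    show "hl q \<le> hh q" for q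
    proof -
      let ?f = "tmap V (\<rho> s q) (\<rho> t q)"
      have le: "\<rho> s q \<le> \<rho> t q" using lo_le(2)[of t q] by simp
      have inj: "inj_on ?f (S (\<rho> s q))"
        using tame_bij[OF T(2) le] cell(2)[of t q] fp_sub_subset[OF S(1)]
        by (auto simp: bij_betw_def intro: inj_on_subset)
      have fd: "fin_dim_subspace (S x)" for x using PersD(1)[OF fp_subD(2)[OF S(1)], of x] by simp
      have "amb.dim (S (\<rho> s q)) = amb.dim (?f ` S (\<rho> s q))"
        using dim_linear_image_inj[OF linear_between_restrict[OF PersD(4)[OF P le] fp_sub_subset[OF S(1)]] fd inj] by simp
      also have "\<dots> \<le> amb.dim (S (\<rho> t q))"
        using fp_subD(6)[OF S(1) le] by (intro dim_mono_fin_dim[OF fd]) auto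
      finally show ?thesis by (simp add: hl hh h_def dim_fun_def)
    qed
    show "hl (upd i q y) = hl (upd i q s)" "hh (upd i q y) = hh (upd i q s)" if "y \<in> I" for q y
      using that sI by (simp_all add: hl hh \<rho>_def upd_nth)
  qed
  define F where "F q = a q - \<theta> * b q" for q
  define N where "N k = (\<Sum>c\<in>grid_faces G. lam c * cube_average c k)" for k
  have F_int: "integrable (cube_measure UNIV) F"
    unfolding F_def[abs_def] using integrable_density[OF a null] b_int by simp
  have E: "energy Z \<theta> (submod V S) = (\<integral>q. F q * h q \<partial>cube_measure UNIV) + N h"
    "energy Z \<theta> (submod V lo.slice_sub) = (\<integral>q. F q * hl q \<partial>cube_measure UNIV) + N hl"
    "energy Z \<theta> (submod V hi.slice_sub) = (\<integral>q. F q * hh q \<partial>cube_measure UNIV) + N hh"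
    using energy_eq[OF fp_subD(1)[OF S(1)]] energy_eq[OF fp_subD(1)[OF lo.slice_sub(1)]]
      energy_eq[OF fp_subD(1)[OF hi.slice_sub(1)]]
    unfolding F_def N_def h_def hl_def hh_def by blast+
  \<comment> \<open>Above its lower end the slab contains no threshold of \<open>Z\<close>, so it lies inside the grid of \<open>Z\<close> or outside it as a whole.\<close>
  have G_pat: "z \<le> y \<longleftrightarrow> z \<le> s" if "y \<in> I" "z \<in> thresholds G i" for y z
    using belowT that T(3) by blast
  have inside_I: "inside i y \<longleftrightarrow> inside i t" if "y \<in> I" for y
    unfolding inside_def using G_pat[OF that] G_pat[OF tI] by (meson not_le)
  have avoid: "\<not> (q $ i \<in> I \<and> t \<le> q $ i)" if "q $ i \<in> thresholds G i" for q
    using G_pat[of "q $ i" "q $ i"] that s(2) by auto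
  have faces: "cube_average c hl \<le> cube_average c h \<and> cube_average c h \<le> cube_average c hh \<and>
     ((\<forall>q\<in>c. \<not> (q $ i \<in> I \<and> t \<le> q $ i)) \<longrightarrow> cube_average c h = cube_average c hl)"
    if c: "c \<in> grid_faces G" for c
  proof -
    obtain J \<alpha> \<beta> where J: "face_shape c J \<alpha> \<beta>" using grid_faces_shape[OF c] by blast
    obtain k where k: "k \<ge> 0" "\<And>f. cube_average c f = k * (\<integral>q. indicator c q * f q \<partial>cube_measure c)"
      using cube_average_eq[of c] by blast
    have "cube_average c h = cube_average c hl" if "\<forall>q\<in>c. \<not> (q $ i \<in> I \<and> t \<le> q $ i)"
      using integral_avoiding[of "indicator c" "cube_measure c"] that unfolding k(2) by (auto simp: indicator_def)
    then show ?thesis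
      using integral_between[OF integrable_face[OF J]] k(1) unfolding k(2) by (auto intro!: mult_left_mono)
  qed
  show ?thesis
  proof (cases "inside i t")
    case True
    \<comment> \<open>Slab inside the grid of \<open>Z\<close>: it ends at the threshold \<open>u\<close>, and \<open>p\<close> is the share of its part from \<open>t\<close> on.\<close>
    define u where "u = Min {z \<in> T' i. t < z}"
    have "{z \<in> T' i. t < z} \<noteq> {}" using True T(3)[of i] T'(2)[of i] by (auto simp: inside_def)
    then have "u \<in> {z \<in> T' i. t < z}" unfolding u_def using fin' by (intro Min_in) auto
    then have u: "u \<in> T' i" "t < u" by auto
    have u_min: "u \<le> z" if "z \<in> T' i" "t < z" for z unfolding u_def using fin' that by (intro Min_le) auto
    have I_Ico: "I = {s..<u}"
      using u u_min by (force simp: I_def not_le intro: order_less_le_trans order_le_less_trans)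
    define p where "p = measure coord_measure {t..<u} / measure (coord_measure :: 'a measure) {s..<u}"
    have fm: "{s..<u} \<in> fmeasurable (coord_measure :: 'a measure)" 
      using coord_measure_Ico_finite[of s u] by (intro fmeasurableI) (simp_all add: sets_coord_measure Ico_borel)
    have "measure (coord_measure :: 'a measure) {t..<u} \<le> measure coord_measure {s..<u}"
      using s(2) by (intro measure_mono_fmeasurable[OF _ _ fm]) (auto simp: sets_coord_measure Ico_borel)
    then have p: "0 \<le> p" "p \<le> 1" by (auto simp: p_def divide_le_eq_1 zero_less_measure_iff)
    have F_const: "F (upd i q y) = F (upd i q s)" if "y \<in> I" for q y
    proof -
      have *: "inside i y" "\<And>z. z \<in> thresholds G i \<Longrightarrow> z \<le> y \<longleftrightarrow> z \<le> s"
        using inside_I[OF that] True G_pat[OF that] by auto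
      have "a (upd i q y) = a (upd i q s)" "b (upd i q y) = b (upd i q s)"
        using * by (auto intro!: discretisable_cong[OF a] discretisable_cong[OF b] simp: upd_nth)
      then show ?thesis by (simp add: F_def)
    qed
    have "(\<integral>q. F q * h q \<partial>cube_measure UNIV) - (\<integral>q. F q * hl q \<partial>cube_measure UNIV) =
      p * ((\<integral>q. F q * hh q \<partial>cube_measure UNIV) - (\<integral>q. F q * hl q \<partial>cube_measure UNIV))"
      unfolding p_def by (rule integral_uniform[OF F_int _ F_const I_Ico s(2) u(2)]) (simp_all add: cube_dirs_UNIV)
    moreover have "N h - N hl \<le> p * (N hh - N hl)"
    proof -
      have "lam c * cube_average c h - lam c * cube_average c hl \<le>
          p * (lam c * cube_average c hh - lam c * cube_average c hl)" if c: "c \<in> grid_faces G" for c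
      proof -
        obtain J \<alpha> \<beta> where J: "face_shape c J \<alpha> \<beta>" using grid_faces_shape[OF c] by blast
        obtain k where k: "k \<ge> 0" "\<And>f. cube_average c f = k * (\<integral>q. indicator c q * f q \<partial>cube_measure c)"
          using cube_average_eq[of c] by blast
        have ab: "\<alpha> i \<in> thresholds G i" "\<beta> i \<in> thresholds G i" using J by (auto simp: face_shape_def)
        have "cube_average c h - cube_average c hl \<le> p * (cube_average c hh - cube_average c hl)"
        proof (cases "J i = {\<alpha> i..<\<beta> i}")
          case True
          have c_const: "indicator c (upd i q y) = (indicator c (upd i q s) :: real)" if "y \<in> I" for q y
          proof -
            have "y \<in> J i \<longleftrightarrow> s \<in> J i" using G_pat[OF that ab(1)] G_pat[OF that ab(2)] True by auto
            then have "upd i q y \<in> c \<longleftrightarrow> upd i q s \<in> c"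
              using J by (auto simp: face_shape_def box_of_def upd_nth split: if_splits)
            then show ?thesis by (simp add: indicator_def)
          qed
          have "(\<integral>q. indicator c q * h q \<partial>cube_measure c) - (\<integral>q. indicator c q * hl q \<partial>cube_measure c) =
            p * ((\<integral>q. indicator c q * hh q \<partial>cube_measure c) - (\<integral>q. indicator c q * hl q \<partial>cube_measure c))"
            unfolding p_def
            by (rule integral_uniform[OF integrable_face[OF J] face_dirs[OF J True] c_const I_Ico s(2) u(2)])
          then show ?thesis unfolding k(2) by (simp flip: right_diff_distrib)
        next
          case False
          then have "J i = {\<alpha> i} \<or> J i = {\<beta> i}" using J by (auto simp: face_shape_def)
          then have "J i \<subseteq> thresholds G i" using ab by auto
          then have "q $ i \<in> thresholds G i" if "q \<in> c" for q
            using that J by (auto simp: face_shape_def box_of_def)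
          then have "cube_average c h = cube_average c hl" using faces[OF c] avoid by blast
          moreover have "0 \<le> p * (cube_average c hh - cube_average c hl)"
            using faces[OF c] p(1) by (intro mult_nonneg_nonneg) auto
          ultimately show ?thesis by simp
        qed
        from mult_left_mono[OF this lam_nonneg[OF c]] show ?thesis by (simp add: algebra_simps)
      qed
      then show ?thesis
        unfolding N_def sum_subtractf[symmetric] sum_distrib_left by (intro sum_mono)
    qed
    ultimately have conv: "energy Z \<theta> (submod V S) - energy Z \<theta> (submod V lo.slice_sub) \<le>
        p * (energy Z \<theta> (submod V hi.slice_sub) - energy Z \<theta> (submod V lo.slice_sub))"
      unfolding E by (simp add: algebra_simps)
    show ?thesis
    proof (cases "energy Z \<theta> (submod V hi.slice_sub) \<le> energy Z \<theta> (submod V lo.slice_sub)")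
      case True
      then have "p * (energy Z \<theta> (submod V hi.slice_sub) - energy Z \<theta> (submod V lo.slice_sub)) \<le> 0"
        using p(1) by (intro mult_nonneg_nonpos) auto
      then show ?thesis using conv lo.slice_sub unfolding T''_def by force
    next
      case False
      then have "p * (energy Z \<theta> (submod V hi.slice_sub) - energy Z \<theta> (submod V lo.slice_sub)) \<le>
          1 * (energy Z \<theta> (submod V hi.slice_sub) - energy Z \<theta> (submod V lo.slice_sub))"
        using p(2) by (intro mult_right_mono) auto
      then show ?thesis using conv hi.slice_sub unfolding T''_def by force
    qed
  next
    case False
    \<comment> \<open>Slab outside the grid of \<open>Z\<close>: the density is \<open>- \<theta> * b\<close>, and faces meet the slab at most in its lower end.\<close>
    have out: "\<not> inside i (q $ i)" if "q $ i \<in> I" for q using inside_I[OF that] False by simp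
    have F_I: "F q = - \<theta> * b q" if "q $ i \<in> I" for q
      using null_outside[OF a null out[OF that]] by (simp add: F_def)
    have face_avoid: "\<not> (q $ i \<in> I \<and> t \<le> q $ i)" if c: "c \<in> grid_faces G" and q: "q \<in> c" for c q
    proof -
      obtain J \<alpha> \<beta> where J: "face_shape c J \<alpha> \<beta>" using grid_faces_shape[OF c] by blast
      then have ab: "\<alpha> i \<in> thresholds G i" "\<beta> i \<in> thresholds G i" and qJ: "q $ i \<in> J i"
        and shape: "J i = {\<alpha> i..<\<beta> i} \<or> J i = {\<alpha> i} \<or> J i = {\<beta> i}"
        using q by (auto simp: face_shape_def box_of_def)
      show ?thesis
      proof (cases "J i = {\<alpha> i..<\<beta> i}")
        case True
        then have "inside i (q $ i)" using qJ ab by (auto simp: inside_def)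
        then show ?thesis using out by blast
      next
        case False
        with shape have "J i = {\<alpha> i} \<or> J i = {\<beta> i}" by blast
        then have "J i \<subseteq> thresholds G i" using ab by (elim disjE) simp_all
        then have "q $ i \<in> thresholds G i" using qJ by (rule subsetD)
        then show ?thesis by (rule avoid)
      qed
    qed
    have "cube_average c h = cube_average c hl" if c: "c \<in> grid_faces G" for c
      using faces[OF c] face_avoid[OF c] by blast
    then have N_lo: "N h = N hl" unfolding N_def by simp
    have "lam c * cube_average c h \<le> lam c * cube_average c hh" if c: "c \<in> grid_faces G" for c
      using faces[OF c] lam_nonneg[OF c] by (intro mult_left_mono) auto
    then have N_hi: "N h \<le> N hh" unfolding N_def by (rule sum_mono)
    show ?thesis
    proof (cases "\<theta> \<ge> 0")
      case True
      have "(\<integral>q. - F q * hl q \<partial>cube_measure UNIV) \<le> (\<integral>q. - F q * h q \<partial>cube_measure UNIV)"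
        using F_int F_I True b_pos by (intro integral_between(1)) (auto simp: less_imp_le)
      then have "energy Z \<theta> (submod V S) \<le> energy Z \<theta> (submod V lo.slice_sub)" unfolding E N_lo by simp
      then show ?thesis using lo.slice_sub unfolding T''_def by blast
    next
      case False
      have "(\<integral>q. F q * h q \<partial>cube_measure UNIV) \<le> (\<integral>q. F q * hh q \<partial>cube_measure UNIV)"
        using F_int F_I False b_pos by (intro integral_between(2)) (auto simp: less_imp_le mult_nonpos_nonneg)
      then have "energy Z \<theta> (submod V S) \<le> energy Z \<theta> (submod V hi.slice_sub)" unfolding E using N_hi by simp
      then show ?thesis using hi.slice_sub unfolding T''_def by blast
    qed
  qed
qed

end

section \<open>Domination by subobjects that are tame for a fixed grid\<close>

text \<open>
  A threshold preceding all thresholds of \<open>V\<close> in its direction is superfluous for \<open>S\<close> as well: until the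
  next threshold the ambient module is zero.
\<close>

lemma remove_first_threshold:
  fixes V :: "('a::linorder ^ 'n::finite, 'k::field) pmod"
  assumes T: "tame T V" "\<And>j. T j \<subseteq> T' j" and S: "fp_sub V S" "tame T' (submod V S)"
    and t: "t \<notin> T i" "\<And>s. s \<in> T' i \<Longrightarrow> t \<le> s"
  shows "tame (T'(i := T' i - {t})) (submod V S)"
proof -
  define T'' where "T'' = T'(i := T' i - {t})"
  have sub: "T j \<subseteq> T'' j" for j using T(2)[of j] t(1) by (auto simp: T''_def)
  have zero: "S q = {0}" if "fib V q = {0}" for q
    using fp_subD(4)[OF S(1), of q] fp_sub_subset[OF S(1), of q] that by blast
  have "tame T'' (submod V S)"
    unfolding tame_def
  proof (intro conjI allI impI)
    fix q r assume qr: "q \<le> r" "same_cell T'' q r"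
    show "bij_betw (tmap (submod V S) q r) (fib (submod V S) q) (fib (submod V S) r)"
    proof (cases "t \<le> q $ i \<longleftrightarrow> t \<le> r $ i")
      case True
      have "same_cell T' q r"
        unfolding same_cell_def
      proof (intro allI ballI)
        fix j z assume z: "z \<in> T' j"
        show "z \<le> q $ j \<longleftrightarrow> z \<le> r $ j"
        proof (cases "j = i \<and> z = t")
          case False
          then have "z \<in> T'' j" using z by (auto simp: T''_def)
          then show ?thesis using qr(2) by (simp add: same_cell_def)
        qed (use True in simp)
      qed
      then show ?thesis by (rule tame_bij[OF S(2) qr(1)])
    next
      case False
      then have q: "\<not> t \<le> q $ i" using qr(1) by (auto simp: less_eq_vec_def intro: order_trans)
      have "\<not> s \<le> q $ i" if "s \<in> T i" for s
      proof
        assume "s \<le> q $ i"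
        moreover have "t \<le> s" using t(2) T(2)[of i] that by blast
        ultimately show False using q by simp
      qed
      then have nq: "\<not> above_grid T q" by (auto simp: above_grid_def)
      then have "\<not> above_grid T r" using above_grid_cong[OF same_cell_mono[OF sub qr(2)]] by simp
      then have "S q = {0}" "S r = {0}" using zero tame_zero[OF T(1)] nq by blast+
      then show ?thesis
        using PersD(8)[OF fp_subD(2)[OF S(1)] qr(1)] by (simp add: bij_betw_def)
    qed
  next
    fix q assume "\<not> above_grid T'' q"
    then have "\<not> above_grid T q" using sub by (meson above_grid_def subsetD)
    then show "fib (submod V S) q = {0}" using zero tame_zero[OF T(1)] by simp
  qed
  then show ?thesis by (simp add: T''_def)
qed

text \<open>
  A tame dimension function is determined by its values at the finitely many grid points, where it is
  bounded by that of \<open>V\<close>.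
\<close>

lemma finite_tame_dims:
  fixes V :: "('a::linorder ^ 'n::finite, 'k::field) pmod"
  assumes T: "finite_grid T" and V: "V \<in> Pers"
  shows "finite {dim_fun (submod V S) | S. fp_sub V S \<and> tame T (submod V S)}"
proof -
  define A where "A = {p. \<forall>i. p $ i \<in> T i}"
  have "finite {vec_nth p | p. p \<in> A}"
    by (rule finite_subset[of _ "PiE UNIV T"]) (use T in \<open>auto simp: A_def finite_grid_def intro!: finite_PiE\<close>)
  then have "finite (vec_lambda ` {vec_nth p | p. p \<in> A})" by (rule finite_imageI)
  moreover have "A \<subseteq> vec_lambda ` {vec_nth p | p. p \<in> A}" by (force simp: image_iff)
  ultimately have A: "finite A" using finite_subset by blast
  define ext where "ext d q = (if above_grid T q then d (cell_floor T q) else 0)" for d :: "'a ^ 'n \<Rightarrow> nat" and q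
  have "{dim_fun (submod V S) | S. fp_sub V S \<and> tame T (submod V S)} \<subseteq> ext ` (PiE A (\<lambda>p. {..dim_fun V p}))"
  proof
    fix d assume "d \<in> {dim_fun (submod V S) | S. fp_sub V S \<and> tame T (submod V S)}"
    then obtain S where S: "d = dim_fun (submod V S)" "fp_sub V S" "tame T (submod V S)" by blast
    have "ext (restrict d A) q = d q" for q
    proof (cases "above_grid T q")
      case True
      have "cell_floor T q \<in> A" using cell_floor_in[OF T True] by (simp add: A_def)
      moreover have "d (cell_floor T q) = d q"
        unfolding S(1) by (rule dim_fun_cell_const[OF fp_subD(2)[OF S(2)] T S(3) same_cell_floor[OF T True]])
      ultimately show ?thesis using True by (simp add: ext_def)
    next
      case False
      then show ?thesis using tame_zero[OF S(3) False] by (simp add: ext_def S(1) dim_fun_def dim_zero_space)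
    qed
    then have "d = ext (restrict d A)" by (simp add: fun_eq_iff)
    moreover have "restrict d A \<in> PiE A (\<lambda>p. {..dim_fun V p})"
      using dim_mono_fin_dim[OF PersD(1)[OF V] fp_sub_subset[OF S(2)]] by (simp add: S(1) dim_fun_def)
    ultimately show "d \<in> ext ` (PiE A (\<lambda>p. {..dim_fun V p}))" by blast
  qed
  moreover have "finite (PiE A (\<lambda>p. {..dim_fun V p}))" using A by (intro finite_PiE) auto
  ultimately show ?thesis using finite_subset by blast
qed

context integral_stability
begin

text \<open>
  Induction on the number of thresholds of \<open>A\<close> that do not belong to \<open>T\<close>.
\<close>

lemma tame_domination:
  assumes V: "V \<in> Pers_fp" and T: "finite_grid T" "tame T V" "\<And>j. thresholds G j \<subseteq> T j" and A: "fp_sub V A"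
  shows "\<exists>S. fp_sub V S \<and> tame T (submod V S) \<and> energy Z \<theta> (submod V A) \<le> energy Z \<theta> (submod V S)"
proof -
  have "\<exists>S. fp_sub V S \<and> tame T (submod V S) \<and> energy Z \<theta> (submod V A) \<le> energy Z \<theta> (submod V S)"
    if "finite_grid T'" "\<And>j. T j \<subseteq> T' j" "fp_sub V A" "tame T' (submod V A)" for T' A
    using that
  proof (induction "card (SIGMA j:UNIV. T' j - T j)" arbitrary: T' A rule: less_induct)
    case less
    show ?case
    proof (cases "\<forall>j. T' j \<subseteq> T j")
      case True
      then have "T' = T" using less.prems(2) by (auto simp: fun_eq_iff)
      then show ?thesis using less.prems by blast
    next
      case False
      then obtain i t where t: "t \<in> T' i" "t \<notin> T i" by blast
      define T'' where "T'' = T'(i := T' i - {t})"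
      have fin: "finite_grid T''" using less.prems(1) by (simp add: T''_def finite_grid_def)
      have sub: "T j \<subseteq> T'' j" for j using less.prems(2)[of j] t(2) by (auto simp: T''_def)
      have "finite (SIGMA j:UNIV. T' j - T j)" using less.prems(1) by (auto simp: finite_grid_def)
      moreover have "(SIGMA j:UNIV. T'' j - T j) \<subset> (SIGMA j:UNIV. T' j - T j)"
      proof
        show "(SIGMA j:UNIV. T'' j - T j) \<subseteq> (SIGMA j:UNIV. T' j - T j)"
          by (auto simp: T''_def split: if_splits)
        have "(i, t) \<in> (SIGMA j:UNIV. T' j - T j)" "(i, t) \<notin> (SIGMA j:UNIV. T'' j - T j)"
          using t by (simp_all add: T''_def)
        then show "(SIGMA j:UNIV. T'' j - T j) \<noteq> (SIGMA j:UNIV. T' j - T j)" by blast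
      qed
      ultimately have card: "card (SIGMA j:UNIV. T'' j - T j) < card (SIGMA j:UNIV. T' j - T j)"
        by (rule psubset_card_mono)
      have "\<exists>S'. fp_sub V S' \<and> tame T'' (submod V S') \<and> energy Z \<theta> (submod V A) \<le> energy Z \<theta> (submod V S')"
      proof (cases "\<exists>s\<in>T' i. s < t")
        case True
        then show ?thesis
          unfolding T''_def by (rule remove_threshold[OF V T less.prems t])
      next
        case False
        have "tame T'' (submod V A)"
          unfolding T''_def
          by (rule remove_first_threshold[OF T(2) less.prems(2-4) t(2)]) (use False in force)
        then show ?thesis using less.prems(3) by blast
      qed
      then obtain S' where S': "fp_sub V S'" "tame T'' (submod V S')"
        "energy Z \<theta> (submod V A) \<le> energy Z \<theta> (submod V S')" by blast
      obtain S where "fp_sub V S" "tame T (submod V S)" "energy Z \<theta> (submod V S') \<le> energy Z \<theta> (submod V S)"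
        using less.hyps[OF card fin sub S'(1,2)] by blast
      then show ?thesis using S'(3) order_trans by blast
    qed
  qed
  moreover obtain T1 where T1: "finite_grid T1" "tame T1 (submod V A)" using fp_sub_tame[OF A] by blast
  ultimately show ?thesis
    using A finite_grid_Un[OF T(1) T1(1)] tame_Un(2)[OF T1(2), of T] by blast
qed

lemma HN_filtration_exists:
  assumes V: "V \<in> Pers_fp"
  shows "\<exists>l F C. HN_filtration Z V l F C"
proof -
  obtain T0 where T0: "finite_grid T0" "tame T0 V" and P: "V \<in> Pers" using V by (auto simp: Pers_fp_iff_tame)
  define T where "T i = T0 i \<union> thresholds G i" for i
  have T: "finite_grid T" "tame T V" "thresholds G j \<subseteq> T j" for j
    using finite_grid_Un[OF T0(1) finite_thresholds] tame_Un(1)[OF T0(2), of "thresholds G"]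
    by (simp_all add: T_def[abs_def])
  define L where "L = {S. fp_sub V S \<and> tame T (submod V S)}"
  have "dominated Z V L"
  proof
    show "V \<in> Pers_fp" by (rule V)
    show "fp_sub V S" if "S \<in> L" for S using that by (simp add: L_def)
    show "(\<lambda>_. {0}) \<in> L" using tame_sub_zero[OF P T(2,1)] by (simp add: L_def)
    show "fib V \<in> L" using fp_sub_fib[OF V] T by (simp add: L_def)
    show "\<exists>S\<in>L. energy Z \<theta> (submod V A) \<le> energy Z \<theta> (submod V S)" if "fp_sub V A" for A \<theta>
      using tame_domination[OF V T that] by (auto simp: L_def)
    define \<phi> where "\<phi> d = (LINT q|cube_measure UNIV. Complex (b q) (a q) * of_nat (d q)) +
      \<i> * of_real (\<Sum>c\<in>grid_faces G. lam c * cube_average c (\<lambda>q. real (d q)))" for d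
    have "(\<lambda>S. Z (K_class (submod V S))) ` L \<subseteq> \<phi> ` {dim_fun (submod V S) | S. fp_sub V S \<and> tame T (submod V S)}"
      using charge_eq fp_subD(1) by (fastforce simp: L_def \<phi>_def)
    then show "finite ((\<lambda>S. Z (K_class (submod V S))) ` L)"
      using finite_tame_dims[OF T(1) P] finite_surj by blast
  qed
  then show ?thesis by (rule dominated.HN_filtration_exists)
qed

end

lemma Z_all_integral_stability:
  fixes Z :: "('a::measured_coord ^ 'n::finite, 'k::field) stab"
  assumes "Z \<in> Z_all"
  obtains G G' a b lam where "integral_stability G G' Z a b lam"
proof -
  obtain G where G: "finite_grid_function G" "Z \<in> Z_grid G" using assms by (auto simp: Z_all_def)
  then obtain Z0 lam where Z: "stability_condition Z" and Z0: "Z0 \<in> Z_step G"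
    and lam: "\<And>c. c \<in> grid_faces G \<Longrightarrow> lam c \<ge> 0"
    and eq: "\<And>V. V \<in> Pers_fp \<Longrightarrow> Z (K_class V) = Z0 (K_class V) +
           \<i> * of_real (\<Sum>c\<in>grid_faces G. lam c * cube_average c (\<lambda>q. real (dim_fun V q)))"
    unfolding Z_grid_def by blast
  obtain a b G' where "grid_extension G G'" "discretisable_fun G' a" "discretisable_fun G' b"
    "\<forall>x \<in> insert None (Some ` grid_dom G). \<not> bounded_set (cub G x) \<longrightarrow> (\<forall>q\<in>cub G x. a q = 0)"
    "\<forall>q. b q > 0" "integrable (cube_measure UNIV) b"
    "\<forall>V\<in>Pers_fp. Z0 (K_class V) = (LINT q|cube_measure UNIV. Complex (b q) (a q) * of_nat (dim_fun V q))"
    using Z0 unfolding Z_step_def by blast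
  then have "integral_stability G G' Z a b lam"
    using G(1) Z lam eq by unfold_locales auto
  then show ?thesis by (rule that)
qed

section \<open>The Harder-Narasimhan filtered rank invariant\<close>

locale HN_stability = stability Z for Z :: "('a::measured_coord ^ 'n::finite, 'k::field) stab" +
  assumes HN: "\<And>V. V \<in> Pers_fp \<Longrightarrow> \<exists>l F C. HN_filtration Z V l F C"
begin

lemma largest_max_HN_sub: "V \<in> Pers_fp \<Longrightarrow> largest_max \<theta> V (HN_sub Z V \<theta>)"
  using HN_sub_largest_max HN by blast

lemma HN_sub_hom:
  assumes "V \<in> Pers_fp" "W \<in> Pers_fp" "pers_hom V W h"
  shows "h q ` HN_sub Z V \<theta> q \<subseteq> HN_sub Z W \<theta> q"
  by (rule largest_max_hom[OF assms largest_max_HN_sub[OF assms(1)] largest_max_HN_sub[OF assms(2)]])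

definition HN_fibre :: "real \<Rightarrow> ('a ^ 'n, 'k) pmod \<Rightarrow> 'a ^ 'n \<Rightarrow> 'k poly set" where
  "HN_fibre \<theta> V x = HN_sub Z (translate x V) \<theta> 0"

lemma fib_translate [simp]: "fib (translate x V) q = fib V (x + q)"
  and tmap_translate [simp]: "tmap (translate x V) q r = tmap V (x + q) (x + r)"
  by (simp_all add: translate_def pullback_def)

lemma HN_rank_eq:
  "x \<le> y \<Longrightarrow> HN_rank Z V \<theta> x y = enat (amb.dim (tmap V x y ` HN_fibre \<theta> V x))"
  "\<not> x \<le> y \<Longrightarrow> HN_rank Z V \<theta> x y = \<infinity>"
  by (simp_all add: HN_rank_def HN_fibre_def)

lemma HN_fibre_sub:
  assumes "V \<in> Pers_fp"
  shows "fin_dim_subspace (HN_fibre \<theta> V x)" "HN_fibre \<theta> V x \<subseteq> fib V x"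
proof -
  have "fp_sub (translate x V) (HN_sub Z (translate x V) \<theta>)"
    using largest_max_HN_sub[OF translate_Pers_fp[OF assms]] by (simp add: largest_max_def)
  from PersD(1)[OF fp_subD(2)[OF this], of 0] fp_sub_subset[OF this, of 0]
  show "fin_dim_subspace (HN_fibre \<theta> V x)" "HN_fibre \<theta> V x \<subseteq> fib V x"
    by (simp_all add: HN_fibre_def)
qed

text \<open>
  All inequalities between ranks come from factoring the map of larger source and target: if \<open>m'\<close> is
  \<open>k \<circ> m \<circ> h\<close> and \<open>h\<close> respects the filtrations, the rank of \<open>m'\<close> is at most that of \<open>m\<close>.
\<close>

lemma HN_rank_le:
  assumes V: "V \<in> Pers_fp" and W: "W \<in> Pers_fp"
    and h: "pers_hom (translate x V) (translate x' W) h"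
    and xy: "x \<le> y" "x' \<le> y'" and k: "linear_between (fib W y') (fib V y) k"
    and fac: "\<And>v. v \<in> fib V x \<Longrightarrow> tmap V x y v = k (tmap W x' y' (h 0 v))"
  shows "HN_rank Z V \<theta> x y \<le> HN_rank Z W \<theta> x' y'"
proof -
  let ?A = "HN_fibre \<theta> V x" and ?B = "HN_fibre \<theta> W x'"
  have sub: "h 0 ` ?A \<subseteq> ?B"
    unfolding HN_fibre_def by (rule HN_sub_hom[OF translate_Pers_fp[OF V] translate_Pers_fp[OF W] h])
  note B = HN_fibre_sub[OF W, of \<theta> x']
  have linm: "linear_between ?B (fib W y') (tmap W x' y')"
    by (rule linear_between_restrict[OF PersD(4)[OF Pers_fp_imp_Pers[OF W] xy(2)] B(2)])
  let ?C = "tmap W x' y' ` ?B"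
  have C: "fin_dim_subspace ?C" by (rule fin_dim_linear_image[OF linm B(1)])
  have linC: "linear_between ?C (fib V y) k"
    by (rule linear_between_restrict[OF k linear_between_image(1)[OF linm]])
  have "tmap V x y ` ?A \<subseteq> k ` ?C"
  proof
    fix w assume "w \<in> tmap V x y ` ?A"
    then obtain v where v: "v \<in> ?A" "w = tmap V x y v" by blast
    then have "v \<in> fib V x" using HN_fibre_sub(2)[OF V] by blast
    then have "w = k (tmap W x' y' (h 0 v))" using fac v(2) by simp
    then show "w \<in> k ` ?C" using sub v(1) by blast
  qed
  then have "amb.dim (tmap V x y ` ?A) \<le> amb.dim (k ` ?C)"
    by (rule dim_mono_fin_dim[OF fin_dim_linear_image[OF linC C]])
  also have "\<dots> \<le> amb.dim ?C" by (rule dim_linear_image_le[OF linC C])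
  finally show ?thesis using xy by (simp add: HN_rank_eq)
qed

lemma translate_hom:
  fixes V :: "('a ^ 'n, 'k) pmod"
  assumes V: "V \<in> Pers" and x: "x \<le> x'"
  shows "pers_hom (translate x V) (translate x' V) (\<lambda>q. tmap V (x + q) (x' + q))"
proof -
  have le_x: "x + q \<le> x' + q" for q using x by (simp add: less_eq_vec_def)
  have le: "x + q \<le> x + r" "x' + q \<le> x' + r" if "q \<le> r" for q r
    using that by (simp_all add: less_eq_vec_def)
  show ?thesis
  proof (rule pers_homI)
    show "linear_between (fib (translate x V) q) (fib (translate x' V) q) (tmap V (x + q) (x' + q))" for q
      using PersD(4)[OF V le_x] by simp
    show "tmap V (x + r) (x' + r) (tmap (translate x V) q r v) = tmap (translate x' V) q r (tmap V (x + q) (x' + q) v)"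
      if "q \<le> r" "v \<in> fib (translate x V) q" for q r v
      using that PersD(6)[OF V le(1)[OF that(1)] le_x] PersD(6)[OF V le_x le(2)[OF that(1)]] by simp
  qed
qed

lemma rank_functor_HN_rank:
  assumes V: "V \<in> Pers_fp"
  shows "rank_functor (HN_rank Z V \<theta>)"
  unfolding rank_functor_def
proof (intro allI impI)
  fix x x' y y' :: "'a ^ 'n" assume le: "x \<le> x'" "y' \<le> y"
  note P = Pers_fp_imp_Pers[OF V]
  show "HN_rank Z V \<theta> x y \<le> HN_rank Z V \<theta> x' y'"
  proof (cases "x' \<le> y'")
    case True
    have xy': "x \<le> y'" using le(1) True by (rule order_trans)
    show ?thesis
    proof (rule HN_rank_le[OF V V translate_hom[OF P le(1)] order_trans[OF xy' le(2)] True PersD(4)[OF P le(2)]])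
      fix v assume v: "v \<in> fib V x"
      show "tmap V x y v = tmap V y' y (tmap V x' y' (tmap V (x + 0) (x' + 0) v))"
        using PersD(6)[OF P le(1) True v] PersD(6)[OF P xy' le(2) v] by simp
    qed
  qed (simp add: HN_rank_eq)
qed

lemma translate_interleaving:
  fixes V W :: "('a ^ 'n, 'k) pmod"
  assumes "pers_hom V (translate (vec \<epsilon>) W) f"
  shows "pers_hom (translate x V) (translate (x + vec \<epsilon>) W) (\<lambda>q. f (x + q))"
proof (rule pers_homI)
  have eq: "vec \<epsilon> + (x + q) = x + vec \<epsilon> + q" for q :: "'a ^ 'n" by (simp add: add_ac)
  show "linear_between (fib (translate x V) q) (fib (translate (x + vec \<epsilon>) W) q) (f (x + q))" for q
    using pers_homD(1)[OF assms, of "x + q"] by (simp add: eq)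
  show "f (x + r) (tmap (translate x V) q r v) = tmap (translate (x + vec \<epsilon>) W) q r (f (x + q) v)"
    if "q \<le> r" "v \<in> fib (translate x V) q" for q r v
  proof -
    have "x + q \<le> x + r" using that(1) by (simp add: less_eq_vec_def)
    then show ?thesis using pers_homD(2)[OF assms, of "x + q" "x + r" v] that(2) by (simp add: eq)
  qed
qed

text \<open>
  The map of \<open>V\<close> over a pair enlarged by \<open>\<epsilon>\<close> on both sides factors through the map of \<open>W\<close> over
  the pair.
\<close>

lemma HN_rank_interleaving:
  assumes V: "V \<in> Pers_fp" and W: "W \<in> Pers_fp" and \<epsilon>: "0 \<le> \<epsilon>"
    and f: "pers_hom V (translate (vec \<epsilon>) W) f" and g: "pers_hom W (translate (vec \<epsilon>) V) g"
    and gf: "\<And>q v. v \<in> fib V q \<Longrightarrow> g (vec \<epsilon> + q) (f q v) = tmap V q (vec (2 * \<epsilon>) + q) v"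
  shows "HN_rank Z V \<theta> (a - vec \<epsilon>) (b + vec \<epsilon>) \<le> HN_rank Z W \<theta> a b"
proof (cases "a \<le> b")
  case ab: True
  note PV = Pers_fp_imp_Pers[OF V] and PW = Pers_fp_imp_Pers[OF W]
  let ?x = "a - vec \<epsilon>"
  have x_eq: "?x + vec \<epsilon> = a" "vec \<epsilon> + ?x = a" "vec (2 * \<epsilon>) + ?x = a + vec \<epsilon>"
    by (simp_all add: vec_eq_iff)
  have le: "?x \<le> b + vec \<epsilon>" "?x \<le> a + vec \<epsilon>" "a + vec \<epsilon> \<le> b + vec \<epsilon>"
  proof -
    have "a $ i - \<epsilon> \<le> b $ i + \<epsilon>" for i
    proof -
      have "a $ i \<le> b $ i" using ab by (simp add: less_eq_vec_def)
      then show ?thesis using \<epsilon> by linarith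
    qed
    then show "?x \<le> b + vec \<epsilon>" by (simp add: less_eq_vec_def)
    show "?x \<le> a + vec \<epsilon>" using \<epsilon> by (simp add: less_eq_vec_def diff_le_eq add_increasing2)
    show "a + vec \<epsilon> \<le> b + vec \<epsilon>" using ab by (simp add: less_eq_vec_def)
  qed
  show ?thesis
  proof (rule HN_rank_le[OF V W _ le(1) ab])
    show "pers_hom (translate ?x V) (translate a W) (\<lambda>q. f (?x + q))"
      using translate_interleaving[OF f, of ?x] by (simp add: x_eq)
    show "linear_between (fib W b) (fib V (b + vec \<epsilon>)) (g b)"
      using pers_homD(1)[OF g, of b] by (simp add: add.commute)
    fix v assume v: "v \<in> fib V ?x"
    have fv: "f ?x v \<in> fib W a" using pers_homD(3)[OF f v] by (simp add: x_eq)
    have "g b (tmap W a b (f ?x v)) = tmap V (a + vec \<epsilon>) (b + vec \<epsilon>) (g a (f ?x v))"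
      using pers_homD(2)[OF g ab fv] by (simp add: add.commute)
    also have "g a (f ?x v) = tmap V ?x (a + vec \<epsilon>) v"
      using gf[OF v] by (simp add: x_eq)
    also have "tmap V (a + vec \<epsilon>) (b + vec \<epsilon>) (tmap V ?x (a + vec \<epsilon>) v) = tmap V ?x (b + vec \<epsilon>) v"
      by (rule PersD(6)[OF PV le(2,3) v])
    finally show "tmap V ?x (b + vec \<epsilon>) v = g b (tmap W a b (f (?x + 0) v))" by simp
  qed
qed (simp add: HN_rank_eq)

lemma d_E_le_d_I:
  assumes V: "V \<in> Pers_fp" and W: "W \<in> Pers_fp"
  shows "d_E (HN_rank Z V \<theta>) (HN_rank Z W \<theta>) \<le> d_I V W"
  unfolding d_E_def d_I_def
proof (rule Inf_superset_mono, rule subsetI)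
  fix e assume "e \<in> {ereal (real_of_coord \<epsilon>) | \<epsilon>. 0 \<le> \<epsilon> \<and> (\<exists>f g. interleaving \<epsilon> V W f g)}"
  then obtain \<epsilon> f g where e: "e = ereal (real_of_coord \<epsilon>)" "0 \<le> \<epsilon>" and fg: "interleaving \<epsilon> V W f g" by blast
  have "HN_rank Z V \<theta> (a - vec \<epsilon>) (b + vec \<epsilon>) \<le> HN_rank Z W \<theta> a b" for a b
    by (rule HN_rank_interleaving[OF V W e(2), of f g]) (use fg in \<open>auto simp: interleaving_def\<close>)
  moreover have "HN_rank Z W \<theta> (a - vec \<epsilon>) (b + vec \<epsilon>) \<le> HN_rank Z V \<theta> a b" for a b
    by (rule HN_rank_interleaving[OF W V e(2), of g f]) (use fg in \<open>auto simp: interleaving_def\<close>)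
  ultimately show "e \<in> {ereal (real_of_coord \<epsilon>) | \<epsilon>. 0 \<le> \<epsilon> \<and>
     (\<forall>a b. HN_rank Z V \<theta> (a - vec \<epsilon>) (b + vec \<epsilon>) \<le> HN_rank Z W \<theta> a b \<and>
        HN_rank Z W \<theta> (a - vec \<epsilon>) (b + vec \<epsilon>) \<le> HN_rank Z V \<theta> a b)}"
    using e by blast
qed

end

lemma Z_all_HN_stability:
  fixes Z :: "('a::measured_coord ^ 'n::finite, 'k::field) stab"
  assumes "Z \<in> Z_all"
  shows "HN_stability Z"
proof -
  obtain G G' a b lam where "integral_stability G G' Z a b lam" by (rule Z_all_integral_stability[OF assms])
  then interpret integral_stability G G' Z a b lam .
  show ?thesis by unfold_locales (rule HN_filtration_exists)
qed

lemma HN_rank_stable: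
  fixes Z :: "('a::measured_coord ^ 'n::finite, 'k::field) stab"
  assumes Z: "Z \<in> Z_all" and V: "V \<in> Pers_fp" and W: "W \<in> Pers_fp"
  shows "(\<forall>\<theta>. rank_functor (HN_rank Z V \<theta>) \<and> rank_functor (HN_rank Z W \<theta>)) \<and>
    (SUP \<theta>. d_E (HN_rank Z V \<theta>) (HN_rank Z W \<theta>)) \<le> d_I V W"
proof -
  interpret HN_stability Z by (rule Z_all_HN_stability[OF Z])
  show ?thesis using rank_functor_HN_rank[OF V] rank_functor_HN_rank[OF W] d_E_le_d_I[OF V W]
    by (auto intro: SUP_least)
qed

theorem theorem3p7:
  shows
    "(\<forall>(Z :: (real ^ 'n::finite, 'k::field) stab) V W.
        Z \<in> Z_all \<longrightarrow> V \<in> Pers_fp \<longrightarrow> W \<in> Pers_fp \<longrightarrow>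
          (\<forall>\<theta>. rank_functor (HN_rank Z V \<theta>) \<and> rank_functor (HN_rank Z W \<theta>)) \<and>
          (SUP \<theta>. d_E (HN_rank Z V \<theta>) (HN_rank Z W \<theta>)) \<le> d_I V W) \<and>
     (\<forall>(Z :: (int ^ 'n, 'k) stab) V W.
        Z \<in> Z_all \<longrightarrow> V \<in> Pers_fp \<longrightarrow> W \<in> Pers_fp \<longrightarrow>
          (\<forall>\<theta>. rank_functor (HN_rank Z V \<theta>) \<and> rank_functor (HN_rank Z W \<theta>)) \<and>
          (SUP \<theta>. d_E (HN_rank Z V \<theta>) (HN_rank Z W \<theta>)) \<le> d_I V W)"
  by (intro conjI allI impI) (simp_all add: HN_rank_stable)

end
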